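(* Let $(s_1,s_2)\in\mathbb{R}^2$, $-1\le\alpha<0$ and let $T$ be a positive real number. Then there does not exist a space $X_T$ continuously embedded in $C([-T,T];H^{s_1,s_2}(\mathbb{R}^2))$ such that, for a fixed constant $C$, $$\|W_\alpha(\cdot)\phi\|_{X_T}\le C\|\phi\|_{H^{s_1,s_2}}\qquad\text{for all }\phi\in H^{s_1,s_2}(\mathbb{R}^2),$$ and $$\left\|\int_0^tW_\alpha(t-t')\big(u(t')u_x(t')\big)\,dt'\right\|_{X_T}\le C\|u\|_{X_T}^2\qquad\text{for all }u\in X_T.$$
   Context: Functions are of $(x,y)\in\mathbb{R}^2$ with dual Fourier variables $(\xi,\eta)$; $\langle a\rangle=(1+a^2)^{1/2}$. $H^{s_1,s_2}(\mathbb{R}^2)$ is the space of tempered distributions with $\|f\|_{H^{s_1,s_2}}^2=\int(\langle\xi\rangle^{2s_1}+\langle\eta\rangle^{2s_2})|\widehat f(\xi,\eta)|^2d\xi d\eta<\infty$. $W_\alpha(t)$ is the Fourier multiplier operator with symbol $e^{-it(\xi^3+\mathrm{sgn}(\xi)|\xi|^\alpha\eta^2)}$, i.e. the unitary group of the linear equation $u_t=u_{xxx}-\mathscr{H}D_x^\alpha u_{yy}$ ($\mathscr{H}$ the Hilbert transform in $x$, symbol $-i\,\mathrm{sgn}(\xi)$; $D_x^\alpha$ with symbol $|\xi|^\alpha$). $X_T$ is a normed space of functions with norm $\|\cdot\|_{X_T}$. *)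

theory Defs
  imports "HOL-Analysis.Analysis"
begin

section \<open>Schwartz functions and tempered distributions on the plane\<close>

type_synonym plane_fun = "real \<times> real \<Rightarrow> complex"

definition x_deriv :: "plane_fun \<Rightarrow> plane_fun" where
  "x_deriv f = (\<lambda>(x, y). vector_derivative (\<lambda>r. f (r, y)) (at x))"

definition y_deriv :: "plane_fun \<Rightarrow> plane_fun" where
  "y_deriv f = (\<lambda>(x, y). vector_derivative (\<lambda>r. f (x, r)) (at y))"

definition mixed_deriv :: "nat \<Rightarrow> nat \<Rightarrow> plane_fun \<Rightarrow> plane_fun" where
  "mixed_deriv j k f = (x_deriv ^^ j) ((y_deriv ^^ k) f)"

text \<open>Since every \<^term>\<open>mixed_deriv j k f\<close> is required to be (totally) differentiable, the order in
  which the partial derivatives are taken is immaterial and \<^term>\<open>f\<close> is smooth.\<close>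

definition schwartz :: "plane_fun \<Rightarrow> bool" where
  "schwartz f \<longleftrightarrow>
     (\<forall>j k. (\<forall>z. mixed_deriv j k f differentiable (at z)) \<and>
            (\<forall>m::nat. bdd_above (range (\<lambda>z. (1 + norm z) ^ m * cmod (mixed_deriv j k f z)))))"

definition schwartz_seminorm :: "nat \<Rightarrow> plane_fun \<Rightarrow> real" where
  "schwartz_seminorm m f =
     (\<Sum>j\<le>m. \<Sum>k\<le>m. SUP z. (1 + norm z) ^ m * cmod (mixed_deriv j k f z))"

text \<open>A distribution is a functional on all functions; a tempered one is a continuous linear
  functional on the Schwartz space. Requiring the junk value 0 off the Schwartz space makes equality
  of functionals the equality of tempered distributions.\<close>

type_synonym dist = "plane_fun \<Rightarrow> complex"

definition tempered :: "dist \<Rightarrow> bool" where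
  "tempered u \<longleftrightarrow>
     (\<forall>f g a b. schwartz f \<longrightarrow> schwartz g \<longrightarrow> u (\<lambda>z. a * f z + b * g z) = a * u f + b * u g) \<and>
     (\<exists>m C. \<forall>f. schwartz f \<longrightarrow> cmod (u f) \<le> C * schwartz_seminorm m f) \<and>
     (\<forall>f. \<not> schwartz f \<longrightarrow> u f = 0)"

text \<open>\<open>regular u f\<close>: the distribution \<open>u\<close> is (integration against) the function \<open>f\<close>. Such an \<open>f\<close> is
  locally integrable and determined by \<open>u\<close> up to a null set.\<close>

definition regular :: "dist \<Rightarrow> plane_fun \<Rightarrow> bool" where
  "regular u f \<longleftrightarrow>
     f \<in> borel_measurable borel \<and>
     (\<forall>\<psi>. schwartz \<psi> \<longrightarrow> integrable lborel (\<lambda>z. f z * \<psi> z)) \<and>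
     u = (\<lambda>\<psi>. if schwartz \<psi> then LINT z|lborel. f z * \<psi> z else 0)"

definition dist_x_deriv :: "dist \<Rightarrow> dist" where
  "dist_x_deriv u = (\<lambda>\<psi>. if schwartz \<psi> then - u (x_deriv \<psi>) else 0)"

definition is_product :: "dist \<Rightarrow> dist \<Rightarrow> dist \<Rightarrow> bool" where
  "is_product u v p \<longleftrightarrow>
     tempered p \<and> (\<exists>f g. regular u f \<and> regular v g \<and> regular p (\<lambda>z. f z * g z))"


section \<open>Fourier transform and Fourier multipliers\<close>

definition fourier :: "plane_fun \<Rightarrow> plane_fun" where
  "fourier f = (\<lambda>\<zeta>. LINT z|lborel. cis (- (z \<bullet> \<zeta>)) * f z)"

definition dist_fourier :: "dist \<Rightarrow> dist" where
  "dist_fourier u = (\<lambda>\<psi>. if schwartz \<psi> then u (fourier \<psi>) else 0)"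

definition fourier_fun :: "dist \<Rightarrow> plane_fun" where
  "fourier_fun u = (SOME g. regular (dist_fourier u) g)"

text \<open>Meaningful for tempered \<open>u\<close> whose Fourier transform is a function.\<close>

definition fourier_multiplier :: "plane_fun \<Rightarrow> dist \<Rightarrow> dist" where
  "fourier_multiplier m u =
     (THE v. tempered v \<and> regular (dist_fourier v) (\<lambda>\<zeta>. m \<zeta> * fourier_fun u \<zeta>))"

definition W :: "real \<Rightarrow> real \<Rightarrow> dist \<Rightarrow> dist" where
  "W \<alpha> t = fourier_multiplier (\<lambda>(\<xi>, \<eta>). cis (- t * (\<xi> ^ 3 + sgn \<xi> * \<bar>\<xi>\<bar> powr \<alpha> * \<eta>\<^sup>2)))"


section \<open>Anisotropic Sobolev spaces\<close>

definition japanese_bracket :: "real \<Rightarrow> real" where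
  "japanese_bracket a = sqrt (1 + a\<^sup>2)"

definition sobolev_weight :: "real \<Rightarrow> real \<Rightarrow> real \<times> real \<Rightarrow> real" where
  "sobolev_weight s1 s2 = (\<lambda>(\<xi>, \<eta>).
     japanese_bracket \<xi> powr (2 * s1) + japanese_bracket \<eta> powr (2 * s2))"

definition sobolev :: "real \<Rightarrow> real \<Rightarrow> dist set" where
  "sobolev s1 s2 =
     {u. tempered u \<and> (\<exists>g. regular (dist_fourier u) g \<and>
            integrable lborel (\<lambda>\<zeta>. sobolev_weight s1 s2 \<zeta> * (cmod (g \<zeta>))\<^sup>2))}"

definition sobolev_norm :: "real \<Rightarrow> real \<Rightarrow> dist \<Rightarrow> real" where
  "sobolev_norm s1 s2 u =
     sqrt (LINT \<zeta>|lborel. sobolev_weight s1 s2 \<zeta> * (cmod (fourier_fun u \<zeta>))\<^sup>2)"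


section \<open>Spaces of functions of time\<close>

text \<open>A function on \<open>[-T,T]\<close> with values in distributions is represented by its extension by 0 to
  the whole line.\<close>

definition on_interval :: "real \<Rightarrow> (real \<Rightarrow> dist) \<Rightarrow> (real \<Rightarrow> dist)" where
  "on_interval T u = (\<lambda>t. if t \<in> {-T..T} then u t else (\<lambda>\<psi>. 0))"

definition C_sobolev :: "real \<Rightarrow> real \<Rightarrow> real \<Rightarrow> (real \<Rightarrow> dist) set" where
  "C_sobolev T s1 s2 =
     {u. on_interval T u = u \<and>
         (\<forall>t\<in>{-T..T}. u t \<in> sobolev s1 s2) \<and>
         (\<forall>t\<in>{-T..T}. ((\<lambda>r. sobolev_norm s1 s2 (\<lambda>\<psi>. u r \<psi> - u t \<psi>)) \<longlongrightarrow> 0)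
            (at t within {-T..T}))}"

text \<open>Real scalars: this includes all complex normed spaces.\<close>

definition normed_function_space :: "(real \<Rightarrow> dist) set \<Rightarrow> ((real \<Rightarrow> dist) \<Rightarrow> real) \<Rightarrow> bool" where
  "normed_function_space X nX \<longleftrightarrow>
     (\<lambda>t \<psi>. 0) \<in> X \<and>
     (\<forall>u\<in>X. \<forall>v\<in>X. (\<lambda>t \<psi>. u t \<psi> + v t \<psi>) \<in> X) \<and>
     (\<forall>c::real. \<forall>u\<in>X. (\<lambda>t \<psi>. of_real c * u t \<psi>) \<in> X) \<and>
     (\<forall>u\<in>X. 0 \<le> nX u \<and> (nX u = 0 \<longleftrightarrow> u = (\<lambda>t \<psi>. 0))) \<and>
     (\<forall>u\<in>X. \<forall>v\<in>X. nX (\<lambda>t \<psi>. u t \<psi> + v t \<psi>) \<le> nX u + nX v) \<and>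
     (\<forall>c::real. \<forall>u\<in>X. nX (\<lambda>t \<psi>. of_real c * u t \<psi>) = \<bar>c\<bar> * nX u)"

definition continuously_embedded ::
    "real \<Rightarrow> real \<Rightarrow> real \<Rightarrow> (real \<Rightarrow> dist) set \<Rightarrow> ((real \<Rightarrow> dist) \<Rightarrow> real) \<Rightarrow> bool" where
  "continuously_embedded T s1 s2 X nX \<longleftrightarrow>
     X \<subseteq> C_sobolev T s1 s2 \<and>
     (\<exists>K. \<forall>u\<in>X. \<forall>t\<in>{-T..T}. sobolev_norm s1 s2 (u t) \<le> K * nX u)"


section \<open>The Duhamel term\<close>

text \<open>\<open>is_duhamel \<alpha> T u D\<close>: the integral over \<open>t'\<close> from 0 to \<open>t\<close> of \<open>W(t-t')(u(t') u_x(t'))\<close> is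
  meaningful for all \<open>t \<in> [-T,T]\<close> and equals \<open>D t\<close>. The nonlinearity \<open>N\<close> has to be a product of
  functions (for a rough \<open>u\<close> there need not be one) whose Fourier transform is a function, so that
  \<open>W\<close> acts on it; the integral is taken weakly, that is, tested against Schwartz functions.\<close>

definition is_duhamel :: "real \<Rightarrow> real \<Rightarrow> (real \<Rightarrow> dist) \<Rightarrow> (real \<Rightarrow> dist) \<Rightarrow> bool" where
  "is_duhamel \<alpha> T u D \<longleftrightarrow>
     (\<exists>N. (AE r in lborel. r \<in> {-T..T} \<longrightarrow>
             is_product (u r) (dist_x_deriv (u r)) (N r) \<and>
             (\<exists>g. regular (dist_fourier (N r)) g)) \<and>
          (\<forall>t\<in>{-T..T}. \<forall>\<psi>. schwartz \<psi> \<longrightarrow>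
             interval_lebesgue_integrable lborel (ereal 0) (ereal t) (\<lambda>r. W \<alpha> (t - r) (N r) \<psi>)) \<and>
          D = on_interval T (\<lambda>t \<psi>. if schwartz \<psi>
                then LBINT r=ereal 0..ereal t. W \<alpha> (t - r) (N r) \<psi> else 0))"

end

theory Submission
  imports Defs "HOL-Probability.Characteristic_Functions" "HOL-Probability.Sinc_Integral"
begin

text \<open>
  The two hypotheses combine into a bilinear estimate for the second Picard iterate: the Sobolev norm of
  the Duhamel term of the free evolution of \<open>\<phi>\<close> at time \<open>T\<close> is at most a constant times the squared
  norm of \<open>\<phi>\<close>. It fails for a high-low frequency interaction. Let \<open>\<phi>\<close> have as Fourier transform the
  indicator of a box of size \<open>c \<times> b\<close> near \<open>(0, 0)\<close> plus a multiple of the indicator of a comparable box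
  near \<open>(N, M)\<close>. Because \<open>\<alpha> < 0\<close>, the choice \<open>M\<^sup>2 = (3 / -\<alpha>) N\<^bsup>3 - \<alpha>\<^esup>\<close> cancels the leading term of the
  resonance function, which then stays below \<open>1 / T\<close> on the two boxes for \<open>c = \<epsilon> N\<^bsup>-1/2\<^esup>\<close> and
  \<open>b = \<epsilon> N\<^bsup>-(3 + \<alpha>)/2\<^esup>\<close>. The time integral does not oscillate, the derivative contributes a factor \<open>N\<close>, and
  the estimate would force \<open>N\<^sup>2 c b = \<epsilon>\<^sup>2 N\<^bsup>-\<alpha>/2\<^esup>\<close> to remain bounded as \<open>N\<close> grows.
\<close>

section \<open>Schwartz functions\<close>

text \<open>To first order in the low frequency x, the resonance function at the high frequency (N,
  M) is x times 3 N^2 + \<alpha> N^(\<alpha> - 1) M^2, and M is the zero of this factor. The sides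
  of the boxes are what the remaining errors allow: c^2 N comes from varying the high \<xi>,
  N^\<alpha> b M from the cross term in \<eta>, and both have to be of order \<epsilon>. The low box
  also has to stay off the axis \<xi> = 0, where |\<xi>|^\<alpha> is singular. The exponents s1 and
  s2 cancel because the high input and the output both sit near (N, M), and the high bump is
  normalised by the weight there. The other obstacle is that multipliers and norms are defined on
  tempered distributions through \<open>SOME\<close> and \<open>THE\<close>. The argument therefore
  works with distributions \<open>spectral_dist g\<close> for integrable g, and a uniqueness theorem
  for regular distributions, proved with Gaussians as the only test functions, turns each definition
  into an explicit operation on g.\<close>

lemma has_x_deriv:
  assumes "f differentiable (at (x, y))"
  shows "((\<lambda>r. f (r, y)) has_vector_derivative x_deriv f (x, y)) (at x)"
proof -
  have "(\<lambda>r. f (r, y)) differentiable (at x)"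
    using assms by (intro differentiable_compose[of f "\<lambda>r. (r, y)"]) (auto intro!: differentiable_Pair)
  then show ?thesis
    by (simp add: x_deriv_def vector_derivative_works)
qed

lemma has_y_deriv:
  assumes "f differentiable (at (x, y))"
  shows "((\<lambda>r. f (x, r)) has_vector_derivative y_deriv f (x, y)) (at y)"
proof -
  have "(\<lambda>r. f (x, r)) differentiable (at y)"
    using assms by (intro differentiable_compose[of f "\<lambda>r. (x, r)"]) (auto intro!: differentiable_Pair)
  then show ?thesis
    by (simp add: y_deriv_def vector_derivative_works)
qed

lemma x_deriv_eqI:
  assumes "\<And>x y. ((\<lambda>r. f (r, y)) has_vector_derivative g (x, y)) (at x)"
  shows "x_deriv f = g"
  using assms by (auto simp: x_deriv_def fun_eq_iff intro!: vector_derivative_at)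

lemma y_deriv_eqI:
  assumes "\<And>x y. ((\<lambda>r. f (x, r)) has_vector_derivative g (x, y)) (at y)"
  shows "y_deriv f = g"
  using assms by (auto simp: y_deriv_def fun_eq_iff intro!: vector_derivative_at)

text \<open>A predicate stable under both derivations contains every
  \<open>mixed_deriv j k f\<close>, so differentiability and decay need checking only for its
  members, without formulas for higher derivatives. It is applied to \<open>schwartz_closure\<close>
  and to the set of Fourier transforms of Schwartz functions.\<close>

lemma schwartz_coinduct:
  assumes "P f"
    and "\<And>g z. P g \<Longrightarrow> g differentiable (at z)"
    and "\<And>g m. P g \<Longrightarrow> bdd_above (range (\<lambda>z. (1 + norm z) ^ m * cmod (g z)))"
    and "\<And>g. P g \<Longrightarrow> P (x_deriv g)"
    and "\<And>g. P g \<Longrightarrow> P (y_deriv g)"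
  shows "schwartz f"
proof -
  have y: "P ((y_deriv ^^ k) f)" for k
    by (induction k) (use assms in auto)
  have "P (mixed_deriv j k f)" for j k
    unfolding mixed_deriv_def by (induction j) (use assms y in auto)
  then show ?thesis
    using assms by (simp add: schwartz_def)
qed

lemma mixed_deriv_0_0 [simp]: "mixed_deriv 0 0 f = f"
  by (simp add: mixed_deriv_def)

lemma schwartz_imp_differentiable:
  assumes "schwartz f"
  shows "f differentiable (at z)"
  using assms by (metis mixed_deriv_0_0 schwartz_def)

lemma schwartz_imp_bdd_above:
  assumes "schwartz f"
  shows "bdd_above (range (\<lambda>z. (1 + norm z) ^ m * cmod (f z)))"
  using assms by (metis mixed_deriv_0_0 schwartz_def)

text \<open>f(r, t) is f(r, a) plus the integral of \<open>y_deriv f\<close> over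
  \<open>{a..t}\<close>; differentiate under the integral in r, then in t by the fundamental
  theorem. The asymmetric hypotheses match \<open>schwartz\<close>, where y-derivatives are taken
  before x-derivatives.\<close>

lemma mixed_partials_commute:
  assumes f: "\<And>z. f differentiable (at z)"
    and fy: "\<And>z. y_deriv f differentiable (at z)"
    and fxy: "\<And>z. x_deriv (y_deriv f) differentiable (at z)"
  shows "y_deriv (x_deriv f) = x_deriv (y_deriv f)"
proof (rule y_deriv_eqI)
  fix x y :: real
  let ?g = "x_deriv (y_deriv f)"
  \<comment> \<open>Any window with y in its interior serves: the integral formula holds for t above
    a only, and interiority turns the derivative within \<open>{a..b}\<close> into a full
    one.\<close>
  define a b where "a = y - 1" and "b = y + 1"
  have cont: "continuous_on UNIV h" if "\<And>z. h differentiable (at z)" for h :: plane_fun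
    using that by (intro continuous_at_imp_continuous_on) (auto intro: differentiable_imp_continuous_within)
  have eq: "x_deriv f (x, t) = x_deriv f (x, a) + integral {a..t} (\<lambda>s. ?g (x, s))" if "a \<le> t" for t
  proof -
    have ftc: "((\<lambda>s. y_deriv f (r, s)) has_integral f (r, t) - f (r, a)) {a..t}" for r
      using that f
      by (intro fundamental_theorem_of_calculus)
         (auto intro!: has_vector_derivative_at_within has_y_deriv)
    have "((\<lambda>r. integral (cbox a t) (\<lambda>s. y_deriv f (r, s))) has_vector_derivative
            integral (cbox a t) (\<lambda>s. ?g (x, s))) (at x within UNIV)"
    proof (rule leibniz_rule_vector_derivative)
      show "continuous_on (UNIV \<times> cbox a t) (\<lambda>(r, s). ?g (r, s))"
        using cont[OF fxy] by (auto intro: continuous_on_subset)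
      show "(\<lambda>s. y_deriv f (r, s)) integrable_on cbox a t" for r
        using ftc[of r] by (auto simp: integrable_on_def)
    qed (use fy has_x_deriv in auto)
    then have "((\<lambda>r. f (r, a) + integral {a..t} (\<lambda>s. y_deriv f (r, s))) has_vector_derivative
            x_deriv f (x, a) + integral {a..t} (\<lambda>s. ?g (x, s))) (at x)"
      using f by (intro has_vector_derivative_add has_x_deriv) auto
    moreover have "f (r, a) + integral {a..t} (\<lambda>s. y_deriv f (r, s)) = f (r, t)" for r
      using ftc[of r] by (simp add: integral_unique)
    ultimately show ?thesis
      by (simp add: x_deriv_def vector_derivative_at)
  qed
  have "((\<lambda>t. integral {a..t} (\<lambda>s. ?g (x, s))) has_vector_derivative ?g (x, y)) (at y within {a..b})"
  proof (rule integral_has_vector_derivative)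
    show "continuous_on {a..b} (\<lambda>s. ?g (x, s))"
      by (intro continuous_on_compose2[OF cont[OF fxy]] continuous_intros) auto
  qed (auto simp: a_def b_def)
  then have "((\<lambda>t. x_deriv f (x, a) + integral {a..t} (\<lambda>s. ?g (x, s))) has_vector_derivative ?g (x, y))
      (at y within {a..b})"
    by (auto intro!: derivative_eq_intros)
  moreover have "y \<in> {a..b}"
    by (simp add: a_def b_def)
  moreover have "x_deriv f (x, t) = x_deriv f (x, a) + integral {a..t} (\<lambda>s. ?g (x, s))" if "t \<in> {a..b}" for t
    using that by (intro eq) simp
  ultimately have "((\<lambda>t. x_deriv f (x, t)) has_vector_derivative ?g (x, y)) (at y within {a..b})"
    by (metis (no_types, lifting) has_vector_derivative_transform)
  then have "((\<lambda>t. x_deriv f (x, t)) has_vector_derivative ?g (x, y)) (at y within {a<..<b})"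
    by (rule has_vector_derivative_within_subset) auto
  then show "((\<lambda>t. x_deriv f (x, t)) has_vector_derivative ?g (x, y)) (at y)"
    by (subst (asm) has_vector_derivative_within_open) (auto simp: a_def b_def)
qed

lemma schwartz_y_deriv:
  assumes "schwartz f"
  shows "schwartz (y_deriv f)"
proof -
  have "mixed_deriv j k (y_deriv f) = mixed_deriv j (Suc k) f" for j k
    by (simp add: mixed_deriv_def funpow_swap1)
  then show ?thesis
    using assms by (simp add: schwartz_def)
qed

text \<open>\<open>mixed_deriv\<close> applies x-derivatives outermost, so the new one has to be
  moved past all y-derivatives, one at a time.\<close>

lemma schwartz_x_deriv:
  assumes "schwartz f"
  shows "schwartz (x_deriv f)"
proof -
  have diff: "mixed_deriv j k f differentiable (at z)" for j k z
    using assms unfolding schwartz_def by blast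
  have "(y_deriv ^^ k) (x_deriv f) = x_deriv ((y_deriv ^^ k) f)" for k
  proof (induction k)
    case (Suc k)
    have "y_deriv (x_deriv ((y_deriv ^^ k) f)) = x_deriv (y_deriv ((y_deriv ^^ k) f))"
      using diff[of 0 k] diff[of 0 "Suc k"] diff[of 1 "Suc k"]
      by (intro mixed_partials_commute) (auto simp: mixed_deriv_def)
    then show ?case
      by (simp add: Suc)
  qed simp
  then have "mixed_deriv j k (x_deriv f) = mixed_deriv (Suc j) k f" for j k
    by (simp add: mixed_deriv_def funpow_swap1)
  then show ?thesis
    using assms by (simp add: schwartz_def)
qed

section \<open>Gaussians and a class of test functions closed under differentiation\<close>

definition gaussian :: "real \<Rightarrow> real \<times> real \<Rightarrow> plane_fun" where
  "gaussian p b = (\<lambda>z. of_real (exp (b \<bullet> z - p * (z \<bullet> z))))"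

text \<open>Built so that the product rule and the derivatives of a Gaussian stay within the
  constructors. Stability under both derivations is then an induction, and
  \<open>schwartz_coinduct\<close> gives the Schwartz property for the whole class.\<close>

inductive schwartz_closure :: "plane_fun \<Rightarrow> bool" where
  schwartz: "schwartz f \<Longrightarrow> schwartz_closure f"
| gaussian: "0 < p \<Longrightarrow> schwartz_closure (gaussian p b)"
| mult_fst: "schwartz_closure f \<Longrightarrow> schwartz_closure (\<lambda>z. of_real (fst z) * f z)"
| mult_snd: "schwartz_closure f \<Longrightarrow> schwartz_closure (\<lambda>z. of_real (snd z) * f z)"
| lincomb: "schwartz_closure f \<Longrightarrow> schwartz_closure g \<Longrightarrow> schwartz_closure (\<lambda>z. a * f z + b * g z)"

lemma differentiable_of_real [simp]: "of_real differentiable F"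
  by (rule bounded_linear_imp_differentiable) (rule bounded_linear_of_real)

lemma differentiable_gaussian: "gaussian p b differentiable (at z)"
proof -
  have "((\<lambda>z. exp (b \<bullet> z - p * (z \<bullet> z))) has_derivative
      (\<lambda>h. exp (b \<bullet> z - p * (z \<bullet> z)) * (b \<bullet> h - p * (2 * (z \<bullet> h))))) (at z)"
    by (auto intro!: derivative_eq_intros simp: inner_commute)
  then have "(\<lambda>z. exp (b \<bullet> z - p * (z \<bullet> z))) differentiable (at z)"
    by (rule differentiableI)
  then show ?thesis
    unfolding gaussian_def
    by (intro differentiable_compose[OF differentiable_of_real])
qed

lemma x_deriv_gaussian:
  "x_deriv (gaussian p b) =
    (\<lambda>z. of_real (- 2 * p) * (of_real (fst z) * gaussian p b z) + of_real (fst b) * gaussian p b z)"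
proof (rule x_deriv_eqI)
  fix x y :: real
  have "((\<lambda>r. exp (b \<bullet> (r, y) - p * ((r, y) \<bullet> (r, y)))) has_real_derivative
      (fst b - 2 * p * x) * exp (b \<bullet> (x, y) - p * ((x, y) \<bullet> (x, y)))) (at x)"
    unfolding inner_prod_def inner_real_def fst_conv snd_conv
    by (rule derivative_eq_intros refl | simp add: algebra_simps)+
  then show "((\<lambda>r. gaussian p b (r, y)) has_vector_derivative
      of_real (- 2 * p) * (of_real (fst (x, y)) * gaussian p b (x, y)) + of_real (fst b) * gaussian p b (x, y)) (at x)"
    unfolding gaussian_def
    by (auto simp: algebra_simps dest!: has_vector_derivative_of_real)
qed

lemma y_deriv_gaussian:
  "y_deriv (gaussian p b) =
    (\<lambda>z. of_real (- 2 * p) * (of_real (snd z) * gaussian p b z) + of_real (snd b) * gaussian p b z)"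
proof (rule y_deriv_eqI)
  fix x y :: real
  have "((\<lambda>r. exp (b \<bullet> (x, r) - p * ((x, r) \<bullet> (x, r)))) has_real_derivative
      (snd b - 2 * p * y) * exp (b \<bullet> (x, y) - p * ((x, y) \<bullet> (x, y)))) (at y)"
    unfolding inner_prod_def inner_real_def fst_conv snd_conv
    by (rule derivative_eq_intros refl | simp add: algebra_simps)+
  then show "((\<lambda>r. gaussian p b (x, r)) has_vector_derivative
      of_real (- 2 * p) * (of_real (snd (x, y)) * gaussian p b (x, y)) + of_real (snd b) * gaussian p b (x, y)) (at y)"
    unfolding gaussian_def
    by (auto simp: algebra_simps dest!: has_vector_derivative_of_real)
qed

text \<open>For positive m, 1 + t \<le> m (1 + t / m) \<le> m exp (t / m), and the m-th power of the
  last exponential is exp t.\<close>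

lemma power_le_exp:
  fixes t :: real
  assumes "0 \<le> t"
  shows "(1 + t) ^ m \<le> real m ^ m * exp t"
proof (cases "m = 0")
  case False
  have "1 + t \<le> real m * (1 + t / real m)"
    using False by (simp add: algebra_simps)
  also have "\<dots> \<le> real m * exp (t / real m)"
    by (intro mult_left_mono) auto
  finally have "(1 + t) ^ m \<le> (real m * exp (t / real m)) ^ m"
    using assms by (intro power_mono) auto
  also have "\<dots> = real m ^ m * exp t"
    using False by (simp add: power_mult_distrib flip: exp_of_nat_mult)
  finally show ?thesis .
qed (use assms in auto)

text \<open>\<open>power_le_exp\<close> turns the polynomial weight into exp t with t the norm of z.
  What remains is the exponential of the quadratic c t - p t^2, bounded by its maximum c^2 / (4
  p).\<close>

lemma bdd_above_gaussian:
  assumes "0 < p"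
  shows "bdd_above (range (\<lambda>z. (1 + norm z) ^ m * cmod (gaussian p b z)))"
proof (rule bdd_aboveI2)
  fix z :: "real \<times> real"
  define t c where "t = norm z" and "c = norm b + 1"
  have "0 \<le> (2 * p * t - c)\<^sup>2"
    by simp
  then have "0 \<le> (4 * p\<^sup>2 * t\<^sup>2 - 4 * p * t * c + c\<^sup>2) / (4 * p)"
    using assms by (simp add: power2_eq_square algebra_simps)
  then have q: "c * t - p * t\<^sup>2 \<le> c\<^sup>2 / (4 * p)"
    using assms by (simp add: field_simps power2_eq_square)
  have "b \<bullet> z \<le> norm b * t"
    unfolding t_def by (rule norm_cauchy_schwarz)
  then have "t + (b \<bullet> z - p * (z \<bullet> z)) \<le> c * t - p * t\<^sup>2"
    by (simp add: c_def t_def power2_norm_eq_inner algebra_simps)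
  with q have "exp (t + (b \<bullet> z - p * (z \<bullet> z))) \<le> exp (c\<^sup>2 / (4 * p))"
    by simp
  moreover have "(1 + t) ^ m * cmod (gaussian p b z) \<le> real m ^ m * exp t * exp (b \<bullet> z - p * (z \<bullet> z))"
    unfolding gaussian_def by (simp add: t_def power_le_exp)
  ultimately show "(1 + norm z) ^ m * cmod (gaussian p b z) \<le> real m ^ m * exp (c\<^sup>2 / (4 * p))"
    unfolding t_def[symmetric] exp_add
    by (smt (verit) mult.assoc mult_left_mono of_nat_0_le_iff zero_le_power)
qed

lemma schwartz_closure_differentiable:
  "schwartz_closure f \<Longrightarrow> f differentiable (at z)"
proof (induction rule: schwartz_closure.induct)
  case (mult_fst f)
  then show ?case
    by (intro differentiable_mult differentiable_compose[OF differentiable_of_real]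
        bounded_linear_imp_differentiable[OF bounded_linear_fst])
next
  case (mult_snd f)
  then show ?case
    by (intro differentiable_mult differentiable_compose[OF differentiable_of_real]
        bounded_linear_imp_differentiable[OF bounded_linear_snd])
qed (auto intro!: derivative_intros schwartz_imp_differentiable differentiable_gaussian)

text \<open>The factors 1 give the right-hand side the shape of the rule \<open>lincomb\<close>, so
  that \<open>schwartz_closure_derivs\<close> can apply it directly.\<close>

lemma x_deriv_mult_fst:
  assumes "\<And>z. f differentiable (at z)"
  shows "x_deriv (\<lambda>z. of_real (fst z) * f z) = (\<lambda>z. 1 * f z + 1 * (of_real (fst z) * x_deriv f z))"
  by (rule x_deriv_eqI)
     (rule has_vector_derivative_eq_rhs, rule has_vector_derivative_mult,
      auto intro!: derivative_eq_intros has_x_deriv assms)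

lemma y_deriv_mult_fst:
  assumes "\<And>z. f differentiable (at z)"
  shows "y_deriv (\<lambda>z. of_real (fst z) * f z) = (\<lambda>z. of_real (fst z) * y_deriv f z)"
  by (rule y_deriv_eqI)
     (rule has_vector_derivative_eq_rhs, rule has_vector_derivative_mult,
      auto intro!: derivative_eq_intros has_y_deriv assms)

lemma x_deriv_mult_snd:
  assumes "\<And>z. f differentiable (at z)"
  shows "x_deriv (\<lambda>z. of_real (snd z) * f z) = (\<lambda>z. of_real (snd z) * x_deriv f z)"
  by (rule x_deriv_eqI)
     (rule has_vector_derivative_eq_rhs, rule has_vector_derivative_mult,
      auto intro!: derivative_eq_intros has_x_deriv assms)

lemma y_deriv_mult_snd:
  assumes "\<And>z. f differentiable (at z)"
  shows "y_deriv (\<lambda>z. of_real (snd z) * f z) = (\<lambda>z. 1 * f z + 1 * (of_real (snd z) * y_deriv f z))"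
  by (rule y_deriv_eqI)
     (rule has_vector_derivative_eq_rhs, rule has_vector_derivative_mult,
      auto intro!: derivative_eq_intros has_y_deriv assms)

lemma x_deriv_lincomb:
  assumes "\<And>z. f differentiable (at z)" "\<And>z. g differentiable (at z)"
  shows "x_deriv (\<lambda>z. a * f z + b * g z) = (\<lambda>z. a * x_deriv f z + b * x_deriv g z)"
  by (rule x_deriv_eqI)
     (intro has_vector_derivative_add has_vector_derivative_mult_right has_x_deriv assms)

lemma y_deriv_lincomb:
  assumes "\<And>z. f differentiable (at z)" "\<And>z. g differentiable (at z)"
  shows "y_deriv (\<lambda>z. a * f z + b * g z) = (\<lambda>z. a * y_deriv f z + b * y_deriv g z)"
  by (rule y_deriv_eqI)
     (intro has_vector_derivative_add has_vector_derivative_mult_right has_y_deriv assms)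

lemma schwartz_closure_derivs:
  "schwartz_closure f \<Longrightarrow> schwartz_closure (x_deriv f) \<and> schwartz_closure (y_deriv f)"
proof (induction rule: schwartz_closure.induct)
  case (schwartz f)
  then show ?case
    by (auto intro: schwartz_closure.schwartz schwartz_x_deriv schwartz_y_deriv)
next
  case (gaussian p b)
  then show ?case
    unfolding x_deriv_gaussian y_deriv_gaussian
    by (intro conjI schwartz_closure.mult_fst schwartz_closure.mult_snd schwartz_closure.lincomb
        schwartz_closure.gaussian)
next
  case (mult_fst f)
  then have "f differentiable (at z)" for z
    by (simp add: schwartz_closure_differentiable)
  with mult_fst show ?case
    by (simp only: x_deriv_mult_fst y_deriv_mult_fst)
       (intro conjI schwartz_closure.mult_fst schwartz_closure.lincomb; blast)
next
  case (mult_snd f)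
  then have "f differentiable (at z)" for z
    by (simp add: schwartz_closure_differentiable)
  with mult_snd show ?case
    by (simp only: x_deriv_mult_snd y_deriv_mult_snd)
       (intro conjI schwartz_closure.mult_snd schwartz_closure.lincomb; blast)
next
  case (lincomb f g a b)
  then have "f differentiable (at z)" "g differentiable (at z)" for z
    by (simp_all add: schwartz_closure_differentiable)
  with lincomb show ?case
    by (simp only: x_deriv_lincomb y_deriv_lincomb) (intro conjI schwartz_closure.lincomb; blast)
qed

text \<open>One extra power of the weight pays for the coordinate factor.\<close>

lemma bdd_above_weighted_mult:
  fixes f :: plane_fun and l :: "real \<times> real \<Rightarrow> real"
  assumes "bdd_above (range (\<lambda>z. (1 + norm z) ^ Suc m * cmod (f z)))"
    and l: "\<And>z. \<bar>l z\<bar> \<le> norm z"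
  shows "bdd_above (range (\<lambda>z. (1 + norm z) ^ m * cmod (of_real (l z) * f z)))"
proof -
  from assms obtain C where C: "\<And>z. (1 + norm z) ^ Suc m * cmod (f z) \<le> C"
    by (auto simp: bdd_above_def)
  show ?thesis
  proof (rule bdd_aboveI2)
    fix z
    have "(1 + norm z) ^ m * cmod (of_real (l z) * f z) = \<bar>l z\<bar> * ((1 + norm z) ^ m * cmod (f z))"
      by (simp add: norm_mult)
    also have "\<dots> \<le> (1 + norm z) * ((1 + norm z) ^ m * cmod (f z))"
      using l[of z] by (intro mult_right_mono) auto
    also have "\<dots> \<le> C"
      using C[of z] by (simp add: mult.assoc)
    finally show "(1 + norm z) ^ m * cmod (of_real (l z) * f z) \<le> C" .
  qed
qed

lemma abs_fst_le_norm: "\<bar>fst z\<bar> \<le> norm z" for z :: "real \<times> real"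
  using norm_fst_le[of "fst z" "snd z"] by simp

lemma abs_snd_le_norm: "\<bar>snd z\<bar> \<le> norm z" for z :: "real \<times> real"
  using norm_snd_le[of "snd z" "fst z"] by simp

lemma schwartz_closure_bdd_above:
  "schwartz_closure f \<Longrightarrow> bdd_above (range (\<lambda>z. (1 + norm z) ^ m * cmod (f z)))"
proof (induction arbitrary: m rule: schwartz_closure.induct)
  case (mult_fst f)
  show ?case
    by (rule bdd_above_weighted_mult[OF mult_fst.IH abs_fst_le_norm])
next
  case (mult_snd f)
  show ?case
    by (rule bdd_above_weighted_mult[OF mult_snd.IH abs_snd_le_norm])
next
  case (lincomb f g a b)
  obtain C1 C2 where C: "\<And>z. (1 + norm z) ^ m * cmod (f z) \<le> C1" "\<And>z. (1 + norm z) ^ m * cmod (g z) \<le> C2"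
    using lincomb.IH[of m] by (auto simp: bdd_above_def)
  show ?case
  proof (rule bdd_aboveI2)
    fix z
    have "(1 + norm z) ^ m * cmod (a * f z + b * g z) \<le> (1 + norm z) ^ m * (cmod a * cmod (f z) + cmod b * cmod (g z))"
      by (intro mult_left_mono) (auto intro: order.trans[OF norm_triangle_ineq] simp: norm_mult)
    also have "\<dots> = cmod a * ((1 + norm z) ^ m * cmod (f z)) + cmod b * ((1 + norm z) ^ m * cmod (g z))"
      by (simp add: algebra_simps)
    also have "\<dots> \<le> cmod a * C1 + cmod b * C2"
      using C by (intro add_mono mult_left_mono) auto
    finally show "(1 + norm z) ^ m * cmod (a * f z + b * g z) \<le> cmod a * C1 + cmod b * C2" .
  qed
qed (auto intro: schwartz_imp_bdd_above bdd_above_gaussian)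

lemma schwartz_if_schwartz_closure: "schwartz_closure f \<Longrightarrow> schwartz f"
  by (rule schwartz_coinduct[where P = schwartz_closure])
     (simp_all add: schwartz_closure_differentiable schwartz_closure_derivs schwartz_closure_bdd_above)

lemmas schwartz_gaussian = schwartz_closure.gaussian[THEN schwartz_if_schwartz_closure]
  and schwartz_mult_fst = schwartz_closure.schwartz[THEN schwartz_closure.mult_fst, THEN schwartz_if_schwartz_closure]
  and schwartz_mult_snd = schwartz_closure.schwartz[THEN schwartz_closure.mult_snd, THEN schwartz_if_schwartz_closure]
  and schwartz_lincomb = schwartz_closure.lincomb[OF schwartz_closure.schwartz schwartz_closure.schwartz, THEN schwartz_if_schwartz_closure]

lemma schwartz_cmult: "schwartz f \<Longrightarrow> schwartz (\<lambda>z. a * f z)"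
  using schwartz_lincomb[of f f a 0] by simp


section \<open>The Fourier transform of Schwartz functions\<close>

lemma schwartz_imp_continuous_on:
  assumes "schwartz f"
  shows "continuous_on UNIV f"
  using differentiable_imp_continuous_within[OF schwartz_imp_differentiable[OF assms]]
  by (simp add: continuous_on_eq_continuous_within)

lemma schwartz_borel_measurable: "schwartz f \<Longrightarrow> f \<in> borel_measurable borel"
  by (rule borel_measurable_continuous_onI) (rule schwartz_imp_continuous_on)

lemma integrable_tensor:
  fixes f :: "'a :: euclidean_space \<Rightarrow> 'c :: {real_normed_field, banach, second_countable_topology}"
    and g :: "'b :: euclidean_space \<Rightarrow> 'c"
  assumes f: "integrable lborel f" and g: "integrable lborel g"
  shows "integrable lborel (\<lambda>z. f (fst z) * g (snd z))"
    and "(LINT z|lborel. f (fst z) * g (snd z)) = (LINT x|lborel. f x) * (LINT y|lborel. g y)"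
proof -
  have [measurable]: "f \<in> borel_measurable borel" "g \<in> borel_measurable borel"
    using f g by auto
  have *: "integrable (lborel \<Otimes>\<^sub>M lborel) (\<lambda>z. f (fst z) * g (snd z))"
    by (rule lborel_pair.Fubini_integrable) (use f g in \<open>auto simp: norm_mult\<close>)
  then show "integrable lborel (\<lambda>z. f (fst z) * g (snd z))"
    by (simp add: lborel_prod)
  show "(LINT z|lborel. f (fst z) * g (snd z)) = (LINT x|lborel. f x) * (LINT y|lborel. g y)"
    using lborel_pair.integral_fst'[OF *] by (simp add: lborel_prod)
qed

text \<open>The exponent 4 comes from comparison with a product of one-dimensional kernels: (1 +
  x^2) (1 + y^2) \<le> (1 + norm z)^4, and 1 / (1 + x^2) is integrable on the line.\<close>

lemma integrable_if_decay:
  fixes f :: plane_fun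
  assumes [measurable]: "f \<in> borel_measurable borel"
    and C: "\<And>z. (1 + norm z) ^ 4 * cmod (f z) \<le> C"
  shows "integrable lborel f"
proof -
  have "integrable lborel (\<lambda>x::real. inverse (1 + x\<^sup>2))"
    using integrable_inverse_1_plus_square by (simp add: set_integrable_def einterval_def)
  from integrable_tensor(1)[OF this this]
  have "integrable lborel (\<lambda>z::real \<times> real. C * (inverse (1 + (fst z)\<^sup>2) * inverse (1 + (snd z)\<^sup>2)))"
    by (rule integrable_mult_right)
  then show ?thesis
  proof (rule Bochner_Integration.integrable_bound)
    show "AE z in lborel. norm (f z) \<le> norm (C * (inverse (1 + (fst z)\<^sup>2) * inverse (1 + (snd z)\<^sup>2)))"
    proof (intro AE_I2)
      fix z :: "real \<times> real"
      have "0 \<le> C"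
        using order.trans[OF norm_ge_zero, of "f 0" C] C[of 0] by simp
      have sq: "1 + a\<^sup>2 \<le> (1 + norm z)\<^sup>2" if "\<bar>a\<bar> \<le> norm z" for a :: real
      proof -
        have "a\<^sup>2 \<le> (norm z)\<^sup>2"
          using power_mono[OF that, of 2] by simp
        then show ?thesis
          using norm_ge_zero[of z] by (simp add: power2_sum del: norm_ge_zero)
      qed
      have "(1 + (fst z)\<^sup>2) * (1 + (snd z)\<^sup>2) \<le> (1 + norm z)\<^sup>2 * (1 + norm z)\<^sup>2"
        by (intro mult_mono sq abs_fst_le_norm abs_snd_le_norm) auto
      also have "\<dots> = (1 + norm z) ^ 4"
        by (simp flip: power_add)
      finally have "(1 + (fst z)\<^sup>2) * (1 + (snd z)\<^sup>2) * cmod (f z) \<le> C"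
        using C[of z] by (meson mult_right_mono norm_ge_zero order.trans)
      moreover have "0 < (1 + (fst z)\<^sup>2) * (1 + (snd z)\<^sup>2)"
        by (intro mult_pos_pos) (auto simp: add_pos_nonneg)
      ultimately have "cmod (f z) \<le> C / ((1 + (fst z)\<^sup>2) * (1 + (snd z)\<^sup>2))"
        by (simp add: pos_le_divide_eq mult.commute)
      also have "\<dots> = norm (C * (inverse (1 + (fst z)\<^sup>2) * inverse (1 + (snd z)\<^sup>2)))"
        using \<open>0 \<le> C\<close> by (simp add: divide_inverse abs_mult)
      finally show "norm (f z) \<le> \<dots>" .
    qed
  qed auto
qed

lemma schwartz_decay:
  assumes "schwartz f"
  obtains C where "\<And>z. (1 + norm z) ^ m * cmod (f z) \<le> C"
  using schwartz_imp_bdd_above[OF assms, of m] by (auto simp: bdd_above_def)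

lemma schwartz_integrable: "schwartz f \<Longrightarrow> integrable lborel f"
  by (rule schwartz_decay[where m = 4]) (auto intro!: integrable_if_decay schwartz_borel_measurable)

lemma schwartz_bounded:
  assumes "schwartz f"
  obtains C where "\<And>z. cmod (f z) \<le> C"
  using schwartz_decay[OF assms, of 0] by auto

lemma borel_measurable_cis [measurable (raw)]:
  "f \<in> borel_measurable M \<Longrightarrow> (\<lambda>x. cis (f x)) \<in> borel_measurable M"
  unfolding cis_conv_exp by measurable

lemma integrable_cis_mult:
  fixes f :: "'a \<Rightarrow> complex"
  assumes "integrable M f" "\<theta> \<in> borel_measurable M"
  shows "integrable M (\<lambda>z. cis (\<theta> z) * f z)"
proof (rule Bochner_Integration.integrable_bound[OF assms(1)])
  have [measurable]: "f \<in> borel_measurable M"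
    using assms by auto
  show "(\<lambda>z. cis (\<theta> z) * f z) \<in> borel_measurable M"
    using assms(2) by measurable
qed (auto simp: norm_mult)

lemma integrable_mult_bounded:
  fixes f g :: "'a \<Rightarrow> complex"
  assumes f: "integrable M f" and g: "g \<in> borel_measurable M" "\<And>z. cmod (g z) \<le> C"
  shows "integrable M (\<lambda>z. f z * g z)"
proof (rule Bochner_Integration.integrable_bound[of M "\<lambda>z. of_real C * f z"])
  show "integrable M (\<lambda>z. of_real C * f z)"
    using f by simp
  have [measurable]: "f \<in> borel_measurable M"
    using f by auto
  show "(\<lambda>z. f z * g z) \<in> borel_measurable M"
    using g(1) by measurable
  show "AE z in M. norm (f z * g z) \<le> norm (of_real C * f z)"
  proof (rule AE_I2)
    fix z
    show "norm (f z * g z) \<le> norm (of_real C * f z)"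
      using order.trans[OF g(2)[of z] abs_ge_self]
      by (simp add: norm_mult mult.commute[of "\<bar>C\<bar>"] mult_left_mono)
  qed
qed

lemma fourier_integrand_integrable:
  "integrable lborel f \<Longrightarrow> integrable lborel (\<lambda>z. cis (- (z \<bullet> \<zeta>)) * f z)"
  by (rule integrable_cis_mult) auto

lemma fourier_measurable [measurable]:
  assumes [measurable]: "f \<in> borel_measurable borel"
  shows "fourier f \<in> borel_measurable borel"
  unfolding fourier_def by measurable

lemma cmod_fourier_le: "cmod (fourier f \<zeta>) \<le> (LINT z|lborel. cmod (f z))"
  unfolding fourier_def by (rule order.trans[OF integral_norm_bound]) (simp add: norm_mult)

lemma fourier_cmult: "fourier (\<lambda>z. a * f z) = (\<lambda>\<zeta>. a * fourier f \<zeta>)"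
  unfolding fourier_def by (simp add: mult.left_commute[of _ a])

lemma integrable_translate:
  fixes f :: "'a :: euclidean_space \<Rightarrow> 'b :: {banach, second_countable_topology}"
  assumes "integrable lborel f"
  shows "integrable lborel (\<lambda>z. f (a + z))"
proof -
  have "integrable (distr lborel borel ((+) a)) f"
    using assms by (simp add: lborel_distr_plus)
  then show ?thesis
    by (subst (asm) integrable_distr_eq) (use assms in auto)
qed

lemma integral_translate:
  fixes f :: "'a :: euclidean_space \<Rightarrow> 'b :: {banach, second_countable_topology}"
  assumes [measurable]: "f \<in> borel_measurable borel"
  shows "(LINT z|lborel. f (a + z)) = (LINT z|lborel. f z)"
proof -
  have "(LINT z|lborel. f z) = (LINT z|distr lborel borel ((+) a). f z)"
    by (simp add: lborel_distr_plus)
  also have "\<dots> = (LINT z|lborel. f (a + z))"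
    by (subst integral_distr) auto
  finally show ?thesis ..
qed

lemma integral_scale:
  fixes f :: "'a :: euclidean_space \<Rightarrow> 'b :: {banach, second_countable_topology}"
  assumes [measurable]: "f \<in> borel_measurable borel" and c: "c \<noteq> 0"
  shows "(LINT z|lborel. f z) = \<bar>c\<bar> ^ DIM('a) *\<^sub>R (LINT z|lborel. f (c *\<^sub>R z))"
proof -
  have "(LINT z|lborel. f z) = (LINT z|density (distr lborel borel (\<lambda>x::'a. 0 + c *\<^sub>R x)) (\<lambda>_. \<bar>c\<bar> ^ DIM('a)). f z)"
    using c by (subst lborel_affine[of c 0]) auto
  also have "\<dots> = \<bar>c\<bar> ^ DIM('a) *\<^sub>R (LINT z|lborel. f (c *\<^sub>R z))"
    using c by (subst integral_density) (auto simp: integral_distr)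
  finally show ?thesis .
qed

lemma fourier_translate:
  assumes [measurable]: "f \<in> borel_measurable borel"
  shows "fourier (\<lambda>z. f (a + z)) \<zeta> = cis (a \<bullet> \<zeta>) * fourier f \<zeta>"
proof -
  have "cis (a \<bullet> \<zeta>) * fourier f \<zeta> = (LINT z|lborel. cis (a \<bullet> \<zeta>) * (cis (- (z \<bullet> \<zeta>)) * f z))"
    by (simp add: fourier_def)
  also have "\<dots> = (LINT z|lborel. cis (a \<bullet> \<zeta>) * (cis (- ((a + z) \<bullet> \<zeta>)) * f (a + z)))"
    by (rule integral_translate[symmetric]) measurable
  also have "\<dots> = fourier (\<lambda>z. f (a + z)) \<zeta>"
    unfolding fourier_def
    by (intro Bochner_Integration.integral_cong refl)
       (simp add: inner_left_distrib cis_mult mult.assoc[symmetric])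
  finally show ?thesis ..
qed

text \<open>Translation by r e multiplies the transform by a phase, so a difference quotient of f
  has as transform that of f times the difference quotient of the phase. Dominated convergence
  passes to the limit. This avoids integration by parts, and one argument serves both
  coordinates.\<close>

lemma fourier_directional_derivative:
  fixes f D :: plane_fun
  assumes e: "norm e = 1"
    and f: "integrable lborel f" and D: "D \<in> borel_measurable borel"
    and der: "\<And>z r. ((\<lambda>r. f (r *\<^sub>R e + z)) has_vector_derivative D (r *\<^sub>R e + z)) (at r)"
    and C: "\<And>z. (1 + norm z) ^ 4 * cmod (D z) \<le> C"
  shows "fourier D \<zeta> = \<i> * of_real (e \<bullet> \<zeta>) * fourier f \<zeta>"
proof -
  have [measurable]: "f \<in> borel_measurable borel" "D \<in> borel_measurable borel"
    using f D by auto
  define h where "h n = inverse (real (Suc n))" for n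
  have h: "0 < h n" "h n \<le> 1" for n
    by (auto simp: h_def inverse_le_1_iff)
  have h_lim: "filterlim h (at 0) sequentially"
    unfolding filterlim_at using LIMSEQ_inverse_real_of_nat h(1) by (auto simp: h_def[abs_def])
  have quotient_limit: "((\<lambda>n. (g (h n) - g 0) / of_real (h n)) \<longlongrightarrow> d) sequentially"
    if "(g has_vector_derivative d) (at 0)" for g :: "real \<Rightarrow> complex" and d
  proof -
    have "((\<lambda>r. norm (g (0 + r) - g 0 - r *\<^sub>R d) / norm r) \<longlongrightarrow> 0) (at 0)"
      using that unfolding has_vector_derivative_def has_derivative_at by blast
    from filterlim_compose[OF this h_lim]
    have "(\<lambda>n. norm ((g (h n) - g 0) / of_real (h n) - d)) \<longlonglongrightarrow> 0"
    proof (rule filterlim_cong[THEN iffD1, rotated 3])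
      have "norm (g (0 + h n) - g 0 - h n *\<^sub>R d) / norm (h n) = norm ((g (h n) - g 0) / of_real (h n) - d)" for n
      proof -
        have "(g (h n) - g 0) / of_real (h n) - d = (g (0 + h n) - g 0 - h n *\<^sub>R d) / of_real (h n)"
          using h(1)[of n] by (simp add: diff_divide_distrib scaleR_conv_of_real)
        then show ?thesis
          by (simp add: norm_divide)
      qed
      then show "\<forall>\<^sub>F n in sequentially. norm (g (0 + h n) - g 0 - h n *\<^sub>R d) / norm (h n)
          = norm ((g (h n) - g 0) / of_real (h n) - d)"
        by simp
    qed simp_all
    then show ?thesis
      by (simp add: tendsto_norm_zero_iff LIM_zero_iff)
  qed
  define q where "q n z = cis (- (z \<bullet> \<zeta>)) * ((f (h n *\<^sub>R e + z) - f z) / of_real (h n))" for n z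
  have "(\<lambda>n. LINT z|lborel. q n z) \<longlonglongrightarrow> (LINT z|lborel. cis (- (z \<bullet> \<zeta>)) * D z)"
  proof (rule integral_dominated_convergence)
    \<comment> \<open>The mean value theorem moves the point by at most \<open>h n\<close> \<le> 1,
      which costs a factor of at most 2 in 1 + norm z; 16 is its fourth power.\<close>
    show "integrable lborel (\<lambda>z :: real \<times> real. cmod (of_real (16 * C) * (of_real (inverse ((1 + norm z) ^ 4)))))"
    proof (rule integrable_norm, rule integrable_mult_right, rule integrable_if_decay[where C = 1])
      show "(1 + norm z) ^ 4 * cmod (of_real (inverse ((1 + norm z) ^ 4))) \<le> 1" for z :: "real \<times> real"
      proof -
        have "0 < (1 + norm z) ^ 4"
          by (intro zero_less_power add_pos_nonneg) simp_all
        then show ?thesis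
          unfolding norm_of_real by simp
      qed
    qed measurable
    show "AE z in lborel. (\<lambda>n. q n z) \<longlonglongrightarrow> cis (- (z \<bullet> \<zeta>)) * D z"
      using quotient_limit[OF der[of _ 0]] unfolding q_def by (intro AE_I2 tendsto_mult_left) simp
    show "AE z in lborel. norm (q n z) \<le> cmod (of_real (16 * C) * (of_real (inverse ((1 + norm z) ^ 4))))" for n
    proof (intro AE_I2)
      fix z
      have "\<exists>r\<in>{0<..<h n}. norm (f (h n *\<^sub>R e + z) - f (0 *\<^sub>R e + z)) \<le> norm ((h n - 0) *\<^sub>R D (r *\<^sub>R e + z))"
      proof (rule mvt_general)
        show "continuous_on {0..h n} (\<lambda>r. f (r *\<^sub>R e + z))"
          by (intro continuous_at_imp_continuous_on ballI has_vector_derivative_continuous[OF der])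
      qed (use der h in \<open>auto simp: has_vector_derivative_def\<close>)
      then obtain r where r: "0 < r" "r < h n" "cmod (f (h n *\<^sub>R e + z) - f z) \<le> h n * cmod (D (r *\<^sub>R e + z))"
        using h(1)[of n] by auto
      let ?w = "r *\<^sub>R e + z"
      have "norm z \<le> norm ?w + norm (r *\<^sub>R e)"
        by (metis add_diff_cancel_left' norm_triangle_ineq4 add.commute)
      also have "\<dots> \<le> norm ?w + 1"
        using r h(2)[of n] e by simp
      finally have "1 + norm z \<le> 2 * (1 + norm ?w)"
        using norm_ge_zero[of ?w] unfolding distrib_left by linarith
      then have "(1 + norm z) ^ 4 \<le> (2 * (1 + norm ?w)) ^ 4"
        by (intro power_mono) simp_all
      also have "\<dots> = 16 * (1 + norm ?w) ^ 4"
        unfolding power_mult_distrib by simp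
      finally have "(1 + norm z) ^ 4 * cmod (D ?w) \<le> 16 * (1 + norm ?w) ^ 4 * cmod (D ?w)"
        by (intro mult_right_mono) auto
      also have "\<dots> \<le> 16 * C"
        using C[of ?w] by simp
      finally have "(1 + norm z) ^ 4 * cmod (D ?w) \<le> 16 * C" .
      then have bound: "cmod (D ?w) \<le> 16 * C * inverse ((1 + norm z) ^ 4)"
      proof -
        have "0 < (1 + norm z) ^ 4"
          by (intro zero_less_power add_pos_nonneg) simp_all
        with this show ?thesis
          using \<open>(1 + norm z) ^ 4 * cmod (D ?w) \<le> 16 * C\<close>
          by (simp only: divide_inverse[symmetric] pos_le_divide_eq mult.commute)
      qed
      have "norm (q n z) \<le> cmod (D ?w)"
        using r(3) h(1)[of n] by (simp add: q_def norm_mult norm_divide pos_divide_le_eq mult.commute)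
      also note bound
      also have "16 * C * inverse ((1 + norm z) ^ 4) \<le> cmod (of_real (16 * C) * (of_real (inverse ((1 + norm z) ^ 4))))"
        by (simp only: flip: of_real_mult) (simp only: norm_of_real abs_ge_self)
      finally show "norm (q n z) \<le> cmod (of_real (16 * C) * (of_real (inverse ((1 + norm z) ^ 4))))" .
    qed
  qed (simp_all add: q_def)
  moreover have "(LINT z|lborel. q n z) = (cis (h n * (e \<bullet> \<zeta>)) - 1) / of_real (h n) * fourier f \<zeta>" for n
  proof -
    have "integrable lborel (\<lambda>z. cis (- (z \<bullet> \<zeta>)) * f (h n *\<^sub>R e + z))"
      by (intro fourier_integrand_integrable integrable_translate f)
    then have "(LINT z|lborel. q n z) = (fourier (\<lambda>z. f (h n *\<^sub>R e + z)) \<zeta> - fourier f \<zeta>) / of_real (h n)"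
      using fourier_integrand_integrable[OF f, of \<zeta>]
      by (simp add: q_def fourier_def right_diff_distrib diff_divide_distrib)
    also have "\<dots> = (cis (h n * (e \<bullet> \<zeta>)) - 1) / of_real (h n) * fourier f \<zeta>"
      by (simp add: fourier_translate left_diff_distrib diff_divide_distrib)
    finally show ?thesis .
  qed
  moreover have "(\<lambda>n. (cis (h n * (e \<bullet> \<zeta>)) - 1) / of_real (h n) * fourier f \<zeta>)
      \<longlonglongrightarrow> \<i> * of_real (e \<bullet> \<zeta>) * fourier f \<zeta>"
  proof -
    have "((\<lambda>r. r * (e \<bullet> \<zeta>)) has_vector_derivative e \<bullet> \<zeta>) (at 0)"
      by (auto intro!: derivative_eq_intros)
    from vector_diff_chain_at[OF this has_vector_derivative_iexp]
    have "((\<lambda>r. cis (r * (e \<bullet> \<zeta>))) has_vector_derivative \<i> * of_real (e \<bullet> \<zeta>)) (at 0)"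
      by (simp add: cis_conv_exp o_def scaleR_conv_of_real mult.commute)
    from quotient_limit[OF this] show ?thesis
      by (intro tendsto_mult_right) simp
  qed
  ultimately show ?thesis
    by (simp add: fourier_def LIMSEQ_unique)
qed

lemma fourier_x_deriv:
  assumes "schwartz f"
  shows "fourier (x_deriv f) = (\<lambda>\<zeta>. \<i> * (of_real (fst \<zeta>) * fourier f \<zeta>))"
proof
  fix \<zeta>
  obtain C where C: "\<And>z. (1 + norm z) ^ 4 * cmod (x_deriv f z) \<le> C"
    using schwartz_decay[OF schwartz_x_deriv[OF assms]] by blast
  have "((\<lambda>r. f (r *\<^sub>R (1, 0) + z)) has_vector_derivative x_deriv f (r *\<^sub>R (1, 0) + z)) (at r)" for z r
  proof -
    have "((\<lambda>r. f (r, snd z)) \<circ> (\<lambda>r. r + fst z) has_vector_derivative 1 *\<^sub>R x_deriv f (r + fst z, snd z)) (at r)"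
      by (rule vector_diff_chain_at)
         (auto intro!: derivative_eq_intros has_x_deriv schwartz_imp_differentiable assms)
    then show ?thesis
      by (simp add: o_def plus_prod_def)
  qed
  then have "fourier (x_deriv f) \<zeta> = \<i> * of_real ((1, 0) \<bullet> \<zeta>) * fourier f \<zeta>"
    by (intro fourier_directional_derivative[OF _ _ _ _ C])
       (use assms schwartz_x_deriv in \<open>auto intro: schwartz_integrable schwartz_borel_measurable simp: norm_Pair\<close>)
  then show "fourier (x_deriv f) \<zeta> = \<i> * (of_real (fst \<zeta>) * fourier f \<zeta>)"
    by (cases \<zeta>) simp
qed

lemma fourier_y_deriv:
  assumes "schwartz f"
  shows "fourier (y_deriv f) = (\<lambda>\<zeta>. \<i> * (of_real (snd \<zeta>) * fourier f \<zeta>))"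
proof
  fix \<zeta>
  obtain C where C: "\<And>z. (1 + norm z) ^ 4 * cmod (y_deriv f z) \<le> C"
    using schwartz_decay[OF schwartz_y_deriv[OF assms]] by blast
  have "((\<lambda>r. f (r *\<^sub>R (0, 1) + z)) has_vector_derivative y_deriv f (r *\<^sub>R (0, 1) + z)) (at r)" for z r
  proof -
    have "((\<lambda>r. f (fst z, r)) \<circ> (\<lambda>r. r + snd z) has_vector_derivative 1 *\<^sub>R y_deriv f (fst z, r + snd z)) (at r)"
      by (rule vector_diff_chain_at)
         (auto intro!: derivative_eq_intros has_y_deriv schwartz_imp_differentiable assms)
    then show ?thesis
      by (simp add: o_def plus_prod_def)
  qed
  then have "fourier (y_deriv f) \<zeta> = \<i> * of_real ((0, 1) \<bullet> \<zeta>) * fourier f \<zeta>"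
    by (intro fourier_directional_derivative[OF _ _ _ _ C])
       (use assms schwartz_y_deriv in \<open>auto intro: schwartz_integrable schwartz_borel_measurable simp: norm_Pair\<close>)
  then show "fourier (y_deriv f) \<zeta> = \<i> * (of_real (snd \<zeta>) * fourier f \<zeta>)"
    by (cases \<zeta>) simp
qed

text \<open>The Taylor bound |cis t - 1 - i t| \<le> t^2 / 2 under the integral leaves a remainder
  of at most K |h|^2, where K is the integral of |z|^2 |f|. This gives the total derivative, from
  which both partial derivatives are read off.\<close>

lemma fourier_has_derivative:
  assumes "schwartz f"
  defines "F1 \<equiv> fourier (\<lambda>z. of_real (fst z) * f z)" and "F2 \<equiv> fourier (\<lambda>z. of_real (snd z) * f z)"
  shows "(fourier f has_derivative
    (\<lambda>h. of_real (fst h) * (- \<i> * F1 \<zeta>) + of_real (snd h) * (- \<i> * F2 \<zeta>))) (at \<zeta>)"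
proof (rule has_derivativeI_sandwich[where e = 1])
  let ?L = "\<lambda>h. of_real (fst h) * (- \<i> * F1 \<zeta>) + of_real (snd h) * (- \<i> * F2 \<zeta>)"
  show "bounded_linear ?L"
    by (intro bounded_linear_add bounded_linear_mult_const
        bounded_linear_compose[OF bounded_linear_of_real bounded_linear_fst]
        bounded_linear_compose[OF bounded_linear_of_real bounded_linear_snd])
  \<comment> \<open>6 = 2 + 4: two powers for the factor |z|^2, four for
    \<open>integrable_if_decay\<close>.\<close>
  obtain C where C: "\<And>z. (1 + norm z) ^ 6 * cmod (f z) \<le> C"
    using schwartz_decay[OF assms(1)] by blast
  have [measurable]: "f \<in> borel_measurable borel"
    using assms(1) by (rule schwartz_borel_measurable)
  let ?g = "\<lambda>z. of_real ((norm z)\<^sup>2) * f z"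
  have int: "integrable lborel ?g"
  proof (rule integrable_if_decay)
    fix z
    have "(1 + norm z) ^ 4 * cmod (of_real ((norm z)\<^sup>2) * f z) = (1 + norm z) ^ 4 * (norm z)\<^sup>2 * cmod (f z)"
      by (simp add: norm_mult norm_power)
    also have "\<dots> \<le> (1 + norm z) ^ 4 * (1 + norm z)\<^sup>2 * cmod (f z)"
      by (intro mult_right_mono mult_left_mono power_mono) auto
    also have "\<dots> \<le> C"
      using C[of z] by (simp flip: power_add)
    finally show "(1 + norm z) ^ 4 * cmod (of_real ((norm z)\<^sup>2) * f z) \<le> C" .
  qed measurable
  define K where "K = (LINT z|lborel. cmod (?g z))"
  show "((\<lambda>y. norm (y - \<zeta>) * K) \<longlongrightarrow> 0) (at \<zeta> within UNIV)"
    by (auto intro!: tendsto_eq_intros)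
  fix y assume "y \<noteq> \<zeta>"
  define h where "h = y - \<zeta>"
  have int': "integrable lborel (\<lambda>z. cis (- (z \<bullet> \<zeta>')) * f z)"
    "integrable lborel (\<lambda>z. cis (- (z \<bullet> \<zeta>')) * (of_real (fst z) * f z))"
    "integrable lborel (\<lambda>z. cis (- (z \<bullet> \<zeta>')) * (of_real (snd z) * f z))" for \<zeta>'
    by (intro fourier_integrand_integrable schwartz_integrable schwartz_mult_fst schwartz_mult_snd assms(1))+
  have "fourier f y - fourier f \<zeta> - ?L h =
      (LINT z|lborel. cis (- (z \<bullet> y)) * f z - cis (- (z \<bullet> \<zeta>)) * f z
         - (of_real (fst h) * (- \<i> * (cis (- (z \<bullet> \<zeta>)) * (of_real (fst z) * f z)))
            + of_real (snd h) * (- \<i> * (cis (- (z \<bullet> \<zeta>)) * (of_real (snd z) * f z)))))"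
    using int' unfolding fourier_def F1_def F2_def by simp
  also have "\<dots> = (LINT z|lborel. cis (- (z \<bullet> \<zeta>)) * f z * (cis (- (z \<bullet> h)) - (1 + \<i> * of_real (- (z \<bullet> h)))))"
  proof (intro Bochner_Integration.integral_cong refl)
    fix z
    have "cis (- (z \<bullet> y)) = cis (- (z \<bullet> \<zeta>)) * cis (- (z \<bullet> h))"
      by (simp add: cis_mult h_def inner_diff_right)
    moreover have "z \<bullet> h = fst z * fst h + snd z * snd h"
      by (simp add: inner_prod_def)
    ultimately show "cis (- (z \<bullet> y)) * f z - cis (- (z \<bullet> \<zeta>)) * f z
         - (of_real (fst h) * (- \<i> * (cis (- (z \<bullet> \<zeta>)) * (of_real (fst z) * f z)))
            + of_real (snd h) * (- \<i> * (cis (- (z \<bullet> \<zeta>)) * (of_real (snd z) * f z))))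
       = cis (- (z \<bullet> \<zeta>)) * f z * (cis (- (z \<bullet> h)) - (1 + \<i> * of_real (- (z \<bullet> h))))"
      by (simp add: algebra_simps)
  qed
  also have "cmod \<dots> \<le> (LINT z|lborel. (norm h)\<^sup>2 * cmod (?g z))"
  proof (rule order.trans[OF integral_norm_bound], rule Bochner_Integration.integral_mono)
    have bound: "cmod (cis (- (z \<bullet> h)) - (1 + \<i> * of_real (- (z \<bullet> h)))) \<le> (norm h)\<^sup>2 * (norm z)\<^sup>2" for z
    proof -
      have "cmod (cis (- (z \<bullet> h)) - (1 + \<i> * of_real (- (z \<bullet> h)))) \<le> \<bar>- (z \<bullet> h)\<bar>\<^sup>2 / 2"
        using iexp_approx1[of "- (z \<bullet> h)" 1] by (simp add: cis_conv_exp numeral_2_eq_2)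
      also have "\<dots> \<le> \<bar>z \<bullet> h\<bar>\<^sup>2"
        by simp
      also have "\<dots> \<le> (norm z * norm h)\<^sup>2"
        by (intro power_mono Cauchy_Schwarz_ineq2) auto
      finally show ?thesis
        by (simp add: power_mult_distrib mult.commute)
    qed
    show *: "norm (cis (- (z \<bullet> \<zeta>)) * f z * (cis (- (z \<bullet> h)) - (1 + \<i> * of_real (- (z \<bullet> h)))))
        \<le> (norm h)\<^sup>2 * cmod (?g z)" for z
      using mult_left_mono[OF bound[of z] norm_ge_zero[of "f z"]]
      unfolding norm_mult norm_cis norm_of_real norm_power by (simp add: mult_ac)
    show "integrable lborel (\<lambda>z. norm (cis (- (z \<bullet> \<zeta>)) * f z * (cis (- (z \<bullet> h)) - (1 + \<i> * of_real (- (z \<bullet> h))))))"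
    proof (rule integrable_norm, rule Bochner_Integration.integrable_bound[OF integrable_mult_right[OF int, of "of_real ((norm h)\<^sup>2)"]])
      show "AE z in lborel. norm (cis (- (z \<bullet> \<zeta>)) * f z * (cis (- (z \<bullet> h)) - (1 + \<i> * of_real (- (z \<bullet> h)))))
          \<le> norm (of_real ((norm h)\<^sup>2) * ?g z)"
        using * by (simp add: norm_mult norm_power)
    qed measurable
    show "integrable lborel (\<lambda>z. (norm h)\<^sup>2 * cmod (?g z))"
      using int by (intro integrable_mult_right integrable_norm)
  qed
  also have "\<dots> = (norm h)\<^sup>2 * K"
    by (simp add: K_def)
  finally show "norm (fourier f y - fourier f \<zeta> - ?L (y - \<zeta>)) / norm (y - \<zeta>) \<le> norm (y - \<zeta>) * K"
    using \<open>y \<noteq> \<zeta>\<close> by (simp add: h_def field_simps power2_eq_square)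
qed simp

lemma x_deriv_fourier:
  assumes "schwartz f"
  shows "x_deriv (fourier f) = fourier (\<lambda>z. - \<i> * (of_real (fst z) * f z))"
proof (rule x_deriv_eqI)
  fix x y
  have "((\<lambda>r. fourier f (r, y)) has_derivative (\<lambda>h. of_real h * (- \<i> * fourier (\<lambda>z. of_real (fst z) * f z) (x, y)))) (at x)"
    using has_derivative_compose[OF has_derivative_Pair[OF has_derivative_ident has_derivative_const] fourier_has_derivative[OF assms]]
    by simp
  then show "((\<lambda>r. fourier f (r, y)) has_vector_derivative fourier (\<lambda>z. - \<i> * (of_real (fst z) * f z)) (x, y)) (at x)"
    unfolding fourier_cmult has_vector_derivative_def scaleR_conv_of_real .
qed

lemma y_deriv_fourier:
  assumes "schwartz f"
  shows "y_deriv (fourier f) = fourier (\<lambda>z. - \<i> * (of_real (snd z) * f z))"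
proof (rule y_deriv_eqI)
  fix x y
  have "((\<lambda>r. fourier f (x, r)) has_derivative (\<lambda>h. of_real h * (- \<i> * fourier (\<lambda>z. of_real (snd z) * f z) (x, y)))) (at y)"
    using has_derivative_compose[OF has_derivative_Pair[OF has_derivative_const has_derivative_ident] fourier_has_derivative[OF assms]]
    by simp
  then show "((\<lambda>r. fourier f (x, r)) has_vector_derivative fourier (\<lambda>z. - \<i> * (of_real (snd z) * f z)) (x, y)) (at y)"
    unfolding fourier_cmult has_vector_derivative_def scaleR_conv_of_real .
qed

text \<open>One power of the weight is traded for one derivative of f: 1 + norm \<zeta> \<le> 1 +
  |\<xi>| + |\<eta>|, and a coordinate times the transform is, up to a factor of modulus 1, the
  transform of a partial derivative. Hence the induction over all Schwartz f.\<close>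

lemma bdd_above_fourier:
  assumes "schwartz f"
  shows "bdd_above (range (\<lambda>\<zeta>. (1 + norm \<zeta>) ^ m * cmod (fourier f \<zeta>)))"
  using assms
proof (induction m arbitrary: f)
  case 0
  then show ?case
    by (intro bdd_aboveI2[where M = "LINT z|lborel. cmod (f z)"]) (simp add: cmod_fourier_le)
next
  case (Suc m)
  have "\<exists>C. \<forall>\<zeta>. (1 + norm \<zeta>) ^ m * cmod (fourier g \<zeta>) \<le> C" if "schwartz g" for g
    using Suc.IH[OF that] unfolding bdd_above_def by blast
  from this[OF Suc.prems] this[OF schwartz_x_deriv[OF Suc.prems]] this[OF schwartz_y_deriv[OF Suc.prems]]
  obtain A B C where A: "\<And>\<zeta>. (1 + norm \<zeta>) ^ m * cmod (fourier f \<zeta>) \<le> A"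
    and B: "\<And>\<zeta>. (1 + norm \<zeta>) ^ m * cmod (fourier (x_deriv f) \<zeta>) \<le> B"
    and C: "\<And>\<zeta>. (1 + norm \<zeta>) ^ m * cmod (fourier (y_deriv f) \<zeta>) \<le> C"
    by blast
  show ?case
  proof (rule bdd_aboveI2)
    fix \<zeta> :: "real \<times> real"
    have "norm \<zeta> \<le> \<bar>fst \<zeta>\<bar> + \<bar>snd \<zeta>\<bar>"
      using norm_Pair_le[of "fst \<zeta>" "snd \<zeta>"] by simp
    then have "(1 + norm \<zeta>) * ((1 + norm \<zeta>) ^ m * cmod (fourier f \<zeta>))
        \<le> (1 + \<bar>fst \<zeta>\<bar> + \<bar>snd \<zeta>\<bar>) * ((1 + norm \<zeta>) ^ m * cmod (fourier f \<zeta>))"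
      by (intro mult_right_mono) auto
    also have "\<dots> = (1 + norm \<zeta>) ^ m * cmod (fourier f \<zeta>)
        + (1 + norm \<zeta>) ^ m * cmod (fourier (x_deriv f) \<zeta>) + (1 + norm \<zeta>) ^ m * cmod (fourier (y_deriv f) \<zeta>)"
      by (simp add: fourier_x_deriv[OF Suc.prems] fourier_y_deriv[OF Suc.prems] norm_mult algebra_simps)
    also have "\<dots> \<le> A + B + C"
      by (intro add_mono A B C)
    finally show "(1 + norm \<zeta>) ^ Suc m * cmod (fourier f \<zeta>) \<le> A + B + C"
      by (simp add: mult.assoc)
  qed
qed

text \<open>The invariant is to be the transform of a Schwartz function: differentiating a transform
  gives the transform of a coordinate multiple.\<close>

lemma schwartz_fourier:
  assumes "schwartz f"
  shows "schwartz (fourier f)"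
proof (rule schwartz_coinduct[where P = "\<lambda>g. \<exists>f. schwartz f \<and> g = fourier f"])
  show "g differentiable (at z)" if "\<exists>f. schwartz f \<and> g = fourier f" for g z
    using that fourier_has_derivative unfolding differentiable_def by blast
  show "bdd_above (range (\<lambda>z. (1 + norm z) ^ m * cmod (g z)))" if "\<exists>f. schwartz f \<and> g = fourier f" for g m
    using that bdd_above_fourier by auto
  show "\<exists>f. schwartz f \<and> x_deriv g = fourier f" if "\<exists>f. schwartz f \<and> g = fourier f" for g
    using that x_deriv_fourier schwartz_cmult schwartz_mult_fst by blast
  show "\<exists>f. schwartz f \<and> y_deriv g = fourier f" if "\<exists>f. schwartz f \<and> g = fourier f" for g
    using that y_deriv_fourier schwartz_cmult schwartz_mult_snd by blast
qed (use assms in blast)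


section \<open>Fourier inversion\<close>

lemma integrable_scale:
  fixes f :: "'a :: euclidean_space \<Rightarrow> 'b :: {banach, second_countable_topology}"
  assumes f: "integrable lborel f" and c: "c \<noteq> 0"
  shows "integrable lborel (\<lambda>z. f (c *\<^sub>R z))"
proof -
  have "integrable (density (distr lborel borel (\<lambda>x::'a. 0 + c *\<^sub>R x)) (\<lambda>_. \<bar>c\<bar> ^ DIM('a))) f"
    using f lborel_affine[OF c, of "0 :: 'a"] by simp
  then have "integrable lborel (\<lambda>z. \<bar>c\<bar> ^ DIM('a) *\<^sub>R f (c *\<^sub>R z))"
    using f by (subst (asm) integrable_density) (auto simp: integrable_distr_eq)
  from integrable_scaleR_right[OF this, of "1 / \<bar>c\<bar> ^ DIM('a)"] show ?thesis
    using c by simp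
qed

lemma fourier_multiplication_formula:
  assumes f: "integrable lborel f" and g: "integrable lborel g"
  shows "(LINT \<zeta>|lborel. fourier f \<zeta> * g \<zeta>) = (LINT z|lborel. f z * fourier g z)"
proof -
  have [measurable]: "f \<in> borel_measurable borel" "g \<in> borel_measurable borel"
    using f g by auto
  have "integrable (lborel \<Otimes>\<^sub>M lborel) (\<lambda>p. f (fst p) * g (snd p))"
    using integrable_tensor(1)[OF f g] by (simp add: lborel_prod)
  then have "integrable (lborel \<Otimes>\<^sub>M lborel) (\<lambda>p. cis (- (fst p \<bullet> snd p)) * (f (fst p) * g (snd p)))"
    by (rule integrable_cis_mult) measurable
  then have int: "integrable (lborel \<Otimes>\<^sub>M lborel) (\<lambda>(z, \<zeta>). cis (- (z \<bullet> \<zeta>)) * (f z * g \<zeta>))"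
    by (simp add: case_prod_unfold)
  have "(LINT \<zeta>|lborel. fourier f \<zeta> * g \<zeta>) = (LINT \<zeta>|lborel. LINT z|lborel. cis (- (z \<bullet> \<zeta>)) * (f z * g \<zeta>))"
    by (simp add: fourier_def mult.assoc[symmetric])
  also have "\<dots> = (LINT z|lborel. LINT \<zeta>|lborel. cis (- (z \<bullet> \<zeta>)) * (f z * g \<zeta>))"
    by (rule lborel_pair.Fubini_integral[OF int])
  also have "\<dots> = (LINT z|lborel. f z * fourier g z)"
    by (simp add: fourier_def mult.left_commute[of _ "f _"] inner_commute)
  finally show ?thesis .
qed

text \<open>Read off from the characteristic function of the standard normal distribution at -
  t.\<close>

lemma fourier_std_gaussian_1d:
  "(LINT x|lborel. cis (- (x * t)) * of_real (exp (- (x\<^sup>2 / 2)))) = of_real (sqrt (2 * pi) * exp (- (t\<^sup>2 / 2)))"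
proof -
  have "of_real (exp (- (t\<^sup>2 / 2))) = char std_normal_distribution (- t)"
    by (simp add: char_std_normal_distribution)
  also have "\<dots> = (LINT x|lborel. std_normal_density x *\<^sub>R iexp (- t * x))"
    unfolding char_def by (subst integral_density) auto
  also have "\<dots> = (LINT x|lborel. of_real (1 / sqrt (2 * pi)) * (cis (- (x * t)) * of_real (exp (- (x\<^sup>2 / 2)))))"
    by (intro Bochner_Integration.integral_cong refl)
       (simp add: std_normal_density_def cis_conv_exp scaleR_conv_of_real mult_ac)
  also have "\<dots> = of_real (1 / sqrt (2 * pi)) * (LINT x|lborel. cis (- (x * t)) * of_real (exp (- (x\<^sup>2 / 2))))"
    by (rule integral_mult_right_zero)
  finally show ?thesis
    by (simp add: field_simps)
qed

lemma fourier_gaussian_1d: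
  assumes "\<epsilon> > 0"
  shows "(LINT x|lborel. cis (- (x * t)) * of_real (exp (- (\<epsilon>\<^sup>2 / 2 * x\<^sup>2)))) =
    of_real (sqrt (2 * pi) / \<epsilon> * exp (- (1 / (2 * \<epsilon>\<^sup>2) * t\<^sup>2)))"
proof -
  have "(LINT x|lborel. cis (- (x * t)) * of_real (exp (- (\<epsilon>\<^sup>2 / 2 * x\<^sup>2)))) =
    \<bar>1 / \<epsilon>\<bar> ^ DIM(real) *\<^sub>R (LINT x|lborel. cis (- (((1 / \<epsilon>) *\<^sub>R x) * t)) * of_real (exp (- (\<epsilon>\<^sup>2 / 2 * ((1 / \<epsilon>) *\<^sub>R x)\<^sup>2))))"
    by (rule integral_scale) (use assms in auto)
  also have "\<dots> = (1 / \<epsilon>) *\<^sub>R (LINT x|lborel. cis (- (x * (t / \<epsilon>))) * of_real (exp (- (x\<^sup>2 / 2))))"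
    using assms by (simp add: field_simps)
  also have "\<dots> = of_real (sqrt (2 * pi) / \<epsilon> * exp (- (1 / (2 * \<epsilon>\<^sup>2) * t\<^sup>2)))"
    unfolding fourier_std_gaussian_1d using assms by (simp add: scaleR_conv_of_real power_divide mult.commute)
  finally show ?thesis .
qed

lemma fourier_gaussian:
  assumes "\<epsilon> > 0"
  shows "fourier (gaussian (\<epsilon>\<^sup>2 / 2) 0) \<zeta> = of_real (2 * pi / \<epsilon>\<^sup>2) * gaussian (1 / (2 * \<epsilon>\<^sup>2)) 0 \<zeta>"
proof -
  let ?F = "\<lambda>t x. cis (- (x * t)) * of_real (exp (- (\<epsilon>\<^sup>2 / 2 * x\<^sup>2)))"
  \<comment> \<open>A function that is not integrable has integral 0 by default, whereas
    \<open>fourier_gaussian_1d\<close> gives a nonzero value.\<close>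
  have "integrable lborel (?F t)" for t
  proof (rule ccontr)
    assume "\<not> integrable lborel (?F t)"
    then have "(LINT x|lborel. ?F t x) = 0"
      by (rule not_integrable_integral_eq)
    then have "sqrt (2 * pi) / \<epsilon> * exp (- (1 / (2 * \<epsilon>\<^sup>2) * t\<^sup>2)) = 0"
      unfolding fourier_gaussian_1d[OF assms] of_real_eq_0_iff .
    then show False
      using assms by simp
  qed
  from integrable_tensor(2)[OF this this]
  have "(LINT z|lborel. ?F (fst \<zeta>) (fst z) * ?F (snd \<zeta>) (snd z)) = (LINT x|lborel. ?F (fst \<zeta>) x) * (LINT x|lborel. ?F (snd \<zeta>) x)" .
  moreover have "fourier (gaussian (\<epsilon>\<^sup>2 / 2) 0) \<zeta> = (LINT z|lborel. ?F (fst \<zeta>) (fst z) * ?F (snd \<zeta>) (snd z))"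
    unfolding fourier_def gaussian_def
  proof (intro Bochner_Integration.integral_cong refl)
    fix z :: "real \<times> real"
    have "cis (- (z \<bullet> \<zeta>)) = cis (- (fst z * fst \<zeta>)) * cis (- (snd z * snd \<zeta>))"
      by (simp add: cis_mult inner_prod_def)
    moreover have "exp (0 \<bullet> z - \<epsilon>\<^sup>2 / 2 * (z \<bullet> z)) = exp (- (\<epsilon>\<^sup>2 / 2 * (fst z)\<^sup>2)) * exp (- (\<epsilon>\<^sup>2 / 2 * (snd z)\<^sup>2))"
      by (simp add: inner_prod_def power2_eq_square algebra_simps flip: exp_add)
    ultimately show "cis (- (z \<bullet> \<zeta>)) * complex_of_real (exp (0 \<bullet> z - \<epsilon>\<^sup>2 / 2 * (z \<bullet> z))) = ?F (fst \<zeta>) (fst z) * ?F (snd \<zeta>) (snd z)"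
      by simp
  qed
  moreover have "exp (- (1 / (2 * \<epsilon>\<^sup>2) * (fst \<zeta>)\<^sup>2)) * exp (- (1 / (2 * \<epsilon>\<^sup>2) * (snd \<zeta>)\<^sup>2)) = exp (0 \<bullet> \<zeta> - 1 / (2 * \<epsilon>\<^sup>2) * (\<zeta> \<bullet> \<zeta>))"
    by (simp add: inner_prod_def power2_eq_square distrib_left flip: exp_add)
  moreover have "sqrt (2 * pi) / \<epsilon> * a * (sqrt (2 * pi) / \<epsilon> * b) = 2 * pi / \<epsilon>\<^sup>2 * (a * b)" for a b :: real
    by (simp add: power2_eq_square)
  ultimately show ?thesis
    unfolding fourier_gaussian_1d[OF assms] gaussian_def of_real_mult[symmetric] by (simp only:)
qed

lemma integral_gaussian: "(LINT z|lborel. gaussian (1 / 2) 0 z) = of_real (2 * pi)"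
  using fourier_gaussian[of 1 0] by (simp add: fourier_def gaussian_def)

lemma integrable_gaussian: "p > 0 \<Longrightarrow> integrable lborel (gaussian p b)"
  by (intro schwartz_integrable schwartz_gaussian)

lemma gaussian_measurable [measurable]: "gaussian p b \<in> borel_measurable borel"
  unfolding gaussian_def by measurable

lemma gaussian_scale: "gaussian (1 / (2 * \<epsilon>\<^sup>2)) 0 (\<epsilon> *\<^sub>R z) = gaussian (1 / 2) 0 z" if "\<epsilon> \<noteq> 0"
  using that by (simp add: gaussian_def power2_eq_square)

text \<open>An ever wider Gaussian is inserted as a damping factor on the Fourier side. The
  multiplication formula moves it to f, where it becomes an average over a shrinking neighbourhood
  of 0. One factor 2 pi comes from \<open>fourier_gaussian\<close>, the other from the mass of the
  Gaussian.\<close>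

lemma fourier_inversion_at_0:
  assumes cont: "continuous_on UNIV f" and bound: "\<And>z. cmod (f z) \<le> C"
    and f: "integrable lborel f" and ff: "integrable lborel (fourier f)"
  shows "(LINT \<zeta>|lborel. fourier f \<zeta>) = of_real ((2 * pi)\<^sup>2) * f 0"
proof -
  have [measurable]: "f \<in> borel_measurable borel" "fourier f \<in> borel_measurable borel"
    using f ff by auto
  define \<epsilon> where "\<epsilon> n = inverse (real (Suc n))" for n
  have \<epsilon>: "0 < \<epsilon> n" for n
    by (simp add: \<epsilon>_def)
  have \<epsilon>_lim: "\<epsilon> \<longlonglongrightarrow> 0"
    unfolding \<epsilon>_def by (rule LIMSEQ_inverse_real_of_nat)
  have "(\<lambda>n. LINT \<zeta>|lborel. fourier f \<zeta> * gaussian ((\<epsilon> n)\<^sup>2 / 2) 0 \<zeta>) \<longlonglongrightarrow> (LINT \<zeta>|lborel. fourier f \<zeta>)"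
  proof (rule integral_dominated_convergence)
    show "integrable lborel (\<lambda>\<zeta>. cmod (fourier f \<zeta>))"
      using ff by simp
    show "AE \<zeta> in lborel. (\<lambda>n. fourier f \<zeta> * gaussian ((\<epsilon> n)\<^sup>2 / 2) 0 \<zeta>) \<longlonglongrightarrow> fourier f \<zeta>"
      unfolding gaussian_def by (intro AE_I2) (auto intro!: tendsto_eq_intros \<epsilon>_lim)
    show "AE \<zeta> in lborel. norm (fourier f \<zeta> * gaussian ((\<epsilon> n)\<^sup>2 / 2) 0 \<zeta>) \<le> cmod (fourier f \<zeta>)" for n
      by (intro AE_I2) (simp add: norm_mult gaussian_def mult_left_le)
  qed simp_all
  moreover have "(LINT \<zeta>|lborel. fourier f \<zeta> * gaussian ((\<epsilon> n)\<^sup>2 / 2) 0 \<zeta>)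
      = (LINT z|lborel. of_real (2 * pi) * (f (\<epsilon> n *\<^sub>R z) * gaussian (1 / 2) 0 z))" for n
  proof -
    let ?e = "\<epsilon> n"
    have "(LINT \<zeta>|lborel. fourier f \<zeta> * gaussian (?e\<^sup>2 / 2) 0 \<zeta>)
        = (LINT z|lborel. f z * (of_real (2 * pi / ?e\<^sup>2) * gaussian (1 / (2 * ?e\<^sup>2)) 0 z))"
      using \<epsilon>[of n] by (subst fourier_multiplication_formula) (auto intro: f integrable_gaussian simp: fourier_gaussian)
    also have "\<dots> = \<bar>?e\<bar> ^ DIM(real \<times> real) *\<^sub>R (LINT z|lborel. f (?e *\<^sub>R z) * (of_real (2 * pi / ?e\<^sup>2) * gaussian (1 / (2 * ?e\<^sup>2)) 0 (?e *\<^sub>R z)))"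
      by (rule integral_scale) (use \<epsilon>[of n] in auto)
    also have "\<dots> = (LINT z|lborel. ?e\<^sup>2 *\<^sub>R (f (?e *\<^sub>R z) * (of_real (2 * pi / ?e\<^sup>2) * gaussian (1 / (2 * ?e\<^sup>2)) 0 (?e *\<^sub>R z))))"
      by (subst integral_scaleR_right) (simp add: power2_eq_square)
    also have "\<dots> = (LINT z|lborel. of_real (2 * pi) * (f (?e *\<^sub>R z) * gaussian (1 / 2) 0 z))"
      using \<epsilon>[of n] by (intro Bochner_Integration.integral_cong refl) (simp add: gaussian_scale scaleR_conv_of_real)
    finally show ?thesis .
  qed
  moreover have "(\<lambda>n. LINT z|lborel. of_real (2 * pi) * (f (\<epsilon> n *\<^sub>R z) * gaussian (1 / 2) 0 z))
      \<longlonglongrightarrow> (LINT z|lborel. of_real (2 * pi) * (f 0 * gaussian (1 / 2) 0 z))"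
  proof (rule integral_dominated_convergence)
    show "integrable lborel (\<lambda>z. 2 * pi * (C * cmod (gaussian (1 / 2) 0 z)))"
      by (intro integrable_mult_right integrable_norm integrable_gaussian) auto
    show "AE z in lborel. (\<lambda>n. of_real (2 * pi) * (f (\<epsilon> n *\<^sub>R z) * gaussian (1 / 2) 0 z))
        \<longlonglongrightarrow> of_real (2 * pi) * (f 0 * gaussian (1 / 2) 0 z)"
    proof (intro AE_I2 tendsto_mult_left tendsto_mult_right)
      fix z :: "real \<times> real"
      have "(\<lambda>n. \<epsilon> n *\<^sub>R z) \<longlonglongrightarrow> 0"
        using tendsto_scaleR[OF \<epsilon>_lim tendsto_const[of z]] by simp
      then show "(\<lambda>n. f (\<epsilon> n *\<^sub>R z)) \<longlonglongrightarrow> f 0"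
        using cont by (intro continuous_on_tendsto_compose[where f = f and s = UNIV]) auto
    qed
    show "AE z in lborel. norm (of_real (2 * pi) * (f (\<epsilon> n *\<^sub>R z) * gaussian (1 / 2) 0 z)) \<le> 2 * pi * (C * cmod (gaussian (1 / 2) 0 z))" for n
      by (intro AE_I2) (simp add: norm_mult bound mult_right_mono)
  qed simp_all
  ultimately have "(LINT \<zeta>|lborel. fourier f \<zeta>) = (LINT z|lborel. of_real (2 * pi) * (f 0 * gaussian (1 / 2) 0 z))"
    by (simp add: LIMSEQ_unique)
  then show ?thesis
    using integral_gaussian by (simp add: power2_eq_square)
qed

text \<open>Inversion at the origin, applied to the translate of f by - z: the phase that
  translation produces is the kernel of the second transform.\<close>

lemma fourier_fourier:
  assumes "schwartz f"
  shows "fourier (fourier f) z = of_real ((2 * pi)\<^sup>2) * f (- z)"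
proof -
  have [measurable]: "f \<in> borel_measurable borel"
    using assms by (rule schwartz_borel_measurable)
  obtain C where C: "\<And>w. cmod (f w) \<le> C"
    using schwartz_bounded[OF assms] by blast
  let ?g = "\<lambda>w. f (- z + w)"
  have fg: "fourier ?g = (\<lambda>\<zeta>. cis (- (\<zeta> \<bullet> z)) * fourier f \<zeta>)"
    by (rule ext) (simp only: fourier_translate[OF \<open>f \<in> borel_measurable borel\<close>] inner_minus_left inner_minus_right inner_commute[of z])
  have "(LINT \<zeta>|lborel. fourier ?g \<zeta>) = of_real ((2 * pi)\<^sup>2) * ?g 0"
  proof (rule fourier_inversion_at_0)
    show "continuous_on UNIV ?g"
      by (intro continuous_on_compose2[OF schwartz_imp_continuous_on[OF assms]] continuous_intros) auto
    show "integrable lborel ?g"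
      by (intro integrable_translate schwartz_integrable assms)
    show "integrable lborel (fourier ?g)"
      unfolding fg by (intro fourier_integrand_integrable schwartz_integrable schwartz_fourier assms)
  qed (rule C)
  then show ?thesis
    unfolding fg fourier_def[of "fourier f"] by simp
qed

text \<open>The transform applied four times is (2 pi)^4 times the identity, since the two
  reflections cancel. Three applications thus give the preimage up to that factor.\<close>

lemma schwartz_eq_fourier:
  assumes "schwartz f"
  obtains g where "schwartz g" "f = fourier g"
proof
  let ?g = "\<lambda>z. of_real (1 / (2 * pi) ^ 4) * fourier (fourier (fourier f)) z"
  show "schwartz ?g"
    by (intro schwartz_cmult schwartz_fourier assms)
  have "fourier (fourier (fourier (fourier f))) z = of_real ((2 * pi) ^ 4) * f z" for z
    using assms by (simp only: fourier_fourier[OF schwartz_fourier[OF schwartz_fourier]]) (simp add: fourier_fourier flip: power_add)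
  then show "f = fourier ?g"
    unfolding fourier_cmult by simp
qed

text \<open>Boxes form an intersection-stable generator of the Borel sets, so vanishing of the
  integral spreads to all Borel sets, which forces k to vanish almost everywhere.\<close>

lemma AE_eq_0_if_box_integrals_eq_0:
  fixes k :: "'a :: euclidean_space \<Rightarrow> 'b :: {banach, second_countable_topology}"
  assumes k: "integrable lborel k" and box: "\<And>a b. (LINT z:box a b|lborel. k z) = 0"
  shows "AE z in lborel. k z = 0"
proof -
  have sint: "set_integrable lborel A k" if "A \<in> sets borel" for A
    using k that unfolding set_integrable_def by (intro integrable_mult_indicator) auto
  \<comment> \<open>Complements in the induction need the integral over the whole space, reached
    along an exhausting sequence of boxes.\<close>
  have "(\<lambda>n. LINT z:box (- (real n *\<^sub>R One)) (real n *\<^sub>R One)|lborel. k z) \<longlonglongrightarrow> (LINT z:(\<Union>n. box (- (real n *\<^sub>R One)) (real n *\<^sub>R One))|lborel. k z)"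
  proof (rule set_integral_cont_up)
    show "incseq (\<lambda>n. box (- (real n *\<^sub>R One)) (real n *\<^sub>R One) :: 'a set)"
      by (rule incseq_SucI) (auto simp: box_def)
  qed (use sint in auto)
  then have univ: "(LINT z|lborel. k z) = 0"
    unfolding box UN_box_eq_UNIV by (simp add: LIMSEQ_const_iff set_lebesgue_integral_def)
  have "(LINT z:A|lborel. k z) = 0" if "A \<in> sets borel" for A
  proof -
    have "Int_stable (range (\<lambda>(a, b). box a b :: 'a set))"
      by (auto simp: Int_stable_def Int_interval box_Int_box)
    moreover have "range (\<lambda>(a, b). box a b :: 'a set) \<subseteq> Pow UNIV"
      by simp
    moreover have sets: "sigma_sets UNIV (range (\<lambda>(a, b). box a b :: 'a set)) = sets borel"
      by (subst borel_eq_box) simp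
    then have "A \<in> sigma_sets UNIV (range (\<lambda>(a, b). box a b :: 'a set))"
      using that by simp
    ultimately show ?thesis
    proof (induction rule: sigma_sets_induct_disjoint)
      case (basic A)
      then show ?case
        by (auto simp: box)
    next
      case empty
      show ?case
        by (simp add: set_lebesgue_integral_def)
    next
      case (compl A)
      have "(LINT z:A \<union> (UNIV - A)|lborel. k z) = (LINT z:A|lborel. k z) + (LINT z:UNIV - A|lborel. k z)"
        using compl sets by (intro set_integral_Un sint) auto
      then show ?case
        using compl univ by (simp add: set_lebesgue_integral_def)
    next
      case (union A)
      have "(LINT z:(\<Union>i. A i)|lborel. k z) = (\<Sum>i. (LINT z:A i|lborel. k z))"
        using union sets by (intro lebesgue_integral_countable_add sint) (auto simp: disjoint_family_on_def)
      then show ?case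
        using union by simp
    qed
  qed
  then show ?thesis
    using sigma_finite_measure.density_zero[OF lborel.sigma_finite_measure_axioms k] by simp
qed


section \<open>Distributions with integrable Fourier transform\<close>

text \<open>The indicator of a box mollified by a Gaussian is a superposition of translated
  Gaussians, so k is orthogonal to it by Fubini. As the width shrinks, the mollifications tend to 2
  pi times the indicator off the frontier of the box, which is a null set.\<close>

lemma AE_eq_0_if_gaussian_orthogonal:
  fixes k :: plane_fun
  assumes k: "integrable lborel k"
    and orth: "\<And>p a. p > 0 \<Longrightarrow> (LINT z|lborel. k z * gaussian p 0 (z - a)) = 0"
  shows "AE z in lborel. k z = 0"
proof (rule AE_eq_0_if_box_integrals_eq_0[OF k])
  fix a b :: "real \<times> real"
  define A where "A = box a b"
  have A[measurable]: "A \<in> sets borel"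
    by (simp add: A_def)
  have k'[measurable]: "k \<in> borel_measurable borel"
    using k by auto
  define G where "G = gaussian (1 / 2) 0"
  have G: "integrable lborel G"
    by (simp add: G_def integrable_gaussian)
  have G'[measurable]: "G \<in> borel_measurable borel"
    by (simp add: G_def)
  define I where "I z = complex_of_real (indicator A z)" for z
  have I'[measurable]: "I \<in> borel_measurable borel"
    unfolding I_def by measurable
  have I_le: "cmod (I z) \<le> 1" for z
    by (simp add: I_def indicator_def)
  have "integrable lborel (indicator A :: _ \<Rightarrow> real)"
    unfolding A_def by (intro integrable_real_indicator) (auto simp: emeasure_lborel_box_eq)
  then have I: "integrable lborel I"
    unfolding I_def by (rule integrable_of_real)
  define \<epsilon> where "\<epsilon> n = inverse (real (Suc n))" for n
  have \<epsilon>: "0 < \<epsilon> n" for n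
    by (simp add: \<epsilon>_def)
  have \<epsilon>_lim: "\<epsilon> \<longlonglongrightarrow> 0"
    unfolding \<epsilon>_def by (rule LIMSEQ_inverse_real_of_nat)
  define J where "J n z = (LINT v|lborel. I (z + \<epsilon> n *\<^sub>R v) * G v)" for n z
  have J'[measurable]: "J n \<in> borel_measurable borel" for n
    unfolding J_def by measurable
  have zero: "(LINT z|lborel. k z * J n z) = 0" for n
  proof -
    define p where "p = 1 / (2 * (\<epsilon> n)\<^sup>2)"
    have p: "p > 0"
      using \<epsilon>[of n] by (simp add: p_def)
    \<comment> \<open>The substitution w = z + \<epsilon> v exhibits \<open>J n\<close> as a
      convolution with a narrow Gaussian, the form to which orthogonality applies; the defining form
      is the one suited to the limit.\<close>
    have J: "J n z = of_real (1 / (\<epsilon> n)\<^sup>2) * (LINT w|lborel. I w * gaussian p 0 (z - w))" for z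
    proof -
      have sym: "gaussian p 0 (z - w) = gaussian p 0 (w - z)" for w
        by (simp add: gaussian_def inner_diff_left inner_diff_right inner_commute)
      have "(LINT w|lborel. I w * gaussian p 0 (w - z)) = (LINT w|lborel. I (z + w) * gaussian p 0 (z + w - z))"
        by (rule integral_translate[symmetric]) measurable
      also have "\<dots> = \<bar>\<epsilon> n\<bar> ^ DIM(real \<times> real) *\<^sub>R (LINT w|lborel. I (z + \<epsilon> n *\<^sub>R w) * gaussian p 0 (z + \<epsilon> n *\<^sub>R w - z))"
        by (rule integral_scale) (use \<epsilon>[of n] in auto)
      also have "\<dots> = of_real ((\<epsilon> n)\<^sup>2) * J n z"
      proof -
        have "gaussian p 0 (\<epsilon> n *\<^sub>R w) = G w" for w
          using \<epsilon>[of n] by (simp add: p_def G_def gaussian_scale)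
        then show ?thesis
          by (simp add: J_def scaleR_conv_of_real power2_eq_square)
      qed
      finally show ?thesis
        using \<epsilon>[of n] by (simp add: sym)
    qed
    have int: "integrable (lborel \<Otimes>\<^sub>M lborel) (\<lambda>(z, w). k z * I w * gaussian p 0 (z - w))"
    proof -
      have "integrable (lborel \<Otimes>\<^sub>M lborel) (\<lambda>q. (k (fst q) * I (snd q)) * gaussian p 0 (fst q - snd q))"
      proof (rule integrable_mult_bounded)
        show "integrable (lborel \<Otimes>\<^sub>M lborel) (\<lambda>q. k (fst q) * I (snd q))"
          using integrable_tensor(1)[OF k I] by (simp add: lborel_prod)
        show "(\<lambda>q. gaussian p 0 (fst q - snd q)) \<in> borel_measurable (lborel \<Otimes>\<^sub>M lborel)"
          by measurable
        show "cmod (gaussian p 0 (fst q - snd q)) \<le> 1" for q :: "(real \<times> real) \<times> (real \<times> real)"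
          using p by (simp add: gaussian_def)
      qed
      then show ?thesis
        by (simp add: case_prod_unfold)
    qed
    have "k z * J n z = of_real (1 / (\<epsilon> n)\<^sup>2) * (LINT w|lborel. k z * I w * gaussian p 0 (z - w))" for z
      unfolding J mult.assoc integral_mult_right_zero by (rule mult.left_commute)
    then have "(LINT z|lborel. k z * J n z) = of_real (1 / (\<epsilon> n)\<^sup>2) * (LINT z|lborel. LINT w|lborel. k z * I w * gaussian p 0 (z - w))"
      by (simp only: integral_mult_right_zero)
    also have "(LINT z|lborel. LINT w|lborel. k z * I w * gaussian p 0 (z - w))
        = (LINT w|lborel. LINT z|lborel. k z * I w * gaussian p 0 (z - w))"
      by (rule lborel_pair.Fubini_integral[OF int, symmetric])
    also have "\<dots> = (LINT w|lborel. I w * (LINT z|lborel. k z * gaussian p 0 (z - w)))"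
      by (simp add: mult.assoc mult.left_commute[of "k _"])
    also have "\<dots> = 0"
      by (simp add: orth[OF p])
    finally show ?thesis
      by simp
  qed
  have J_lim: "(\<lambda>n. J n z) \<longlonglongrightarrow> of_real (2 * pi) * I z" if z: "z \<notin> frontier A" for z
  proof -
    have "(\<lambda>n. J n z) \<longlonglongrightarrow> (LINT v|lborel. I z * G v)"
      unfolding J_def
    proof (rule integral_dominated_convergence)
      show "integrable lborel (\<lambda>v. cmod (G v))"
        using G by simp
      show "AE v in lborel. (\<lambda>n. I (z + \<epsilon> n *\<^sub>R v) * G v) \<longlonglongrightarrow> I z * G v"
      proof (intro AE_I2 tendsto_mult_right)
        fix v
        have lim: "(\<lambda>n. z + \<epsilon> n *\<^sub>R v) \<longlonglongrightarrow> z"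
          using tendsto_add[OF tendsto_const[of z] tendsto_scaleR[OF \<epsilon>_lim tendsto_const[of v]]] by simp
        consider "z \<in> A" | "z \<in> - closure A"
          using z interior_subset[of A] by (auto simp: frontier_def)
        then have "\<forall>\<^sub>F n in sequentially. I (z + \<epsilon> n *\<^sub>R v) = I z"
        proof cases
          case 1
          then have "\<forall>\<^sub>F n in sequentially. z + \<epsilon> n *\<^sub>R v \<in> A"
            by (intro topological_tendstoD[OF lim]) (auto simp: A_def)
          then show ?thesis
            by eventually_elim (use 1 in \<open>simp add: I_def\<close>)
        next
          case 2
          then have "\<forall>\<^sub>F n in sequentially. z + \<epsilon> n *\<^sub>R v \<in> - closure A"
            by (intro topological_tendstoD[OF lim]) auto
          then show ?thesis
            by eventually_elim (use 2 closure_subset[of A] in \<open>auto simp: I_def indicator_def\<close>)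
        qed
        then show "(\<lambda>n. I (z + \<epsilon> n *\<^sub>R v)) \<longlonglongrightarrow> I z"
          by (rule tendsto_eventually)
      qed
      show "AE v in lborel. norm (I (z + \<epsilon> n *\<^sub>R v) * G v) \<le> cmod (G v)" for n
        by (intro AE_I2) (simp add: norm_mult I_le mult_left_le_one_le)
    qed simp_all
    then show ?thesis
      using integral_gaussian by (simp add: G_def mult.commute)
  qed
  have J_le: "cmod (J n z) \<le> (LINT v|lborel. cmod (G v))" for n z
    unfolding J_def
  proof (rule order.trans[OF integral_norm_bound], rule Bochner_Integration.integral_mono)
    show "integrable lborel (\<lambda>v. norm (I (z + \<epsilon> n *\<^sub>R v) * G v))"
      using integrable_mult_bounded[OF G, of "\<lambda>v. I (z + \<epsilon> n *\<^sub>R v)" 1] I_le by (simp add: mult.commute)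
  qed (use G I_le in \<open>auto simp: norm_mult mult_left_le_one_le\<close>)
  have "(\<lambda>n. LINT z|lborel. k z * J n z) \<longlonglongrightarrow> (LINT z|lborel. k z * (of_real (2 * pi) * I z))"
  proof (rule integral_dominated_convergence)
    show "integrable lborel (\<lambda>z. cmod (k z) * (LINT v|lborel. cmod (G v)))"
      using k by simp
    have "frontier A \<in> null_sets lborel"
      using negligible_convex_frontier[of A]
      by (simp add: A_def negligible_iff_null_sets null_sets_completion_iff)
    from AE_not_in[OF this] show "AE z in lborel. (\<lambda>n. k z * J n z) \<longlonglongrightarrow> k z * (of_real (2 * pi) * I z)"
      by eventually_elim (intro tendsto_mult_left J_lim)
    show "AE z in lborel. norm (k z * J n z) \<le> cmod (k z) * (LINT v|lborel. cmod (G v))" for n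
      by (intro AE_I2) (simp add: norm_mult J_le mult_left_mono)
  qed simp_all
  then have "(LINT z|lborel. of_real (2 * pi) * (k z * I z)) = 0"
    unfolding zero by (simp add: LIMSEQ_const_iff mult.left_commute)
  then have "(LINT z|lborel. k z * I z) = 0"
    by simp
  moreover have "indicator A z *\<^sub>R k z = k z * I z" for z
    by (simp add: I_def scaleR_conv_of_real)
  ultimately show "(LINT z:box a b|lborel. k z) = 0"
    by (simp add: set_lebesgue_integral_def A_def)
qed

lemma regular_apply:
  assumes "regular u f" "schwartz \<psi>"
  shows "u \<psi> = (LINT z|lborel. f z * \<psi> z)"
proof -
  have "u = (\<lambda>\<psi>. if schwartz \<psi> then LINT z|lborel. f z * \<psi> z else 0)"
    using assms(1) unfolding regular_def by blast
  from fun_cong[OF this, of \<psi>] show ?thesis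
    using assms(2) by simp
qed

text \<open>f - g is known to be integrable only against Schwartz functions. Multiplication by a
  fixed Gaussian makes it integrable, and that factor vanishes nowhere.\<close>

lemma regular_unique:
  assumes f: "regular u f" and g: "regular u g"
  shows "AE z in lborel. f z = g z"
proof -
  have [measurable]: "f \<in> borel_measurable borel" "g \<in> borel_measurable borel"
    using f g by (auto simp: regular_def)
  have int: "integrable lborel (\<lambda>z. f z * \<psi> z)" "integrable lborel (\<lambda>z. g z * \<psi> z)" if "schwartz \<psi>" for \<psi>
    using f g that by (auto simp: regular_def)
  have eq: "(LINT z|lborel. (f z - g z) * \<psi> z) = 0" if "schwartz \<psi>" for \<psi>
  proof -
    have "(LINT z|lborel. f z * \<psi> z) = (LINT z|lborel. g z * \<psi> z)"
      using regular_apply[OF f that] regular_apply[OF g that] by simp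
    with int[OF that] show ?thesis
      by (simp add: left_diff_distrib)
  qed
  define k where "k z = (f z - g z) * gaussian 1 0 z" for z
  have "AE z in lborel. k z = 0"
  proof (rule AE_eq_0_if_gaussian_orthogonal)
    show "integrable lborel k"
      using int[OF schwartz_gaussian[of 1 0]] by (simp add: k_def[abs_def] left_diff_distrib)
    fix p :: real and a :: "real \<times> real" assume "p > 0"
    then have S: "schwartz (gaussian (1 + p) ((2 * p) *\<^sub>R a))"
      by (intro schwartz_gaussian) simp
    \<comment> \<open>Completing the square: a centred Gaussian times a translated one is a constant
      times a Gaussian with a linear term, hence a Schwartz function. This is what the parameter b
      of \<open>gaussian\<close> is for.\<close>
    have "k z * gaussian p 0 (z - a) =
        of_real (exp (- p * (a \<bullet> a))) * ((f z - g z) * gaussian (1 + p) ((2 * p) *\<^sub>R a) z)" for z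
    proof -
      have "(0 \<bullet> z - 1 * (z \<bullet> z)) + (0 \<bullet> (z - a) - p * ((z - a) \<bullet> (z - a))) =
          - p * (a \<bullet> a) + ((2 * p) *\<^sub>R a \<bullet> z - (1 + p) * (z \<bullet> z))"
        by (simp add: inner_diff_left inner_diff_right inner_commute algebra_simps)
      then have "exp (0 \<bullet> z - 1 * (z \<bullet> z)) * exp (0 \<bullet> (z - a) - p * ((z - a) \<bullet> (z - a))) =
          exp (- p * (a \<bullet> a)) * exp ((2 * p) *\<^sub>R a \<bullet> z - (1 + p) * (z \<bullet> z))"
        unfolding exp_add[symmetric] by simp
      then have "gaussian 1 0 z * gaussian p 0 (z - a) = of_real (exp (- p * (a \<bullet> a))) * gaussian (1 + p) ((2 * p) *\<^sub>R a) z"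
        unfolding gaussian_def of_real_mult[symmetric] by (simp only:)
      then show ?thesis
        by (simp add: k_def mult.assoc mult.left_commute)
    qed
    then show "(LINT z|lborel. k z * gaussian p 0 (z - a)) = 0"
      using eq[OF S] by simp
  qed
  then show ?thesis
    by eventually_elim (simp add: k_def gaussian_def)
qed

section \<open>Operations on distributions given by their Fourier transform\<close>

definition inv_fourier :: "plane_fun \<Rightarrow> plane_fun" where
  "inv_fourier f = (\<lambda>z. of_real (1 / (2 * pi)\<^sup>2) * fourier f (- z))"

text \<open>The tempered distribution with Fourier transform g, defined by duality; the value 0 off
  the Schwartz space follows the convention of \<open>tempered\<close>.\<close>

definition spectral_dist :: "plane_fun \<Rightarrow> dist" where
  "spectral_dist g = (\<lambda>\<psi>. if schwartz \<psi> then LINT \<zeta>|lborel. g \<zeta> * inv_fourier \<psi> \<zeta> else 0)"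

lemma inv_fourier_measurable [measurable]:
  assumes [measurable]: "f \<in> borel_measurable borel"
  shows "inv_fourier f \<in> borel_measurable borel"
  unfolding inv_fourier_def by measurable

lemma cmod_inv_fourier_le: "cmod (inv_fourier f z) \<le> 1 / (2 * pi)\<^sup>2 * (LINT z|lborel. cmod (f z))"
  unfolding inv_fourier_def norm_mult norm_of_real by (simp add: cmod_fourier_le mult_left_mono divide_right_mono)

lemma inv_fourier_fourier: "schwartz f \<Longrightarrow> inv_fourier (fourier f) z = f z"
  by (simp add: inv_fourier_def fourier_fourier)

lemma fourier_reflect:
  assumes [measurable]: "f \<in> borel_measurable borel"
  shows "fourier (\<lambda>z. f (- z)) \<zeta> = fourier f (- \<zeta>)"
proof -
  have "fourier f (- \<zeta>) = \<bar>- 1\<bar> ^ DIM(real \<times> real) *\<^sub>R (LINT z|lborel. cis (- (((- 1) *\<^sub>R z) \<bullet> - \<zeta>)) * f ((- 1) *\<^sub>R z))"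
    unfolding fourier_def by (rule integral_scale) auto
  then show ?thesis
    by (simp add: fourier_def)
qed

lemma integrable_mult_inv_fourier:
  assumes "integrable lborel g" "integrable lborel f"
  shows "integrable lborel (\<lambda>\<zeta>. g \<zeta> * inv_fourier f \<zeta>)"
  by (rule integrable_mult_bounded[OF assms(1) _ cmod_inv_fourier_le]) (use assms(2) in auto)

lemma integral_inv_fourier_swap:
  assumes g: "integrable lborel g" and f: "integrable lborel f"
  shows "(LINT z|lborel. inv_fourier g z * f z) = (LINT \<zeta>|lborel. g \<zeta> * inv_fourier f \<zeta>)"
proof -
  have [measurable]: "f \<in> borel_measurable borel" "g \<in> borel_measurable borel"
    using f g by auto
  have f': "integrable lborel (\<lambda>z. f (- z))"
    using integrable_scale[OF f, of "- 1"] by simp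
  have "(LINT z|lborel. inv_fourier g z * f z) = \<bar>- 1\<bar> ^ DIM(real \<times> real) *\<^sub>R (LINT z|lborel. inv_fourier g ((- 1) *\<^sub>R z) * f ((- 1) *\<^sub>R z))"
    by (rule integral_scale) auto
  also have "\<dots> = of_real (1 / (2 * pi)\<^sup>2) * (LINT z|lborel. fourier g z * f (- z))"
    by (simp add: inv_fourier_def mult.assoc)
  also have "(LINT z|lborel. fourier g z * f (- z)) = (LINT \<zeta>|lborel. g \<zeta> * fourier f (- \<zeta>))"
    by (simp add: fourier_multiplication_formula[OF g f'] fourier_reflect)
  also have "of_real (1 / (2 * pi)\<^sup>2) * \<dots> = (LINT \<zeta>|lborel. g \<zeta> * inv_fourier f \<zeta>)"
    by (simp add: inv_fourier_def mult.left_commute)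
  finally show ?thesis .
qed

lemma regular_spectral_dist:
  assumes g: "integrable lborel g"
  shows "regular (spectral_dist g) (inv_fourier g)"
  unfolding regular_def
proof (intro conjI allI impI)
  show "inv_fourier g \<in> borel_measurable borel"
    using g by auto
  show "integrable lborel (\<lambda>z. inv_fourier g z * \<psi> z)" if "schwartz \<psi>" for \<psi>
    using integrable_mult_inv_fourier[OF schwartz_integrable[OF that] g] by (simp add: mult.commute)
  show "spectral_dist g = (\<lambda>\<psi>. if schwartz \<psi> then LINT z|lborel. inv_fourier g z * \<psi> z else 0)"
    using integral_inv_fourier_swap[OF g] by (auto simp: spectral_dist_def schwartz_integrable)
qed

lemma regular_dist_fourier_spectral_dist:
  assumes g: "integrable lborel g"
  shows "regular (dist_fourier (spectral_dist g)) g"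
  unfolding regular_def
proof (intro conjI allI impI)
  show "g \<in> borel_measurable borel"
    using g by auto
  show "integrable lborel (\<lambda>z. g z * \<psi> z)" if "schwartz \<psi>" for \<psi>
    by (rule schwartz_bounded[OF that]) (rule integrable_mult_bounded[OF g], use that schwartz_borel_measurable in auto)
  show "dist_fourier (spectral_dist g) = (\<lambda>\<psi>. if schwartz \<psi> then LINT z|lborel. g z * \<psi> z else 0)"
    by (auto simp: dist_fourier_def spectral_dist_def schwartz_fourier inv_fourier_fourier)
qed

lemma schwartz_le_seminorm:
  assumes "schwartz f"
  shows "(1 + norm z) ^ m * cmod (f z) \<le> schwartz_seminorm m f"
proof -
  let ?s = "\<lambda>j k. SUP z. (1 + norm z) ^ m * cmod (mixed_deriv j k f z)"
  have bdd: "bdd_above (range (\<lambda>z. (1 + norm z) ^ m * cmod (mixed_deriv j k f z)))" for j k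
    using assms by (simp add: schwartz_def)
  have nonneg: "0 \<le> ?s j k" for j k
    by (rule order.trans[OF _ cSUP_upper[OF UNIV_I bdd]]) simp
  have "(1 + norm z) ^ m * cmod (f z) \<le> ?s 0 0"
    using cSUP_upper[OF UNIV_I bdd[of 0 0], of z] by simp
  also have "\<dots> \<le> (\<Sum>k\<le>m. ?s 0 k)"
    by (rule member_le_sum) (use nonneg in auto)
  also have "\<dots> \<le> schwartz_seminorm m f"
    unfolding schwartz_seminorm_def
    by (rule member_le_sum[where f = "\<lambda>j. \<Sum>k\<le>m. ?s j k"]) (use nonneg in \<open>auto intro: sum_nonneg\<close>)
  finally show ?thesis .
qed

text \<open>The value at \<psi> is at most the L1 norm of g times the supremum of
  \<open>inv_fourier \<psi>\<close>, hence bounded by the L1 norm of \<psi>. The seminorm of order 4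
  controls the latter, as a decay of order 4 is integrable on the plane.\<close>

lemma tempered_spectral_dist:
  assumes g: "integrable lborel g"
  shows "tempered (spectral_dist g)"
  unfolding tempered_def
proof (intro conjI allI impI)
  fix f h and a b :: complex assume f: "schwartz f" and h: "schwartz h"
  have "inv_fourier (\<lambda>z. a * f z + b * h z) \<zeta> = a * inv_fourier f \<zeta> + b * inv_fourier h \<zeta>" for \<zeta>
    using fourier_integrand_integrable[OF schwartz_integrable[OF f]] fourier_integrand_integrable[OF schwartz_integrable[OF h]]
    by (simp add: inv_fourier_def fourier_def distrib_left mult.left_commute)
  then show "spectral_dist g (\<lambda>z. a * f z + b * h z) = a * spectral_dist g f + b * spectral_dist g h"
    using integrable_mult_inv_fourier[OF g schwartz_integrable[OF f]] integrable_mult_inv_fourier[OF g schwartz_integrable[OF h]]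
    by (simp add: spectral_dist_def f h schwartz_lincomb distrib_left mult.left_commute)
next
  define I where "I = (LINT z|lborel. cmod (of_real (1 / (1 + norm (z :: real \<times> real)) ^ 4)))"
  have I: "integrable lborel (\<lambda>z :: real \<times> real. complex_of_real (1 / (1 + norm z) ^ 4))"
  proof (rule integrable_if_decay[where C = 1])
    fix z :: "real \<times> real"
    have "0 < (1 + norm z) ^ 4"
      by (intro zero_less_power add_pos_nonneg) simp_all
    then show "(1 + norm z) ^ 4 * cmod (complex_of_real (1 / (1 + norm z) ^ 4)) \<le> 1"
      unfolding norm_of_real by simp
  qed measurable
  have "cmod (spectral_dist g f) \<le> (LINT \<zeta>|lborel. cmod (g \<zeta>)) * (1 / (2 * pi)\<^sup>2 * I) * schwartz_seminorm 4 f" if f: "schwartz f" for f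
  proof -
    have "(LINT z|lborel. cmod (f z)) \<le> (LINT z|lborel. schwartz_seminorm 4 f * cmod (of_real (1 / (1 + norm (z :: real \<times> real)) ^ 4)))"
    proof (rule Bochner_Integration.integral_mono)
      show "integrable lborel (\<lambda>z :: real \<times> real. schwartz_seminorm 4 f * cmod (of_real (1 / (1 + norm z) ^ 4)))"
        by (intro integrable_mult_right integrable_norm I)
      fix z :: "real \<times> real"
      have "0 < (1 + norm z) ^ 4"
        by (intro zero_less_power add_pos_nonneg) simp_all
      with schwartz_le_seminorm[OF f, of z 4]
      show "cmod (f z) \<le> schwartz_seminorm 4 f * cmod (of_real (1 / (1 + norm z) ^ 4))"
        unfolding norm_of_real by (simp add: pos_le_divide_eq mult.commute)
    qed (use f in \<open>simp add: schwartz_integrable\<close>)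
    then have le: "(LINT z|lborel. cmod (f z)) \<le> schwartz_seminorm 4 f * I"
      by (simp add: I_def)
    have "cmod (spectral_dist g f) \<le> (LINT \<zeta>|lborel. cmod (g \<zeta>) * (1 / (2 * pi)\<^sup>2 * (LINT z|lborel. cmod (f z))))"
      unfolding spectral_dist_def if_P[OF f]
    proof (rule order.trans[OF integral_norm_bound], rule Bochner_Integration.integral_mono)
      show "integrable lborel (\<lambda>\<zeta>. norm (g \<zeta> * inv_fourier f \<zeta>))"
        by (intro integrable_norm integrable_mult_inv_fourier g schwartz_integrable f)
      show "integrable lborel (\<lambda>\<zeta>. cmod (g \<zeta>) * (1 / (2 * pi)\<^sup>2 * (LINT z|lborel. cmod (f z))))"
        by (intro integrable_mult_left integrable_norm g)
      show "norm (g \<zeta> * inv_fourier f \<zeta>) \<le> cmod (g \<zeta>) * (1 / (2 * pi)\<^sup>2 * (LINT z|lborel. cmod (f z)))" for \<zeta>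
        unfolding norm_mult by (intro mult_left_mono cmod_inv_fourier_le norm_ge_zero)
    qed
    also have "\<dots> = (LINT \<zeta>|lborel. cmod (g \<zeta>)) * (1 / (2 * pi)\<^sup>2 * (LINT z|lborel. cmod (f z)))"
      by simp
    also have "\<dots> \<le> (LINT \<zeta>|lborel. cmod (g \<zeta>)) * (1 / (2 * pi)\<^sup>2 * (schwartz_seminorm 4 f * I))"
      by (intro mult_left_mono le) auto
    finally show ?thesis
      by (simp add: mult_ac)
  qed
  then show "\<exists>m C. \<forall>f. schwartz f \<longrightarrow> cmod (spectral_dist g f) \<le> C * schwartz_seminorm m f"
    by blast
qed (simp add: spectral_dist_def)

text \<open>Every Schwartz function is the transform of one, so u and v agree on the Schwartz space;
  elsewhere \<open>tempered\<close> makes both 0.\<close>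

lemma dist_fourier_inject:
  assumes "tempered u" "tempered v" "dist_fourier u = dist_fourier v"
  shows "u = v"
proof
  fix \<psi>
  show "u \<psi> = v \<psi>"
  proof (cases "schwartz \<psi>")
    case True
    then obtain f where "schwartz f" "\<psi> = fourier f"
      by (rule schwartz_eq_fourier)
    then show ?thesis
      using fun_cong[OF assms(3), of f] by (simp add: dist_fourier_def)
  next
    case False
    then show ?thesis
      using assms(1,2) by (simp add: tempered_def)
  qed
qed

lemma regular_imp_eq: "regular u g \<Longrightarrow> regular v g \<Longrightarrow> u = v"
  by (simp add: regular_def)

text \<open>Ties the arbitrary choice in \<open>fourier_fun\<close> to a known representative, up to
  a null set.\<close>

lemma fourier_fun_unique:
  assumes "regular (dist_fourier u) g"
  shows "regular (dist_fourier u) (fourier_fun u)" and "AE \<zeta> in lborel. fourier_fun u \<zeta> = g \<zeta>"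
proof -
  show *: "regular (dist_fourier u) (fourier_fun u)"
    unfolding fourier_fun_def by (rule someI[of "regular (dist_fourier u)", OF assms])
  show "AE \<zeta> in lborel. fourier_fun u \<zeta> = g \<zeta>"
    by (rule regular_unique[OF * assms])
qed

lemma regular_cong_AE:
  assumes g: "regular u g" and h[measurable]: "h \<in> borel_measurable borel" and eq: "AE z in lborel. g z = h z"
  shows "regular u h"
proof -
  have [measurable]: "g \<in> borel_measurable borel"
    using g by (simp add: regular_def)
  have "integrable lborel (\<lambda>z. g z * \<psi> z) \<longleftrightarrow> integrable lborel (\<lambda>z. h z * \<psi> z)"
    "(LINT z|lborel. g z * \<psi> z) = (LINT z|lborel. h z * \<psi> z)" if "schwartz \<psi>" for \<psi>
  proof -
    have [measurable]: "\<psi> \<in> borel_measurable borel"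
      using that by (rule schwartz_borel_measurable)
    have "AE z in lborel. g z * \<psi> z = h z * \<psi> z"
      using eq by eventually_elim simp
    then show "integrable lborel (\<lambda>z. g z * \<psi> z) \<longleftrightarrow> integrable lborel (\<lambda>z. h z * \<psi> z)"
      "(LINT z|lborel. g z * \<psi> z) = (LINT z|lborel. h z * \<psi> z)"
      by (intro integrable_cong_AE integral_cong_AE; simp)+
  qed
  then show ?thesis
    using g by (auto simp: regular_def fun_eq_iff simp del: split_paired_All)
qed

text \<open>Resolves the \<open>THE\<close> in \<open>fourier_multiplier\<close>: the right-hand
  side is a candidate and \<open>dist_fourier_inject\<close> makes it the only one. The chosen
  \<open>fourier_fun\<close> equals g only almost everywhere, hence the detour through
  \<open>regular_cong_AE\<close>.\<close>

lemma fourier_multiplier_spectral_dist: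
  assumes g: "integrable lborel g" and m[measurable]: "m \<in> borel_measurable borel" and bound: "\<And>\<zeta>. cmod (m \<zeta>) \<le> C"
  shows "fourier_multiplier m (spectral_dist g) = spectral_dist (\<lambda>\<zeta>. m \<zeta> * g \<zeta>)"
  unfolding fourier_multiplier_def
proof (rule the_equality)
  let ?u = "spectral_dist g" and ?v = "spectral_dist (\<lambda>\<zeta>. m \<zeta> * g \<zeta>)"
  note F = fourier_fun_unique[OF regular_dist_fourier_spectral_dist[OF g]]
  have [measurable]: "fourier_fun ?u \<in> borel_measurable borel"
    using F(1) by (simp add: regular_def)
  have mg: "integrable lborel (\<lambda>\<zeta>. m \<zeta> * g \<zeta>)"
    using integrable_mult_bounded[OF g _ bound] by (simp add: mult.commute)
  have "regular (dist_fourier ?v) (\<lambda>\<zeta>. m \<zeta> * fourier_fun ?u \<zeta>)"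
  proof (rule regular_cong_AE[OF regular_dist_fourier_spectral_dist[OF mg]])
    show "AE \<zeta> in lborel. m \<zeta> * g \<zeta> = m \<zeta> * fourier_fun ?u \<zeta>"
      using F(2) by eventually_elim simp
  qed measurable
  then show *: "tempered ?v \<and> regular (dist_fourier ?v) (\<lambda>\<zeta>. m \<zeta> * fourier_fun ?u \<zeta>)"
    using tempered_spectral_dist[OF mg] by blast
  show "v = ?v" if "tempered v \<and> regular (dist_fourier v) (\<lambda>\<zeta>. m \<zeta> * fourier_fun ?u \<zeta>)" for v
    using that * dist_fourier_inject regular_imp_eq by blast
qed


section \<open>The second Picard iterate\<close>

definition dispersion :: "real \<Rightarrow> real \<times> real \<Rightarrow> real" where
  "dispersion \<alpha> \<zeta> = fst \<zeta> ^ 3 + sgn (fst \<zeta>) * \<bar>fst \<zeta>\<bar> powr \<alpha> * (snd \<zeta>)\<^sup>2"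

lemma borel_measurable_fst_prod [measurable (raw)]:
  "f \<in> M \<rightarrow>\<^sub>M (borel :: (real \<times> real) measure) \<Longrightarrow> (\<lambda>x. fst (f x)) \<in> borel_measurable M"
  by (erule measurable_compose) (intro borel_measurable_continuous_onI continuous_intros)

lemma borel_measurable_snd_prod [measurable (raw)]:
  "f \<in> M \<rightarrow>\<^sub>M (borel :: (real \<times> real) measure) \<Longrightarrow> (\<lambda>x. snd (f x)) \<in> borel_measurable M"
  by (erule measurable_compose) (intro borel_measurable_continuous_onI continuous_intros)

lemma dispersion_measurable [measurable]: "dispersion \<alpha> \<in> borel_measurable borel"
  unfolding dispersion_def sgn_if by measurable

lemma W_spectral_dist:
  assumes "integrable lborel g"
  shows "W \<alpha> t (spectral_dist g) = spectral_dist (\<lambda>\<zeta>. cis (- t * dispersion \<alpha> \<zeta>) * g \<zeta>)"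
proof -
  have "W \<alpha> t = fourier_multiplier (\<lambda>\<zeta>. cis (- t * dispersion \<alpha> \<zeta>))"
    by (simp add: W_def dispersion_def case_prod_unfold)
  moreover have "cmod (cis (- t * dispersion \<alpha> \<zeta>)) \<le> 1" for \<zeta>
    by simp
  ultimately show ?thesis
    using fourier_multiplier_spectral_dist[OF assms, of "\<lambda>\<zeta>. cis (- t * dispersion \<alpha> \<zeta>)" 1] by simp
qed

text \<open>The minus sign of the distributional derivative cancels the one from
  \<open>inv_fourier\<close>, which evaluates the transform at - \<zeta>.\<close>

lemma dist_x_deriv_spectral_dist:
  "dist_x_deriv (spectral_dist g) = spectral_dist (\<lambda>\<zeta>. \<i> * of_real (fst \<zeta>) * g \<zeta>)"
proof
  fix \<psi>
  show "dist_x_deriv (spectral_dist g) \<psi> = spectral_dist (\<lambda>\<zeta>. \<i> * of_real (fst \<zeta>) * g \<zeta>) \<psi>"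
  proof (cases "schwartz \<psi>")
    case True
    have "g \<zeta> * inv_fourier (x_deriv \<psi>) \<zeta> = - (\<i> * of_real (fst \<zeta>) * g \<zeta> * inv_fourier \<psi> \<zeta>)" for \<zeta>
      by (simp add: inv_fourier_def fourier_x_deriv[OF True])
    then show ?thesis
      using True by (simp add: dist_x_deriv_def spectral_dist_def schwartz_x_deriv)
  qed (simp add: dist_x_deriv_def spectral_dist_def)
qed

text \<open>The factor 1 / (2 pi)^2 makes this the Fourier transform of a pointwise product under
  the unnormalised \<open>fourier\<close>; see \<open>inv_fourier_convolve\<close>.\<close>

definition convolve :: "plane_fun \<Rightarrow> plane_fun \<Rightarrow> plane_fun" where
  "convolve g k = (\<lambda>\<zeta>. of_real (1 / (2 * pi)\<^sup>2) * (LINT \<zeta>'|lborel. g (\<zeta> - \<zeta>') * k \<zeta>'))"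

lemma integrable_convolve_integrand:
  fixes g k :: plane_fun
  assumes g: "integrable lborel g" and k: "integrable lborel k"
  shows "integrable (lborel \<Otimes>\<^sub>M lborel) (\<lambda>(\<zeta>', \<zeta>). g (\<zeta> - \<zeta>') * k \<zeta>')"
proof (rule lborel_pair.Fubini_integrable)
  have [measurable]: "g \<in> borel_measurable borel" "k \<in> borel_measurable borel"
    using g k by auto
  show "(\<lambda>(\<zeta>', \<zeta>). g (\<zeta> - \<zeta>') * k \<zeta>') \<in> borel_measurable (lborel \<Otimes>\<^sub>M lborel)"
    by measurable
  have g': "integrable lborel (\<lambda>\<zeta>. g (\<zeta> - \<zeta>'))" for \<zeta>'
    using integrable_translate[OF g, of "- \<zeta>'"] by simp
  have "(LINT \<zeta>|lborel. cmod (g (\<zeta> - \<zeta>'))) = (LINT \<zeta>|lborel. cmod (g \<zeta>))" for \<zeta>'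
    using integral_translate[of "\<lambda>\<zeta>. cmod (g \<zeta>)" "- \<zeta>'"] by simp
  then show "integrable lborel (\<lambda>\<zeta>'. LINT \<zeta>|lborel. norm (case (\<zeta>', \<zeta>) of (\<zeta>', \<zeta>) \<Rightarrow> g (\<zeta> - \<zeta>') * k \<zeta>'))"
    using k by (simp add: norm_mult)
  show "AE \<zeta>' in lborel. integrable lborel (\<lambda>\<zeta>. case (\<zeta>', \<zeta>) of (\<zeta>', \<zeta>) \<Rightarrow> g (\<zeta> - \<zeta>') * k \<zeta>')"
    using g' by simp
qed

lemma integrable_convolve:
  assumes "integrable lborel g" "integrable lborel k"
  shows "integrable lborel (convolve g k)"
  unfolding convolve_def
  using lborel_pair.integrable_snd[OF integrable_convolve_integrand[OF assms]] by simp

lemma cmod_convolve_le: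
  "cmod (convolve g k \<zeta>) \<le> cmod (convolve (\<lambda>\<zeta>. of_real (cmod (g \<zeta>))) (\<lambda>\<zeta>. of_real (cmod (k \<zeta>))) \<zeta>)"
proof -
  have "cmod (LINT \<zeta>'|lborel. g (\<zeta> - \<zeta>') * k \<zeta>') \<le> (LINT \<zeta>'|lborel. cmod (g (\<zeta> - \<zeta>')) * cmod (k \<zeta>'))"
    by (rule order.trans[OF integral_norm_bound]) (simp add: norm_mult)
  also have "\<dots> \<le> cmod (LINT \<zeta>'|lborel. of_real (cmod (g (\<zeta> - \<zeta>'))) * of_real (cmod (k \<zeta>')))"
    unfolding of_real_mult[symmetric] integral_complex_of_real norm_of_real by simp
  finally show ?thesis
    unfolding convolve_def norm_mult by (intro mult_left_mono) auto
qed

lemma inv_fourier_convolve: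
  assumes g: "integrable lborel g" and k: "integrable lborel k"
  shows "inv_fourier (convolve g k) z = inv_fourier g z * inv_fourier k z"
proof -
  have [measurable]: "g \<in> borel_measurable borel" "k \<in> borel_measurable borel"
    using g k by auto
  let ?c = "complex_of_real (1 / (2 * pi)\<^sup>2)"
  have "integrable (lborel \<Otimes>\<^sub>M lborel) (\<lambda>q. cis (snd q \<bullet> z) * (case q of (\<zeta>', \<zeta>) \<Rightarrow> g (\<zeta> - \<zeta>') * k \<zeta>'))"
    by (intro integrable_cis_mult integrable_convolve_integrand g k) measurable
  then have int: "integrable (lborel \<Otimes>\<^sub>M lborel) (\<lambda>(\<zeta>', \<zeta>). cis (\<zeta> \<bullet> z) * (g (\<zeta> - \<zeta>') * k \<zeta>'))"
    by (simp add: case_prod_unfold)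
  have "fourier (convolve g k) (- z) = ?c * (LINT \<zeta>|lborel. LINT \<zeta>'|lborel. cis (\<zeta> \<bullet> z) * (g (\<zeta> - \<zeta>') * k \<zeta>'))"
    by (simp add: fourier_def convolve_def mult.left_commute)
  also have "(LINT \<zeta>|lborel. LINT \<zeta>'|lborel. cis (\<zeta> \<bullet> z) * (g (\<zeta> - \<zeta>') * k \<zeta>'))
      = (LINT \<zeta>'|lborel. LINT \<zeta>|lborel. cis (\<zeta> \<bullet> z) * (g (\<zeta> - \<zeta>') * k \<zeta>'))"
    by (rule lborel_pair.Fubini_integral[OF int])
  also have "\<dots> = (LINT \<zeta>'|lborel. cis (- (\<zeta>' \<bullet> - z)) * k \<zeta>' * fourier g (- z))"
  proof (intro Bochner_Integration.integral_cong refl)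
    fix \<zeta>'
    have "(LINT \<zeta>|lborel. cis (\<zeta> \<bullet> z) * (g (\<zeta> - \<zeta>') * k \<zeta>')) = fourier (\<lambda>\<zeta>. g (- \<zeta>' + \<zeta>)) (- z) * k \<zeta>'"
      by (simp add: fourier_def mult.assoc[symmetric])
    also have "\<dots> = cis (- (\<zeta>' \<bullet> - z)) * k \<zeta>' * fourier g (- z)"
      by (subst fourier_translate) simp_all
    finally show "(LINT \<zeta>|lborel. cis (\<zeta> \<bullet> z) * (g (\<zeta> - \<zeta>') * k \<zeta>')) = cis (- (\<zeta>' \<bullet> - z)) * k \<zeta>' * fourier g (- z)" .
  qed
  also have "\<dots> = fourier k (- z) * fourier g (- z)"
    by (simp add: fourier_def)
  finally show ?thesis
    by (simp add: inv_fourier_def)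
qed

lemma is_product_spectral_dist:
  assumes g: "integrable lborel g" and k: "integrable lborel k"
  shows "is_product (spectral_dist g) (spectral_dist k) (spectral_dist (convolve g k))"
proof -
  note gk = integrable_convolve[OF g k]
  have "regular (spectral_dist (convolve g k)) (\<lambda>z. inv_fourier g z * inv_fourier k z)"
    using regular_spectral_dist[OF gk] unfolding inv_fourier_convolve[OF g k, abs_def] by simp
  then show ?thesis
    unfolding is_product_def
    using tempered_spectral_dist[OF gk] regular_spectral_dist[OF g] regular_spectral_dist[OF k] by blast
qed

text \<open>This and the next two definitions live on the Fourier side. If g is the transform of
  \<phi>, they are the transforms of the free solution u, of u u_x, and (for positive t) of the
  Duhamel term of u.\<close>

definition evolved :: "real \<Rightarrow> plane_fun \<Rightarrow> real \<Rightarrow> plane_fun" where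
  "evolved \<alpha> g t = (\<lambda>\<zeta>. cis (- t * dispersion \<alpha> \<zeta>) * g \<zeta>)"

definition nonlinearity :: "real \<Rightarrow> plane_fun \<Rightarrow> real \<Rightarrow> plane_fun" where
  "nonlinearity \<alpha> g t = convolve (evolved \<alpha> g t) (\<lambda>\<zeta>. \<i> * of_real (fst \<zeta>) * evolved \<alpha> g t \<zeta>)"

definition duhamel :: "real \<Rightarrow> plane_fun \<Rightarrow> real \<Rightarrow> plane_fun" where
  "duhamel \<alpha> g t = (\<lambda>\<zeta>. LINT r:{0<..<t}|lborel. evolved \<alpha> (nonlinearity \<alpha> g r) (t - r) \<zeta>)"

lemma nonlinearity_measurable [measurable]:
  assumes [measurable]: "g \<in> borel_measurable borel"
  shows "(\<lambda>(r, \<zeta>). nonlinearity \<alpha> g r \<zeta>) \<in> borel_measurable (borel \<Otimes>\<^sub>M borel)"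
  unfolding nonlinearity_def convolve_def evolved_def by measurable

context
  fixes g :: plane_fun
  assumes g: "integrable lborel g" and xg: "integrable lborel (\<lambda>\<zeta>. of_real (fst \<zeta>) * g \<zeta>)"
begin

lemma integrable_evolved: "integrable lborel (evolved \<alpha> g t)"
  unfolding evolved_def by (intro integrable_cis_mult g) measurable

lemma integrable_x_evolved: "integrable lborel (\<lambda>\<zeta>. \<i> * of_real (fst \<zeta>) * evolved \<alpha> g t \<zeta>)"
proof -
  have "integrable lborel (\<lambda>\<zeta>. \<i> * (cis (- t * dispersion \<alpha> \<zeta>) * (of_real (fst \<zeta>) * g \<zeta>)))"
    by (intro integrable_mult_right integrable_cis_mult xg) measurable
  then show ?thesis
    by (simp add: evolved_def mult_ac)
qed

lemma integrable_nonlinearity: "integrable lborel (nonlinearity \<alpha> g t)"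
  unfolding nonlinearity_def by (intro integrable_convolve integrable_evolved integrable_x_evolved)

text \<open>The phases in \<open>evolved\<close> have modulus 1, so the convolution of the moduli is
  a majorant independent of time. It justifies Fubini between time and frequency.\<close>

lemma nonlinearity_dominated:
  obtains H where "integrable lborel H" "\<And>r \<zeta>. cmod (nonlinearity \<alpha> g r \<zeta>) \<le> cmod (H \<zeta>)"
proof
  let ?H = "convolve (\<lambda>\<zeta>. of_real (cmod (g \<zeta>))) (\<lambda>\<zeta>. of_real (cmod (of_real (fst \<zeta>) * g \<zeta>)))"
  show "integrable lborel ?H"
    using g xg by (intro integrable_convolve integrable_of_real integrable_norm)
  show "cmod (nonlinearity \<alpha> g r \<zeta>) \<le> cmod (?H \<zeta>)" for r \<zeta>
    using cmod_convolve_le[of "evolved \<alpha> g r" "\<lambda>\<zeta>. \<i> * of_real (fst \<zeta>) * evolved \<alpha> g r \<zeta>" \<zeta>]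
    by (simp add: nonlinearity_def evolved_def norm_mult)
qed

lemma integrable_duhamel_integrand:
  "integrable (lborel \<Otimes>\<^sub>M lborel)
    (\<lambda>(r, \<zeta>). indicator {0<..<t} r *\<^sub>R evolved \<alpha> (nonlinearity \<alpha> g r) (t - r) \<zeta>)"
proof -
  have [measurable]: "g \<in> borel_measurable borel"
    using g by auto
  obtain H where H: "integrable lborel H" and H_le: "\<And>r \<zeta>. cmod (nonlinearity \<alpha> g r \<zeta>) \<le> cmod (H \<zeta>)"
    by (rule nonlinearity_dominated[of \<alpha>]) (rule that)
  have "integrable lborel (\<lambda>r. complex_of_real (indicator {0<..<t} r))"
    using emeasure_lborel_box_finite[of 0 t]
    by (intro integrable_of_real integrable_real_indicator) (simp_all add: box_real)
  from integrable_tensor(1)[OF this H]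
  have "integrable (lborel \<Otimes>\<^sub>M lborel) (\<lambda>q. complex_of_real (indicator {0<..<t} (fst q)) * H (snd q))"
    by (simp add: lborel_prod)
  then show ?thesis
  proof (rule Bochner_Integration.integrable_bound)
    show "AE q in lborel \<Otimes>\<^sub>M lborel. norm (case q of (r, \<zeta>) \<Rightarrow> indicator {0<..<t} r *\<^sub>R evolved \<alpha> (nonlinearity \<alpha> g r) (t - r) \<zeta>)
        \<le> norm (complex_of_real (indicator {0<..<t} (fst q)) * H (snd q))"
      by (intro AE_I2) (auto simp: norm_mult evolved_def H_le mult_left_mono split: prod.split)
    show "(\<lambda>(r, \<zeta>). indicator {0<..<t} r *\<^sub>R evolved \<alpha> (nonlinearity \<alpha> g r) (t - r) \<zeta>) \<in> borel_measurable (lborel \<Otimes>\<^sub>M lborel)"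
      unfolding evolved_def by measurable
  qed
qed

lemma integrable_duhamel: "integrable lborel (duhamel \<alpha> g t)"
  unfolding duhamel_def set_lebesgue_integral_def
  using lborel_pair.integrable_snd[OF integrable_duhamel_integrand] .

text \<open>D is identified at time T, where the embedding will be evaluated: for T > 0 the interval
  integral is one over \<open>{0<..<T}\<close>, and Fubini exchanges it with the frequency integral
  against the test function.\<close>

lemma is_duhamel_spectral_dist:
  assumes "0 < T"
  obtains D where "is_duhamel \<alpha> T (on_interval T (\<lambda>t. W \<alpha> t (spectral_dist g))) D"
    and "D T = spectral_dist (duhamel \<alpha> g T)"
proof
  have [measurable]: "g \<in> borel_measurable borel"
    using g by auto
  let ?N = "\<lambda>r. spectral_dist (nonlinearity \<alpha> g r)"
  let ?D = "on_interval T (\<lambda>t \<psi>. if schwartz \<psi> then LBINT r=ereal 0..ereal t. W \<alpha> (t - r) (?N r) \<psi> else 0)"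
  have WN: "W \<alpha> (t - r) (?N r) \<psi> = (LINT \<zeta>|lborel. evolved \<alpha> (nonlinearity \<alpha> g r) (t - r) \<zeta> * inv_fourier \<psi> \<zeta>)"
    if "schwartz \<psi>" for t r \<psi>
    unfolding W_spectral_dist[OF integrable_nonlinearity] using that by (simp add: spectral_dist_def evolved_def)
  have product: "is_product (W \<alpha> r (spectral_dist g)) (dist_x_deriv (W \<alpha> r (spectral_dist g))) (?N r)" for r
    using is_product_spectral_dist[OF integrable_evolved integrable_x_evolved]
    by (simp add: W_spectral_dist[OF g] dist_x_deriv_spectral_dist nonlinearity_def evolved_def)
  have int: "interval_lebesgue_integrable lborel (ereal 0) (ereal t) (\<lambda>r. W \<alpha> (t - r) (?N r) \<psi>)"
    if \<psi>: "schwartz \<psi>" for t \<psi>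
  proof -
    have [measurable]: "\<psi> \<in> borel_measurable borel"
      using \<psi> by (rule schwartz_borel_measurable)
    let ?F = "\<lambda>r. W \<alpha> (t - r) (?N r) \<psi>"
    have meas: "?F \<in> borel_measurable borel"
      unfolding WN[OF \<psi>] evolved_def by measurable
    obtain H where H: "integrable lborel H" and H_le: "\<And>r \<zeta>. cmod (nonlinearity \<alpha> g r \<zeta>) \<le> cmod (H \<zeta>)"
      by (rule nonlinearity_dominated[of \<alpha>]) (rule that)
    define K where "K = 1 / (2 * pi)\<^sup>2 * (LINT z|lborel. cmod (\<psi> z))"
    have B: "cmod (?F r) \<le> (LINT \<zeta>|lborel. cmod (H \<zeta>) * K)" for r
      unfolding WN[OF \<psi>]
    proof (rule order.trans[OF integral_norm_bound], rule Bochner_Integration.integral_mono)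
      have "integrable lborel (evolved \<alpha> (nonlinearity \<alpha> g r) (t - r))"
        unfolding evolved_def by (intro integrable_cis_mult integrable_nonlinearity) measurable
      then show "integrable lborel (\<lambda>\<zeta>. norm (evolved \<alpha> (nonlinearity \<alpha> g r) (t - r) \<zeta> * inv_fourier \<psi> \<zeta>))"
        using schwartz_integrable[OF \<psi>] by (intro integrable_norm integrable_mult_inv_fourier)
      show "integrable lborel (\<lambda>\<zeta>. cmod (H \<zeta>) * K)"
        using H by simp
      show "norm (evolved \<alpha> (nonlinearity \<alpha> g r) (t - r) \<zeta> * inv_fourier \<psi> \<zeta>) \<le> cmod (H \<zeta>) * K" for \<zeta>
        unfolding norm_mult evolved_def norm_cis mult_1 K_def by (intro mult_mono H_le cmod_inv_fourier_le) auto
    qed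
    have "set_integrable lborel {a<..<b} ?F" for a b
      unfolding set_integrable_def
    proof (rule Bochner_Integration.integrable_bound)
      show "integrable lborel (\<lambda>r. indicator {a<..<b} r * (LINT \<zeta>|lborel. cmod (H \<zeta>) * K))"
        using emeasure_lborel_box_finite[of a b]
        by (intro integrable_mult_left integrable_real_indicator) (simp_all add: box_real)
      show "AE r in lborel. norm (indicator {a<..<b} r *\<^sub>R ?F r) \<le> norm (indicator {a<..<b} r * (LINT \<zeta>|lborel. cmod (H \<zeta>) * K))"
        using B by (intro AE_I2) (auto simp: indicator_def intro: order.trans[OF _ abs_ge_self])
    qed (use meas in simp)
    then show ?thesis
      by (simp add: interval_lebesgue_integrable_def)
  qed
  show "is_duhamel \<alpha> T (on_interval T (\<lambda>t. W \<alpha> t (spectral_dist g))) ?D"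
    unfolding is_duhamel_def
  proof (intro exI conjI ballI allI impI)
    show "AE r in lborel. r \<in> {- T..T} \<longrightarrow>
        is_product (on_interval T (\<lambda>t. W \<alpha> t (spectral_dist g)) r)
          (dist_x_deriv (on_interval T (\<lambda>t. W \<alpha> t (spectral_dist g)) r)) (?N r) \<and>
        (\<exists>h. regular (dist_fourier (?N r)) h)"
      using product regular_dist_fourier_spectral_dist[OF integrable_nonlinearity]
      by (intro AE_I2) (auto simp: on_interval_def)
  qed (simp_all add: int)
  show "?D T = spectral_dist (duhamel \<alpha> g T)"
  proof
    fix \<psi>
    show "?D T \<psi> = spectral_dist (duhamel \<alpha> g T) \<psi>"
    proof (cases "schwartz \<psi>")
      case True
      have [measurable]: "\<psi> \<in> borel_measurable borel"
        using True by (rule schwartz_borel_measurable)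
      let ?F = "\<lambda>r \<zeta>. indicator {0<..<T} r *\<^sub>R evolved \<alpha> (nonlinearity \<alpha> g r) (T - r) \<zeta> * inv_fourier \<psi> \<zeta>"
      have "integrable (lborel \<Otimes>\<^sub>M lborel) (\<lambda>q. (case q of (r, \<zeta>) \<Rightarrow> indicator {0<..<T} r *\<^sub>R evolved \<alpha> (nonlinearity \<alpha> g r) (T - r) \<zeta>) * inv_fourier \<psi> (snd q))"
        by (rule integrable_mult_bounded[OF integrable_duhamel_integrand _ cmod_inv_fourier_le]) measurable
      then have int: "integrable (lborel \<Otimes>\<^sub>M lborel) (\<lambda>(r, \<zeta>). ?F r \<zeta>)"
        by (simp add: case_prod_unfold)
      have "?D T \<psi> = (LINT r:{0<..<T}|lborel. W \<alpha> (T - r) (?N r) \<psi>)"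
        using \<open>0 < T\<close> True by (simp add: on_interval_def interval_lebesgue_integral_def)
      also have "\<dots> = (LINT r|lborel. LINT \<zeta>|lborel. ?F r \<zeta>)"
        by (simp add: set_lebesgue_integral_def WN[OF True])
      also have "\<dots> = (LINT \<zeta>|lborel. LINT r|lborel. ?F r \<zeta>)"
        by (rule lborel_pair.Fubini_integral[OF int, symmetric])
      also have "\<dots> = spectral_dist (duhamel \<alpha> g T) \<psi>"
        by (simp only: spectral_dist_def if_P[OF True] duhamel_def set_lebesgue_integral_def integral_mult_left_zero)
      finally show ?thesis .
    next
      case False
      then show ?thesis
        using \<open>0 < T\<close> by (simp add: on_interval_def spectral_dist_def)
    qed
  qed
qed

end


section \<open>Weights and the resonance function\<close>

text \<open>The upper bound is 1 + (a + 3)^2 \<le> 16 (1 + a^2). Shifts up to 3 occur because the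
  output box extends to N + 3 c with c \<le> 1.\<close>

lemma japanese_bracket_compare:
  assumes "0 \<le> a" "0 \<le> b" "b \<le> 3"
  shows "japanese_bracket a \<le> japanese_bracket (a + b)" "japanese_bracket (a + b) \<le> 4 * japanese_bracket a"
proof -
  show "japanese_bracket a \<le> japanese_bracket (a + b)"
    using assms unfolding japanese_bracket_def by (intro real_sqrt_le_mono add_left_mono power_mono) auto
  have "(a + b)\<^sup>2 \<le> (a + 3)\<^sup>2"
    using assms by (intro power_mono) auto
  also have "1 + \<dots> \<le> 4\<^sup>2 * (1 + a\<^sup>2)"
    using zero_le_power2[of "a - 1"] by (simp add: power2_sum power2_diff) (use zero_le_power2[of a] in linarith)
  finally have "sqrt (1 + (a + b)\<^sup>2) \<le> sqrt (4\<^sup>2 * (1 + a\<^sup>2))"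
    by (intro real_sqrt_le_mono) simp
  then show "japanese_bracket (a + b) \<le> 4 * japanese_bracket a"
    unfolding japanese_bracket_def real_sqrt_mult by simp
qed

lemma japanese_bracket_pos: "0 < japanese_bracket a"
  unfolding japanese_bracket_def by (simp add: add_pos_nonneg)

text \<open>For negative s the power reverses both comparisons and the factor 4 changes sides. The
  slack in S lets one constant serve s1 and s2 together.\<close>

lemma japanese_bracket_powr_compare:
  assumes ab: "0 \<le> a" "0 \<le> b" "b \<le> 3" and S: "\<bar>s\<bar> \<le> S"
  shows "japanese_bracket (a + b) powr (2 * s) \<le> 4 powr (2 * S) * japanese_bracket a powr (2 * s)"
    and "japanese_bracket a powr (2 * s) \<le> 4 powr (2 * S) * japanese_bracket (a + b) powr (2 * s)"
proof -
  let ?a = "japanese_bracket a" and ?b = "japanese_bracket (a + b)"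
  note le = japanese_bracket_compare[OF ab] and pos = japanese_bracket_pos
  have S1: "1 \<le> (4::real) powr (2 * S)" and S2: "4 powr (2 * \<bar>s\<bar>) \<le> (4::real) powr (2 * S)"
    using S by (auto intro!: ge_one_powr_ge_zero)
  have weaken: "u \<le> 4 powr (2 * S) * v" if "u \<le> v" "0 \<le> v" for u v :: real
    using mult_right_mono[OF S1, of v] that by simp
  have weaken': "u \<le> 4 powr (2 * S) * v" if "u \<le> 4 powr (2 * \<bar>s\<bar>) * v" "0 \<le> v" for u v :: real
    using mult_right_mono[OF S2, of v] that by simp
  have "?b powr (2 * s) \<le> 4 powr (2 * S) * ?a powr (2 * s) \<and> ?a powr (2 * s) \<le> 4 powr (2 * S) * ?b powr (2 * s)"
  proof (cases "0 \<le> s")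
    case True
    have "?b powr (2 * s) \<le> (4 * ?a) powr (2 * s)"
      using le pos[of "a + b"] True by (intro powr_mono2) auto
    then have "?b powr (2 * s) \<le> 4 powr (2 * \<bar>s\<bar>) * ?a powr (2 * s)"
      using True pos[of a] by (simp add: powr_mult)
    moreover have "?a powr (2 * s) \<le> ?b powr (2 * s)"
      using le pos[of a] True by (intro powr_mono2) auto
    ultimately show ?thesis
      by (simp add: weaken weaken')
  next
    case False
    have "(4 * ?a) powr (2 * s) \<le> ?b powr (2 * s)"
      using le pos[of "a + b"] False by (intro powr_mono2') auto
    then have "4 powr (2 * s) * ?a powr (2 * s) \<le> ?b powr (2 * s)"
      using pos[of a] by (simp add: powr_mult)
    then have "4 powr (2 * \<bar>s\<bar>) * (4 powr (2 * s) * ?a powr (2 * s)) \<le> 4 powr (2 * \<bar>s\<bar>) * ?b powr (2 * s)"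
      by (intro mult_left_mono) auto
    moreover have "4 powr (2 * \<bar>s\<bar>) * (4 powr (2 * s) * ?a powr (2 * s)) = ?a powr (2 * s)"
      using False by (simp add: mult.assoc[symmetric] flip: powr_add)
    ultimately have "?a powr (2 * s) \<le> 4 powr (2 * \<bar>s\<bar>) * ?b powr (2 * s)"
      by simp
    moreover have "?b powr (2 * s) \<le> ?a powr (2 * s)"
      using le pos[of a] False by (intro powr_mono2') auto
    ultimately show ?thesis
      by (simp add: weaken weaken')
  qed
  then show "?b powr (2 * s) \<le> 4 powr (2 * S) * ?a powr (2 * s)" "?a powr (2 * s) \<le> 4 powr (2 * S) * ?b powr (2 * s)"
    by auto
qed

text \<open>Makes the weight constant up to the factor R on each box: the frequencies involved are
  shifts of the corners (0, 0) and (N, M) by at most 3 in each coordinate.\<close>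

lemma sobolev_weight_compare:
  fixes s1 s2 x y a b :: real
  assumes "0 \<le> x" "0 \<le> y" "0 \<le> a" "a \<le> 3" "0 \<le> b" "b \<le> 3"
  defines "R \<equiv> 4 powr (2 * (\<bar>s1\<bar> + \<bar>s2\<bar>))"
  shows "sobolev_weight s1 s2 (x + a, y + b) \<le> R * sobolev_weight s1 s2 (x, y)"
    and "sobolev_weight s1 s2 (x, y) \<le> R * sobolev_weight s1 s2 (x + a, y + b)"
  using japanese_bracket_powr_compare[of x a s1 "\<bar>s1\<bar> + \<bar>s2\<bar>"] japanese_bracket_powr_compare[of y b s2 "\<bar>s1\<bar> + \<bar>s2\<bar>"] assms
  by (auto simp: sobolev_weight_def distrib_left)

lemma sobolev_weight_pos: "0 < sobolev_weight s1 s2 \<zeta>"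
  by (cases \<zeta>) (simp add: sobolev_weight_def add_pos_pos japanese_bracket_pos[THEN less_imp_neq, symmetric])

section \<open>The resonance function near the cancelling high frequency\<close>

lemma powr_diff_mean_value:
  fixes a x y :: real
  assumes "0 < y" "0 < x"
  obtains z where "y < z" "z < x + y" "(x + y) powr a - y powr a = x * (a * z powr (a - 1))"
proof -
  have "\<exists>z. y < z \<and> z < x + y \<and> (x + y) powr a - y powr a = (x + y - y) * (a * z powr (a - 1))"
  proof (rule MVT2)
    show "y < x + y"
      using assms by simp
    show "((\<lambda>z. z powr a) has_real_derivative a * z powr (a - 1)) (at z)" if "y \<le> z" for z
      using that assms by (auto intro!: derivative_eq_intros)
  qed
  then show ?thesis
    using that by auto
qed

text \<open>The mean value theorem for the power \<alpha> gives the form x (A - B) + E3 - E4, with A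
  from the cubic term and B from the change of |\<xi>|^\<alpha>. Both are close to 3 N^2 by the
  choice of M, so their difference is of lower order. E3 is the cross term between low and high
  \<eta>, and E4 comes from the dispersion of the low frequency.\<close>

lemma resonance_bound:
  fixes \<alpha> \<epsilon> N c b M x y p q :: real
  assumes \<alpha>: "-1 \<le> \<alpha>" "\<alpha> < 0" and \<epsilon>: "0 < \<epsilon>" "\<epsilon> \<le> 1" and N: "1 \<le> N"
    and c: "c = \<epsilon> * N powr (- 1 / 2)" and b: "b = \<epsilon> * N powr (- (3 + \<alpha>) / 2)"
    and M: "M = sqrt (3 / - \<alpha>) * N powr ((3 - \<alpha>) / 2)"
    and x: "c \<le> x" "x \<le> 2 * c" and p: "0 \<le> p" "p \<le> b"
    and y: "N \<le> y" "y \<le> N + 2 * c" and q: "M \<le> q" "q \<le> M + 2 * b"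
  shows "\<bar>((x + y) ^ 3 + (x + y) powr \<alpha> * (p + q)\<^sup>2) - (x ^ 3 + x powr \<alpha> * p\<^sup>2) - (y ^ 3 + y powr \<alpha> * q\<^sup>2)\<bar>
    \<le> (300 + 7 * sqrt (3 / - \<alpha>)) * \<epsilon>"
proof -
  define \<kappa> where "\<kappa> = sqrt (3 / - \<alpha>)"
  have \<kappa>1: "1 \<le> \<kappa>"
    unfolding \<kappa>_def using \<alpha> by (intro real_le_rsqrt) (simp add: field_simps)
  have N0: "0 < N"
    using N by simp
  have Npowr_le: "N powr a \<le> 1" if "a \<le> 0" for a
    using powr_mono[OF that N] N by simp
  have c0: "0 < c" and c1: "c \<le> 1" and b0: "0 < b" and b\<epsilon>: "b \<le> \<epsilon>"
    using \<epsilon> N0 \<alpha> Npowr_le[of "- 1 / 2"] Npowr_le[of "- (3 + \<alpha>) / 2"]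
    by (auto simp: c b mult_le_one mult_left_le)
  have b1: "b \<le> 1"
    using b\<epsilon> \<epsilon> by simp
  have M1: "N powr (3 / 2) \<le> M"
    unfolding M \<kappa>_def[symmetric]
    using mult_mono[OF \<kappa>1 powr_mono[of "3 / 2" "(3 - \<alpha>) / 2" N]] N \<alpha> \<kappa>1 by simp
  have M2: "1 \<le> M"
    using M1 ge_one_powr_ge_zero[OF N, of "3 / 2"] by simp
  \<comment> \<open>The equation that determines M: the leading terms of A and B agree.\<close>
  have H1: "- \<alpha> * N powr (\<alpha> - 1) * M\<^sup>2 = 3 * N\<^sup>2"
  proof -
    have "M\<^sup>2 = 3 / - \<alpha> * N powr (3 - \<alpha>)"
      using \<alpha> by (simp add: M power_mult_distrib) (simp add: power2_eq_square flip: powr_add)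
    then have "- \<alpha> * N powr (\<alpha> - 1) * M\<^sup>2 = 3 * (N powr (\<alpha> - 1) * N powr (3 - \<alpha>))"
      using \<alpha> by simp
    also have "\<dots> = 3 * N\<^sup>2"
      using N0 by (simp flip: powr_add)
    finally show ?thesis .
  qed
  \<comment> \<open>The condition behind c: moving y by O(c) changes 3 y^2 by O(c N), and this is
    multiplied by x = O(c).\<close>
  have H2: "c * c * N \<le> \<epsilon>"
  proof -
    have "c * c * N = \<epsilon> * \<epsilon> * (N powr (- 1 / 2) * N powr (- 1 / 2) * N powr 1)"
      using N0 by (simp add: c)
    also have "\<dots> = \<epsilon> * \<epsilon>"
      unfolding powr_add[symmetric] using N0 by simp
    also have "\<dots> \<le> \<epsilon>"
      using \<epsilon> by (simp add: mult_left_le)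
    finally show ?thesis .
  qed
  have H3: "c * N\<^sup>2 \<le> \<epsilon> * M"
  proof -
    have "c * N\<^sup>2 = \<epsilon> * (N powr (- 1 / 2) * N powr 2)"
      using N0 by (simp add: c)
    also have "\<dots> = \<epsilon> * N powr (3 / 2)"
      unfolding powr_add[symmetric] by simp
    also have "\<dots> \<le> \<epsilon> * M"
      using \<epsilon> M1 by (intro mult_left_mono) auto
    finally show ?thesis .
  qed
  \<comment> \<open>The condition behind b: E3 has this size.\<close>
  have H4: "N powr \<alpha> * (b * M) = \<kappa> * \<epsilon>"
  proof -
    have "N powr \<alpha> * (b * M) = \<kappa> * \<epsilon> * (N powr \<alpha> * N powr (- (3 + \<alpha>) / 2) * N powr ((3 - \<alpha>) / 2))"
      by (simp add: b M \<kappa>_def)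
    also have "N powr \<alpha> * N powr (- (3 + \<alpha>) / 2) * N powr ((3 - \<alpha>) / 2) = N powr 0"
      unfolding powr_add[symmetric] by (simp add: field_simps)
    finally show ?thesis
      using N0 by simp
  qed
  \<comment> \<open>The low frequency is only c away from the singularity of |\<xi>|^\<alpha>.
    Bounding \<epsilon>^(\<alpha> + 2) by \<epsilon> is a use of -1 \<le> \<alpha>.\<close>
  have H5: "c powr \<alpha> * b\<^sup>2 \<le> \<epsilon>"
  proof -
    have exponent: "- \<alpha> / 2 + - (3 + \<alpha>) = - (3 + 3 / 2 * \<alpha>)"
      by simp
    have "b\<^sup>2 = \<epsilon> powr 2 * N powr (- (3 + \<alpha>))"
      using \<epsilon> by (simp add: b power_mult_distrib) (simp add: power2_eq_square flip: powr_add)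
    moreover have "c powr \<alpha> = \<epsilon> powr \<alpha> * N powr (- \<alpha> / 2)"
      using \<epsilon> by (simp add: c powr_mult powr_powr)
    ultimately have "c powr \<alpha> * b\<^sup>2 = \<epsilon> powr \<alpha> * \<epsilon> powr 2 * (N powr (- \<alpha> / 2) * N powr (- (3 + \<alpha>)))"
      by simp
    also have "\<dots> = \<epsilon> powr (\<alpha> + 2) * N powr (- (3 + 3 / 2 * \<alpha>))"
      unfolding powr_add[symmetric] exponent by (rule refl)
    also have "\<dots> \<le> \<epsilon> powr 1 * 1"
      using \<epsilon> \<alpha> by (intro mult_mono powr_mono' Npowr_le) auto
    finally show ?thesis
      using \<epsilon> by simp
  qed
  have x0: "0 < x" and y0: "0 < y"
    using x c0 y N0 by auto
  obtain z where z: "y < z" "z < x + y" "(x + y) powr \<alpha> - y powr \<alpha> = x * (\<alpha> * z powr (\<alpha> - 1))"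
    using powr_diff_mean_value[OF y0 x0] by blast
  define A where "A = 3 * y * (x + y)"
  define B where "B = - \<alpha> * z powr (\<alpha> - 1) * (p + q)\<^sup>2"
  define E3 where "E3 = y powr \<alpha> * (2 * p * q + p\<^sup>2)"
  define E4 where "E4 = x powr \<alpha> * p\<^sup>2"
  have split: "((x + y) ^ 3 + (x + y) powr \<alpha> * (p + q)\<^sup>2) - (x ^ 3 + x powr \<alpha> * p\<^sup>2) - (y ^ 3 + y powr \<alpha> * q\<^sup>2)
      = x * (A - B) + E3 - E4"
  proof -
    have t: "(x + y) powr \<alpha> = y powr \<alpha> + x * (\<alpha> * z powr (\<alpha> - 1))"
      using z(3) by simp
    show ?thesis
      unfolding t A_def B_def E3_def E4_def by (simp add: algebra_simps power2_eq_square power3_eq_cube)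
  qed
  have E3: "0 \<le> E3" "E3 \<le> 7 * \<kappa> * \<epsilon>"
  proof -
    show "0 \<le> E3"
      using p q M2 by (simp add: E3_def)
    have pq: "p * q \<le> b * (M + 2 * b)"
      using p q M2 b0 by (intro mult_mono) auto
    have "p\<^sup>2 \<le> b\<^sup>2"
      using p by (intro power_mono) auto
    moreover have bM: "b * b \<le> b * M"
      using b1 M2 b0 by (intro mult_left_mono) auto
    \<comment> \<open>7 = 2 + 4 + 1: 2 p q \<le> 2 b M + 4 b^2, p^2 \<le> b^2, and b^2 \<le> b
      M.\<close>
    ultimately have "2 * p * q + p\<^sup>2 \<le> 7 * (b * M)"
      using pq by (simp add: power2_eq_square algebra_simps)
    then have "E3 \<le> N powr \<alpha> * (7 * (b * M))"
      unfolding E3_def using y N0 \<alpha> b0 M2 p q by (intro mult_mono powr_mono2') auto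
    then show "E3 \<le> 7 * \<kappa> * \<epsilon>"
      using H4 by simp
  qed
  have E4: "0 \<le> E4" "E4 \<le> \<epsilon>"
  proof -
    have "E4 \<le> c powr \<alpha> * b\<^sup>2"
      unfolding E4_def using x c0 \<alpha> p by (intro mult_mono powr_mono2' power_mono) auto
    then show "E4 \<le> \<epsilon>"
      using H5 by simp
  qed (simp add: E4_def)
  have upper: "A - B \<le> 96 * (c * N)"
  proof -
    have "A \<le> 3 * (N + 4 * c) * (N + 4 * c)"
      unfolding A_def using x y x0 y0 c0 N0 by (intro mult_mono) auto
    also have "\<dots> = 3 * N\<^sup>2 + 24 * (c * N) + 48 * (c * c)"
      by (simp add: power2_eq_square algebra_simps)
    also have "c * c \<le> c * N"
      using c0 c1 N by (intro mult_left_mono) auto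
    finally have A: "A \<le> 3 * N\<^sup>2 + 72 * (c * N)"
      by (simp add: mult.commute)
    \<comment> \<open>u is the relative shift, as z < N + 4 c = (1 + u) N. The bound (1 + u)^(-2)
      \<ge> 1 - 2 u carries over to the exponent \<alpha> - 1 because \<alpha> - 1 \<ge> -2.\<close>
    define u where "u = 4 * c / N"
    have u: "0 \<le> u"
      using c0 N0 by (simp add: u_def)
    have "1 - 2 * u \<le> (1 + u) powr (- 2)"
    proof -
      have "(1 - 2 * u) * (1 + u)\<^sup>2 = 1 - 3 * u\<^sup>2 - 2 * u ^ 3"
        by (simp add: power2_eq_square power3_eq_cube algebra_simps)
      also have "\<dots> \<le> 1"
        using zero_le_power[OF u, of 3] zero_le_power2[of u] by linarith
      finally have "1 - 2 * u \<le> 1 / (1 + u)\<^sup>2"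
        using u by (simp add: pos_le_divide_eq)
      then show ?thesis
        using u by (simp add: powr_minus divide_inverse)
    qed
    also have "\<dots> \<le> (1 + u) powr (\<alpha> - 1)"
      using u \<alpha> by (intro powr_mono) auto
    finally have "(1 - 2 * u) * N powr (\<alpha> - 1) \<le> (1 + u) powr (\<alpha> - 1) * N powr (\<alpha> - 1)"
      by (intro mult_right_mono) auto
    also have "\<dots> = (N + 4 * c) powr (\<alpha> - 1)"
    proof -
      have "(1 + u) * N = N + 4 * c"
        using N0 by (simp add: u_def field_simps)
      then show ?thesis
        using u N0 by (simp flip: powr_mult)
    qed
    also have "\<dots> \<le> z powr (\<alpha> - 1)"
      using z x y y0 \<alpha> by (intro powr_mono2') auto
    finally have le: "(1 - 2 * u) * N powr (\<alpha> - 1) \<le> z powr (\<alpha> - 1)" .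
    have MM: "M\<^sup>2 \<le> (p + q)\<^sup>2"
      using M2 p q by (intro power_mono) auto
    have "3 * N\<^sup>2 - 24 * (c * N) = (1 - 2 * u) * (3 * N\<^sup>2)"
      using N0 by (simp add: u_def field_simps power2_eq_square)
    also have "\<dots> = - \<alpha> * ((1 - 2 * u) * N powr (\<alpha> - 1)) * M\<^sup>2"
      unfolding H1[symmetric] by simp
    also have "\<dots> \<le> - \<alpha> * z powr (\<alpha> - 1) * M\<^sup>2"
      using le \<alpha> by (intro mult_right_mono mult_left_mono) auto
    also have "\<dots> \<le> B"
      unfolding B_def using MM \<alpha> by (intro mult_left_mono mult_nonneg_nonneg) auto
    finally show ?thesis
      using A by simp
  qed
  have lower: "B - A \<le> 45 * (N\<^sup>2 * b / M)"
  proof -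
    have A: "3 * N\<^sup>2 \<le> A"
      unfolding A_def using mult_mono[of N y N "x + y"] x0 y N0 by (simp add: power2_eq_square)
    have "B \<le> - \<alpha> * N powr (\<alpha> - 1) * (M + 3 * b)\<^sup>2"
      unfolding B_def using z y N0 \<alpha> p q M2 b0 by (intro mult_mono power_mono powr_mono2' mult_left_mono) (auto intro: mult_nonpos_nonneg)
    also have "\<dots> \<le> - \<alpha> * N powr (\<alpha> - 1) * (M\<^sup>2 * (1 + 15 * (b / M)))"
    proof (intro mult_left_mono)
      \<comment> \<open>15 = 6 + 9: expanding the square gives 6 b M + 9 b^2.\<close>
      have "b * b \<le> b * M"
        using b1 M2 b0 by (intro mult_left_mono) auto
      then show "(M + 3 * b)\<^sup>2 \<le> M\<^sup>2 * (1 + 15 * (b / M))"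
        using M2 by (simp add: power2_eq_square field_simps)
    qed (use \<alpha> in \<open>auto intro: mult_nonpos_nonneg\<close>)
    also have "\<dots> = 3 * N\<^sup>2 * (1 + 15 * (b / M))"
      using H1 by (simp add: mult.assoc[symmetric])
    finally show ?thesis
      using A by (simp add: algebra_simps)
  qed
  have scale: "x * u \<le> 2 * c * v" if "u \<le> v" "0 \<le> v" for u v
  proof -
    have "x * u \<le> x * v"
      using that x0 by (intro mult_left_mono) auto
    also have "\<dots> \<le> 2 * c * v"
      using that x by (intro mult_right_mono) auto
    finally show ?thesis .
  qed
  have "x * (A - B) \<le> 192 * (c * c * N)"
    using scale[OF upper] c0 N0 by simp
  also have "\<dots> \<le> 192 * \<epsilon>"
    using H2 by simp
  finally have up: "x * (A - B) \<le> 192 * \<epsilon>" .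
  have "x * (B - A) \<le> 90 * (c * N\<^sup>2 * (b / M))"
    using scale[OF lower] b0 M2 by simp
  also have "\<dots> \<le> 90 * (\<epsilon> * M * (b / M))"
    using H3 b0 M2 by (intro mult_left_mono mult_right_mono) auto
  also have "\<dots> = 90 * (\<epsilon> * b)"
    using M2 by simp
  also have "\<dots> \<le> 90 * \<epsilon>"
    using b1 \<epsilon> by (simp add: mult_left_le)
  finally have lo: "x * (B - A) \<le> 90 * \<epsilon>" .
  \<comment> \<open>The bounds found are (192 + 7 \<kappa>) \<epsilon> from above and -(90 + 1)
    \<epsilon> from below; 300 leaves room in both.\<close>
  have "x * (A - B) = - (x * (B - A))"
    by (simp add: algebra_simps)
  then show ?thesis
    unfolding split \<kappa>_def[symmetric] distrib_right abs_le_iff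
    using up lo E3 E4 \<epsilon> by auto
qed


section \<open>The high-low interaction\<close>

lemma sobolev_weight_measurable [measurable]: "sobolev_weight s1 s2 \<in> borel_measurable borel"
  unfolding sobolev_weight_def japanese_bracket_def case_prod_unfold by measurable

lemma sobolev_norm_spectral_dist:
  assumes g: "integrable lborel g"
  shows "sobolev_norm s1 s2 (spectral_dist g) = sqrt (LINT \<zeta>|lborel. sobolev_weight s1 s2 \<zeta> * (cmod (g \<zeta>))\<^sup>2)"
proof -
  note F = fourier_fun_unique[OF regular_dist_fourier_spectral_dist[OF g]]
  have [measurable]: "fourier_fun (spectral_dist g) \<in> borel_measurable borel" "g \<in> borel_measurable borel"
    using F(1) g by (auto simp: regular_def)
  have "AE \<zeta> in lborel. sobolev_weight s1 s2 \<zeta> * (cmod (fourier_fun (spectral_dist g) \<zeta>))\<^sup>2 = sobolev_weight s1 s2 \<zeta> * (cmod (g \<zeta>))\<^sup>2"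
    using F(2) by eventually_elim simp
  then show ?thesis
    unfolding sobolev_norm_def by (intro arg_cong[where f = sqrt] integral_cong_AE) measurable
qed

lemma spectral_dist_in_sobolev_iff:
  assumes g: "integrable lborel g"
  shows "spectral_dist g \<in> sobolev s1 s2 \<longleftrightarrow>
    integrable lborel (\<lambda>\<zeta>. sobolev_weight s1 s2 \<zeta> * (cmod (g \<zeta>))\<^sup>2)"
proof
  assume "spectral_dist g \<in> sobolev s1 s2"
  then obtain h where h: "regular (dist_fourier (spectral_dist g)) h"
    and int: "integrable lborel (\<lambda>\<zeta>. sobolev_weight s1 s2 \<zeta> * (cmod (h \<zeta>))\<^sup>2)"
    by (auto simp: sobolev_def)
  have [measurable]: "h \<in> borel_measurable borel" "g \<in> borel_measurable borel"
    using h g by (auto simp: regular_def)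
  have "AE \<zeta> in lborel. h \<zeta> = g \<zeta>"
    by (rule regular_unique[OF h regular_dist_fourier_spectral_dist[OF g]])
  then have "AE \<zeta> in lborel. sobolev_weight s1 s2 \<zeta> * (cmod (h \<zeta>))\<^sup>2 = sobolev_weight s1 s2 \<zeta> * (cmod (g \<zeta>))\<^sup>2"
    by eventually_elim simp
  then show "integrable lborel (\<lambda>\<zeta>. sobolev_weight s1 s2 \<zeta> * (cmod (g \<zeta>))\<^sup>2)"
    by (rule integrable_cong_AE_imp[OF int, rotated]) measurable
next
  assume "integrable lborel (\<lambda>\<zeta>. sobolev_weight s1 s2 \<zeta> * (cmod (g \<zeta>))\<^sup>2)"
  then show "spectral_dist g \<in> sobolev s1 s2"
    using tempered_spectral_dist[OF g] regular_dist_fourier_spectral_dist[OF g] by (auto simp: sobolev_def)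
qed

text \<open>Eliminates X: what is left is an inequality between explicit integrals on the Fourier
  side, with K independent of g.\<close>

lemma bilinear_bound_if_contraction_space:
  assumes T: "0 < T" and space: "normed_function_space X nX" and emb: "continuously_embedded T s1 s2 X nX"
    and lin: "\<And>\<phi>. \<phi> \<in> sobolev s1 s2 \<Longrightarrow> on_interval T (\<lambda>t. W \<alpha> t \<phi>) \<in> X \<and>
        nX (on_interval T (\<lambda>t. W \<alpha> t \<phi>)) \<le> C * sobolev_norm s1 s2 \<phi>"
    and bil: "\<And>u D. u \<in> X \<Longrightarrow> is_duhamel \<alpha> T u D \<Longrightarrow> D \<in> X \<and> nX D \<le> C * (nX u)\<^sup>2"
  obtains K where "0 \<le> K" and
    "\<And>g. integrable lborel g \<Longrightarrow> integrable lborel (\<lambda>\<zeta>. of_real (fst \<zeta>) * g \<zeta>) \<Longrightarrow>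
      integrable lborel (\<lambda>\<zeta>. sobolev_weight s1 s2 \<zeta> * (cmod (g \<zeta>))\<^sup>2) \<Longrightarrow>
      integrable lborel (\<lambda>\<zeta>. sobolev_weight s1 s2 \<zeta> * (cmod (duhamel \<alpha> g T \<zeta>))\<^sup>2) \<and>
      sqrt (LINT \<zeta>|lborel. sobolev_weight s1 s2 \<zeta> * (cmod (duhamel \<alpha> g T \<zeta>))\<^sup>2)
        \<le> K * (LINT \<zeta>|lborel. sobolev_weight s1 s2 \<zeta> * (cmod (g \<zeta>))\<^sup>2)"
proof -
  obtain K0 where K0: "\<And>u t. u \<in> X \<Longrightarrow> t \<in> {-T..T} \<Longrightarrow> sobolev_norm s1 s2 (u t) \<le> K0 * nX u"
    and X: "X \<subseteq> C_sobolev T s1 s2"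
    using emb unfolding continuously_embedded_def by blast
  have nonneg: "0 \<le> nX u" if "u \<in> X" for u
    using space that unfolding normed_function_space_def by blast
  show thesis
  \<comment> \<open>The signs of C and of the embedding constant are not prescribed, hence the
    absolute values. C enters once from the Duhamel bound and twice from squaring the linear
    one.\<close>
  proof (rule that[of "\<bar>K0\<bar> * (\<bar>C\<bar> * C\<^sup>2)"])
    fix g :: plane_fun
    assume g: "integrable lborel g" and xg: "integrable lborel (\<lambda>\<zeta>. of_real (fst \<zeta>) * g \<zeta>)"
      and wg: "integrable lborel (\<lambda>\<zeta>. sobolev_weight s1 s2 \<zeta> * (cmod (g \<zeta>))\<^sup>2)"
    define I where "I = (LINT \<zeta>|lborel. sobolev_weight s1 s2 \<zeta> * (cmod (g \<zeta>))\<^sup>2)"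
    have I: "0 \<le> I"
      unfolding I_def by (intro integral_nonneg_AE AE_I2 mult_nonneg_nonneg) (auto intro: less_imp_le[OF sobolev_weight_pos])
    define u where "u = on_interval T (\<lambda>t. W \<alpha> t (spectral_dist g))"
    obtain D where D: "is_duhamel \<alpha> T u D" and DT: "D T = spectral_dist (duhamel \<alpha> g T)"
      unfolding u_def using is_duhamel_spectral_dist[OF g xg T] by blast
    note d = integrable_duhamel[OF g xg, of \<alpha> T]
    have u: "u \<in> X" "nX u \<le> C * sqrt I"
      using lin[of "spectral_dist g"] wg g
      unfolding u_def I_def sobolev_norm_spectral_dist[OF g, symmetric] by (auto simp: spectral_dist_in_sobolev_iff)
    have DX: "D \<in> X" "nX D \<le> C * (nX u)\<^sup>2"
      using bil[OF u(1) D] by auto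
    \<comment> \<open>Membership supplies integrability; otherwise the integral in the norm could be
      the default value 0 and bound nothing.\<close>
    have "D T \<in> sobolev s1 s2"
      using DX(1) X T by (auto simp: C_sobolev_def)
    then have int: "integrable lborel (\<lambda>\<zeta>. sobolev_weight s1 s2 \<zeta> * (cmod (duhamel \<alpha> g T \<zeta>))\<^sup>2)"
      unfolding DT spectral_dist_in_sobolev_iff[OF d] .
    have "(nX u)\<^sup>2 \<le> (C * sqrt I)\<^sup>2"
      using u nonneg by (intro power_mono) auto
    then have "(nX u)\<^sup>2 \<le> C\<^sup>2 * I"
      using I by (simp add: power_mult_distrib)
    then have "\<bar>C\<bar> * (nX u)\<^sup>2 \<le> \<bar>C\<bar> * (C\<^sup>2 * I)"
      by (intro mult_left_mono) auto
    moreover have "nX D \<le> \<bar>C\<bar> * (nX u)\<^sup>2"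
      using DX(2) mult_right_mono[OF abs_ge_self[of C], of "(nX u)\<^sup>2"] by simp
    ultimately have "\<bar>K0\<bar> * nX D \<le> \<bar>K0\<bar> * (\<bar>C\<bar> * (C\<^sup>2 * I))"
      by (intro mult_left_mono) auto
    moreover have "sobolev_norm s1 s2 (D T) \<le> \<bar>K0\<bar> * nX D"
      using K0[OF DX(1), of T] T mult_right_mono[OF abs_ge_self[of K0] nonneg[OF DX(1)]] by simp
    ultimately have "sobolev_norm s1 s2 (D T) \<le> \<bar>K0\<bar> * (\<bar>C\<bar> * C\<^sup>2) * I"
      by (simp add: mult.assoc)
    then show "integrable lborel (\<lambda>\<zeta>. sobolev_weight s1 s2 \<zeta> * (cmod (duhamel \<alpha> g T \<zeta>))\<^sup>2) \<and>
      sqrt (LINT \<zeta>|lborel. sobolev_weight s1 s2 \<zeta> * (cmod (duhamel \<alpha> g T \<zeta>))\<^sup>2)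
        \<le> \<bar>K0\<bar> * (\<bar>C\<bar> * C\<^sup>2) * (LINT \<zeta>|lborel. sobolev_weight s1 s2 \<zeta> * (cmod (g \<zeta>))\<^sup>2)"
      using int unfolding DT sobolev_norm_spectral_dist[OF d] I_def by simp
  qed simp
qed

section \<open>The two-bump datum and its second iterate\<close>

lemma cos_ge_half: "1 / 2 \<le> cos x" if "\<bar>x\<bar> \<le> 1" for x :: real
proof -
  have "\<bar>sin (x / 2)\<bar> \<le> \<bar>x / 2\<bar>"
    by (rule abs_sin_x_le_abs_x)
  then have "\<bar>sin (x / 2)\<bar> \<le> 1 / 2"
    using that by simp
  then have "\<bar>sin (x / 2)\<bar>\<^sup>2 \<le> (1 / 2)\<^sup>2"
    by (intro power_mono) auto
  then show ?thesis
    using cos_double_sin[of "x / 2"] by (simp add: power2_eq_square)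
qed

lemma integrable_indicator_cbox: "integrable lborel (\<lambda>z. indicator (cbox a b) z :: real)"
  using emeasure_lborel_cbox_finite[of a b] by (intro integrable_real_indicator) simp_all

lemma integral_indicator_cbox_Pair:
  fixes a b c d :: real
  assumes "a \<le> c" "b \<le> d"
  shows "(LINT z|lborel. indicator (cbox (a, b) (c, d)) z) = (c - a) * (d - b)"
  using assms by (simp add: content_Pair)

lemma mem_cbox_real_Pair:
  "z \<in> cbox (a, b) (c, d) \<longleftrightarrow> a \<le> fst z \<and> fst z \<le> c \<and> b \<le> snd z \<and> snd z \<le> d" for z :: "real \<times> real"
  by (cases z) (auto simp: cbox_def Basis_prod_def)

text \<open>The high box has twice the sides of the low one, so that for every output frequency in a
  third box of size c by b, subtracting the whole low box stays inside the high box. The low box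
  begins at c, away from the singularity of \<open>dispersion\<close> at \<xi> = 0. B will be the
  inverse square root of the weight at (N, M).\<close>

definition two_bumps :: "real \<Rightarrow> real \<Rightarrow> real \<Rightarrow> real \<Rightarrow> real \<Rightarrow> real \<times> real \<Rightarrow> real" where
  "two_bumps B c b N M \<zeta> =
    indicator (cbox (c, 0) (2 * c, b)) \<zeta> + B * indicator (cbox (N, M) (N + 2 * c, M + 2 * b)) \<zeta>"

lemma two_bumps_measurable [measurable]: "two_bumps B c b N M \<in> borel_measurable borel"
  unfolding two_bumps_def by measurable

lemma integrable_two_bumps: "integrable lborel (\<lambda>\<zeta>. complex_of_real (two_bumps B c b N M \<zeta>))"
  unfolding two_bumps_def
  by (intro integrable_of_real Bochner_Integration.integrable_add integrable_mult_right integrable_indicator_cbox)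

lemma integrable_x_two_bumps:
  "integrable lborel (\<lambda>\<zeta>. of_real (fst \<zeta>) * complex_of_real (two_bumps B c b N M \<zeta>))"
proof (rule Bochner_Integration.integrable_bound)
  let ?k = "\<bar>2 * c\<bar> + \<bar>c\<bar> + \<bar>N\<bar> + \<bar>N + 2 * c\<bar>"
  show "integrable lborel (\<lambda>\<zeta>. ?k * complex_of_real (two_bumps B c b N M \<zeta>))"
    by (intro integrable_mult_right integrable_two_bumps)
  show "AE \<zeta> in lborel. norm (of_real (fst \<zeta>) * complex_of_real (two_bumps B c b N M \<zeta>))
      \<le> norm (?k * complex_of_real (two_bumps B c b N M \<zeta>))"
  proof (intro AE_I2)
    fix \<zeta> :: "real \<times> real"
    have "\<bar>fst \<zeta>\<bar> \<le> ?k \<or> two_bumps B c b N M \<zeta> = 0"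
      unfolding two_bumps_def indicator_def mem_cbox_real_Pair by auto
    then show "norm (of_real (fst \<zeta>) * complex_of_real (two_bumps B c b N M \<zeta>))
      \<le> norm (?k * complex_of_real (two_bumps B c b N M \<zeta>))"
    proof
      assume "\<bar>fst \<zeta>\<bar> \<le> ?k"
      then show ?thesis
        unfolding norm_mult norm_of_real by (rule mult_right_mono[OF order.trans[OF _ abs_ge_self]]) auto
    qed simp
  qed
qed measurable

text \<open>For output frequencies in the third box, only the interaction of the two bumps contributes, and
  near resonance the oscillating factor has real part at least one half.\<close>

lemma duhamel_two_bumps_ge:
  assumes T: "0 < T" and B: "0 < B" and c: "0 < c" "3 * c < N" and b: "0 < b"
    and res: "\<And>\<zeta>1 \<zeta>2. \<zeta>1 \<in> cbox (c, 0) (2 * c, b) \<Longrightarrow> \<zeta>2 \<in> cbox (N, M) (N + 2 * c, M + 2 * b) \<Longrightarrow>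
      T * \<bar>dispersion \<alpha> (\<zeta>1 + \<zeta>2) - dispersion \<alpha> \<zeta>1 - dispersion \<alpha> \<zeta>2\<bar> \<le> 1"
    and \<zeta>: "\<zeta> \<in> cbox (N + 2 * c, M + b) (N + 3 * c, M + 2 * b)"
  shows "T / 2 * (1 / (2 * pi)\<^sup>2) * (N * B * (c * b)) \<le> cmod (duhamel \<alpha> (\<lambda>\<zeta>. of_real (two_bumps B c b N M \<zeta>)) T \<zeta>)"
proof -
  let ?D1 = "cbox (c, 0) (2 * c, b)" and ?D2 = "cbox (N, M) (N + 2 * c, M + 2 * b)"
  \<comment> \<open>\<zeta> minus the low box, a subset of the high box: here the derivative falls
    on the high-frequency factor.\<close>
  let ?E = "cbox (fst \<zeta> - 2 * c, snd \<zeta> - b) (fst \<zeta> - c, snd \<zeta>)"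
  let ?G = "two_bumps B c b N M" and ?c0 = "1 / (2 * pi)\<^sup>2"
  let ?g = "\<lambda>\<zeta>. complex_of_real (?G \<zeta>)"
  define \<Omega> where "\<Omega> \<zeta>' = dispersion \<alpha> \<zeta> - dispersion \<alpha> (\<zeta> - \<zeta>') - dispersion \<alpha> \<zeta>'" for \<zeta>'
  define P where "P \<zeta>' = fst \<zeta>' * ?G (\<zeta> - \<zeta>') * ?G \<zeta>'" for \<zeta>'
  define Q where "Q r = (LINT \<zeta>'|lborel. cis (r * \<Omega> \<zeta>') * of_real (P \<zeta>'))" for r
  have [measurable]: "\<Omega> \<in> borel_measurable borel" "P \<in> borel_measurable borel"
    unfolding \<Omega>_def P_def by measurable
  have G_nonneg: "0 \<le> ?G \<zeta>'" and G_le: "?G \<zeta>' \<le> 1 + B" for \<zeta>'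
    using B by (auto simp: two_bumps_def indicator_def)
  have int_P: "integrable lborel (\<lambda>\<zeta>'. complex_of_real (P \<zeta>'))"
  proof -
    have "integrable lborel (\<lambda>\<zeta>'. of_real (fst \<zeta>') * ?g \<zeta>' * complex_of_real (?G (\<zeta> - \<zeta>')))"
      by (rule integrable_mult_bounded[OF integrable_x_two_bumps, where C = "1 + B"])
         (use G_nonneg G_le in auto)
    then show ?thesis
      by (simp add: P_def mult_ac)
  qed
  have int_Q: "integrable lborel (\<lambda>\<zeta>'. cis (r * \<Omega> \<zeta>') * of_real (P \<zeta>'))" for r
    by (intro integrable_cis_mult int_P) measurable
  \<comment> \<open>The dependence on r collects in the phase r \<Omega>; the outer phase is
    constant in r and disappears in the modulus.\<close>
  have duhamel: "evolved \<alpha> (nonlinearity \<alpha> ?g r) (T - r) \<zeta> = \<i> * cis (- T * dispersion \<alpha> \<zeta>) * ?c0 * Q r" for r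
  proof -
    have "cis (- (T - r) * dispersion \<alpha> \<zeta>) * (evolved \<alpha> ?g r (\<zeta> - \<zeta>') * (\<i> * of_real (fst \<zeta>') * evolved \<alpha> ?g r \<zeta>'))
        = \<i> * cis (- T * dispersion \<alpha> \<zeta>) * (cis (r * \<Omega> \<zeta>') * of_real (P \<zeta>'))" for \<zeta>'
    proof -
      have "cis (- (T - r) * dispersion \<alpha> \<zeta>) * cis (- r * dispersion \<alpha> (\<zeta> - \<zeta>')) * cis (- r * dispersion \<alpha> \<zeta>')
          = cis (- T * dispersion \<alpha> \<zeta>) * cis (r * \<Omega> \<zeta>')"
        unfolding cis_mult \<Omega>_def by (simp add: algebra_simps)
      then show ?thesis
        by (simp add: evolved_def P_def mult_ac)
    qed
    then have "cis (- (T - r) * dispersion \<alpha> \<zeta>) * (LINT \<zeta>'|lborel. evolved \<alpha> ?g r (\<zeta> - \<zeta>') * (\<i> * of_real (fst \<zeta>') * evolved \<alpha> ?g r \<zeta>'))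
        = \<i> * cis (- T * dispersion \<alpha> \<zeta>) * Q r"
      unfolding Q_def integral_mult_right_zero[symmetric] by (simp only:)
    moreover have "evolved \<alpha> (nonlinearity \<alpha> ?g r) (T - r) \<zeta> = of_real ?c0 *
        (cis (- (T - r) * dispersion \<alpha> \<zeta>) * (LINT \<zeta>'|lborel. evolved \<alpha> ?g r (\<zeta> - \<zeta>') * (\<i> * of_real (fst \<zeta>') * evolved \<alpha> ?g r \<zeta>')))"
      unfolding evolved_def[of \<alpha> "nonlinearity \<alpha> ?g r" "T - r"]
      unfolding nonlinearity_def convolve_def by (rule mult.left_commute)
    ultimately show ?thesis
      by (simp only: mult_ac)
  qed
  have Re_Q: "N * B * (c * b) / 2 \<le> Re (Q r)" if r: "r \<in> {0<..<T}" for r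
  proof -
    have pointwise: "N * B / 2 * indicator ?E \<zeta>' \<le> cos (r * \<Omega> \<zeta>') * P \<zeta>'" for \<zeta>'
    proof (cases "?G (\<zeta> - \<zeta>') \<noteq> 0 \<and> ?G \<zeta>' \<noteq> 0")
      case True
      \<comment> \<open>A box cannot interact with itself into \<zeta>: two low first coordinates
        add up to at most 4 c < N + 2 c, two high ones to at least 2 N > N + 3 c.\<close>
      have "(\<zeta> - \<zeta>' \<in> ?D1 \<and> \<zeta>' \<in> ?D2) \<or> (\<zeta>' \<in> ?D1 \<and> \<zeta> - \<zeta>' \<in> ?D2)"
        using True \<zeta> c unfolding two_bumps_def indicator_def mem_cbox_real_Pair by (auto split: if_splits)
      then have "T * \<bar>\<Omega> \<zeta>'\<bar> \<le> 1 \<and> 0 \<le> fst \<zeta>'"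
      proof
        assume D: "\<zeta> - \<zeta>' \<in> ?D1 \<and> \<zeta>' \<in> ?D2"
        then have "0 \<le> fst \<zeta>'"
          using c by (simp add: mem_cbox_real_Pair)
        then show ?thesis
          using res[of "\<zeta> - \<zeta>'" \<zeta>'] D by (simp add: \<Omega>_def)
      next
        assume D: "\<zeta>' \<in> ?D1 \<and> \<zeta> - \<zeta>' \<in> ?D2"
        then have "0 \<le> fst \<zeta>'"
          using c by (simp add: mem_cbox_real_Pair)
        moreover have "dispersion \<alpha> (\<zeta>' + (\<zeta> - \<zeta>')) - dispersion \<alpha> \<zeta>' - dispersion \<alpha> (\<zeta> - \<zeta>') = \<Omega> \<zeta>'"
          by (simp add: \<Omega>_def)
        ultimately show ?thesis
          using res[of \<zeta>' "\<zeta> - \<zeta>'"] D by simp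
      qed
      then have "T * \<bar>\<Omega> \<zeta>'\<bar> \<le> 1" and fst: "0 \<le> fst \<zeta>'"
        by simp_all
      moreover have "\<bar>r * \<Omega> \<zeta>'\<bar> \<le> T * \<bar>\<Omega> \<zeta>'\<bar>"
        using r by (simp add: abs_mult mult_right_mono)
      ultimately have cos: "1 / 2 \<le> cos (r * \<Omega> \<zeta>')"
        by (intro cos_ge_half) linarith
      \<comment> \<open>Both orders of interaction are nonnegative, so a lower bound may keep
        \<open>?E\<close> alone, where the derivative factor is at least N.\<close>
      have P: "N * B * indicator ?E \<zeta>' \<le> P \<zeta>'"
      proof (cases "\<zeta>' \<in> ?E")
        case True
        then have "\<zeta> - \<zeta>' \<in> ?D1" and D2: "\<zeta>' \<in> ?D2"
          using \<zeta> c b by (auto simp: mem_cbox_real_Pair)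
        then have "1 \<le> ?G (\<zeta> - \<zeta>')" "B \<le> ?G \<zeta>'"
          using B by (auto simp: two_bumps_def indicator_def)
        moreover have "N \<le> fst \<zeta>'"
          using D2 by (simp add: mem_cbox_real_Pair)
        ultimately have "N * 1 * B \<le> P \<zeta>'"
          unfolding P_def using B c by (intro mult_mono) auto
        then show ?thesis
          using True by simp
      next
        case False
        then show ?thesis
          using fst G_nonneg by (simp add: P_def)
      qed
      moreover have "0 \<le> N * B * indicator ?E \<zeta>'"
        using B c by simp
      ultimately have "1 / 2 * (N * B * indicator ?E \<zeta>') \<le> cos (r * \<Omega> \<zeta>') * P \<zeta>'"
        using cos by (intro mult_mono) auto
      then show ?thesis
        by simp
    next
      case False
      have "\<zeta>' \<notin> ?E"
      proof
        assume "\<zeta>' \<in> ?E"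
        then have "\<zeta> - \<zeta>' \<in> ?D1" "\<zeta>' \<in> ?D2"
          using \<zeta> c b by (auto simp: mem_cbox_real_Pair)
        then have "1 \<le> ?G (\<zeta> - \<zeta>')" "B \<le> ?G \<zeta>'"
          using B by (auto simp: two_bumps_def indicator_def)
        then show False
          using False B by auto
      qed
      then show ?thesis
        using False by (auto simp: P_def)
    qed
    have "N * B * (c * b) / 2 = (LINT \<zeta>'|lborel. N * B / 2 * indicator ?E \<zeta>')"
      unfolding integral_mult_right_zero using c b by (subst integral_indicator_cbox_Pair) auto
    also have "\<dots> \<le> (LINT \<zeta>'|lborel. Re (cis (r * \<Omega> \<zeta>') * of_real (P \<zeta>')))"
    proof (rule Bochner_Integration.integral_mono)
      show "integrable lborel (\<lambda>\<zeta>'. N * B / 2 * indicator ?E \<zeta>')"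
        by (intro integrable_mult_right integrable_indicator_cbox)
      show "integrable lborel (\<lambda>\<zeta>'. Re (cis (r * \<Omega> \<zeta>') * of_real (P \<zeta>')))"
        by (rule integrable_Re[OF int_Q])
      show "N * B / 2 * indicator ?E \<zeta>' \<le> Re (cis (r * \<Omega> \<zeta>') * of_real (P \<zeta>'))" for \<zeta>'
        using pointwise[of \<zeta>'] by simp
    qed
    also have "\<dots> = Re (Q r)"
      unfolding Q_def using int_Q by (rule integral_Re)
    finally show ?thesis .
  qed
  have Q_int: "set_integrable lborel {0<..<T} Q"
    unfolding set_integrable_def
  proof (rule Bochner_Integration.integrable_bound)
    show "integrable lborel (\<lambda>r. indicator {0<..<T} r * (LINT \<zeta>'|lborel. cmod (of_real (P \<zeta>'))))"
      using emeasure_lborel_box_finite[of 0 T]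
      by (intro integrable_mult_left integrable_real_indicator) (simp_all add: box_real)
    have "cmod (Q r) \<le> (LINT \<zeta>'|lborel. cmod (of_real (P \<zeta>')))" for r
      unfolding Q_def by (rule order.trans[OF integral_norm_bound]) (simp add: norm_mult)
    then show "AE r in lborel. norm (indicator {0<..<T} r *\<^sub>R Q r) \<le> norm (indicator {0<..<T} r * (LINT \<zeta>'|lborel. cmod (of_real (P \<zeta>'))))"
      by (intro AE_I2) (auto simp: indicator_def intro: order.trans[OF _ abs_ge_self])
    have "Q \<in> borel_measurable borel"
      unfolding Q_def by measurable
    then show "(\<lambda>r. indicator {0<..<T} r *\<^sub>R Q r) \<in> borel_measurable lborel"
      by measurable
  qed
  have "T * (N * B * (c * b) / 2) = (LINT r:{0<..<T}|lborel. N * B * (c * b) / 2)"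
    using T by (simp add: set_lebesgue_integral_def)
  also have "\<dots> \<le> (LINT r:{0<..<T}|lborel. Re (Q r))"
  proof (rule set_integral_mono)
    show "set_integrable lborel {0<..<T} (\<lambda>r. N * B * (c * b) / 2)"
      using T by (simp add: set_integrable_def)
    show "set_integrable lborel {0<..<T} (\<lambda>r. Re (Q r))"
      using integrable_Re[OF Q_int[unfolded set_integrable_def]] by (simp add: set_integrable_def)
  qed (use Re_Q in auto)
  also have "\<dots> = Re (LINT r:{0<..<T}|lborel. Q r)"
    using integral_Re[OF Q_int[unfolded set_integrable_def]] by (simp add: set_lebesgue_integral_def)
  also have "\<dots> \<le> cmod (LINT r:{0<..<T}|lborel. Q r)"
    by (rule complex_Re_le_cmod)
  finally have "?c0 * (T * (N * B * (c * b) / 2)) \<le> ?c0 * cmod (LINT r:{0<..<T}|lborel. Q r)"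
    by (intro mult_left_mono) auto
  also have "\<dots> = cmod (\<i> * cis (- T * dispersion \<alpha> \<zeta>) * ?c0 * (LINT r:{0<..<T}|lborel. Q r))"
    by (simp add: norm_mult norm_divide norm_power)
  also have "\<i> * cis (- T * dispersion \<alpha> \<zeta>) * ?c0 * (LINT r:{0<..<T}|lborel. Q r) = duhamel \<alpha> ?g T \<zeta>"
    unfolding duhamel_def duhamel by (rule set_integral_mult_right[symmetric])
  finally show ?thesis
    by (simp add: mult_ac)
qed

text \<open>B normalises the high bump: its weighted square is at most R on an area 4 c b. On the
  low box, of area c b, the weight is at most R times its value 2 at the origin. Hence 6 = 4 + 2,
  with no power of N left.\<close>

lemma two_bumps_sobolev_bound:
  fixes s1 s2 c b N M :: real
  assumes c: "0 < c" "c \<le> 1" and b: "0 < b" "b \<le> 1" and N: "4 \<le> N" and M: "0 \<le> M"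
  defines "R \<equiv> 4 powr (2 * (\<bar>s1\<bar> + \<bar>s2\<bar>))" and "B \<equiv> 1 / sqrt (sobolev_weight s1 s2 (N, M))"
  shows "integrable lborel (\<lambda>\<zeta>. sobolev_weight s1 s2 \<zeta> * (cmod (of_real (two_bumps B c b N M \<zeta>)))\<^sup>2)"
    and "(LINT \<zeta>|lborel. sobolev_weight s1 s2 \<zeta> * (cmod (of_real (two_bumps B c b N M \<zeta>)))\<^sup>2) \<le> 6 * R * (c * b)"
proof -
  let ?D1 = "cbox (c, 0) (2 * c, b)" and ?D2 = "cbox (N, M) (N + 2 * c, M + 2 * b)"
  let ?w = "sobolev_weight s1 s2"
  let ?f = "\<lambda>\<zeta>. ?w \<zeta> * (cmod (of_real (two_bumps B c b N M \<zeta>)))\<^sup>2"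
  let ?h = "\<lambda>\<zeta>. 2 * R * indicator ?D1 \<zeta> + R * indicator ?D2 \<zeta>"
  have R: "0 < R"
    by (simp add: R_def)
  have B2: "?w (N, M) * B\<^sup>2 = 1"
    using sobolev_weight_pos[of s1 s2 "(N, M)"] by (simp add: B_def power_divide)
  have w1: "?w \<zeta> \<le> 2 * R" if "\<zeta> \<in> ?D1" for \<zeta>
    using sobolev_weight_compare(1)[of 0 0 "fst \<zeta>" "snd \<zeta>" s1 s2] that c b
    by (simp add: mem_cbox_real_Pair R_def sobolev_weight_def[of s1 s2] japanese_bracket_def mult.commute)
  have w2: "?w \<zeta> * B\<^sup>2 \<le> R" if "\<zeta> \<in> ?D2" for \<zeta>
  proof -
    have "?w \<zeta> \<le> R * ?w (N, M)"
      using sobolev_weight_compare(1)[of N M "fst \<zeta> - N" "snd \<zeta> - M" s1 s2] that c b N M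
      by (simp add: mem_cbox_real_Pair R_def)
    then have "?w \<zeta> * B\<^sup>2 \<le> R * ?w (N, M) * B\<^sup>2"
      by (rule mult_right_mono) simp
    then show ?thesis
      using B2 by (simp add: mult.assoc)
  qed
  have le: "?f \<zeta> \<le> ?h \<zeta>" for \<zeta>
  proof -
    \<comment> \<open>The boxes are disjoint, as 2 c \<le> 2 < N, so the square has no cross
      term.\<close>
    consider "\<zeta> \<in> ?D1" "\<zeta> \<notin> ?D2" | "\<zeta> \<notin> ?D1" "\<zeta> \<in> ?D2" | "\<zeta> \<notin> ?D1" "\<zeta> \<notin> ?D2"
      using c N by (auto simp: mem_cbox_real_Pair)
    then show ?thesis
      using w1[of \<zeta>] w2[of \<zeta>] by cases (simp_all add: two_bumps_def del: sobolev_weight_def)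
  qed
  have nonneg: "0 \<le> ?f \<zeta>" for \<zeta>
    using sobolev_weight_pos[of s1 s2 \<zeta>] by simp
  have h: "integrable lborel ?h"
    by (intro Bochner_Integration.integrable_add integrable_mult_right integrable_indicator_cbox)
  show f: "integrable lborel ?f"
  proof (rule Bochner_Integration.integrable_bound[OF h])
    show "AE \<zeta> in lborel. norm (?f \<zeta>) \<le> norm (?h \<zeta>)"
    proof (intro AE_I2)
      show "norm (?f \<zeta>) \<le> norm (?h \<zeta>)" for \<zeta>
        unfolding real_norm_def abs_of_nonneg[OF nonneg] by (rule order.trans[OF le abs_ge_self])
    qed
  qed measurable
  have "(LINT \<zeta>|lborel. ?f \<zeta>) \<le> (LINT \<zeta>|lborel. ?h \<zeta>)"
    by (intro Bochner_Integration.integral_mono f h le)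
  also have "\<dots> = 2 * R * (LINT \<zeta>|lborel. indicator ?D1 \<zeta>) + R * (LINT \<zeta>|lborel. indicator ?D2 \<zeta>)"
    by (subst Bochner_Integration.integral_add)
       (intro integrable_mult_right integrable_indicator_cbox | simp only: integral_mult_right_zero)+
  also have "\<dots> = 6 * R * (c * b)"
    using c b by (simp add: integral_indicator_cbox_Pair del: Bochner_Integration.integral_indicator)
  finally show "(LINT \<zeta>|lborel. ?f \<zeta>) \<le> 6 * R * (c * b)" .
qed

text \<open>The output box has area c b, and the weight on it is comparable to that at (N, M). In
  the application A is proportional to B, so this weight cancels against B^2.\<close>

lemma duhamel_sobolev_ge:
  fixes s1 s2 c b N M A :: real
  assumes c: "0 < c" "c \<le> 1" and b: "0 < b" "b \<le> 1" and N: "4 \<le> N" and M: "0 \<le> M" and A: "0 \<le> A"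
  defines "R \<equiv> 4 powr (2 * (\<bar>s1\<bar> + \<bar>s2\<bar>))"
  assumes ge: "\<And>\<zeta>. \<zeta> \<in> cbox (N + 2 * c, M + b) (N + 3 * c, M + 2 * b) \<Longrightarrow> A \<le> cmod (d \<zeta>)"
    and int: "integrable lborel (\<lambda>\<zeta>. sobolev_weight s1 s2 \<zeta> * (cmod (d \<zeta>))\<^sup>2)"
  shows "sobolev_weight s1 s2 (N, M) * A\<^sup>2 * (c * b) \<le> R * (LINT \<zeta>|lborel. sobolev_weight s1 s2 \<zeta> * (cmod (d \<zeta>))\<^sup>2)"
proof -
  let ?D3 = "cbox (N + 2 * c, M + b) (N + 3 * c, M + 2 * b)"
  let ?w = "sobolev_weight s1 s2"
  have R: "0 < R"
    by (simp add: R_def)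
  have le: "?w (N, M) * A\<^sup>2 * indicator ?D3 \<zeta> \<le> R * (?w \<zeta> * (cmod (d \<zeta>))\<^sup>2)" for \<zeta>
  proof (cases "\<zeta> \<in> ?D3")
    case True
    have "?w (N, M) \<le> R * ?w \<zeta>"
      using sobolev_weight_compare(2)[of N M "fst \<zeta> - N" "snd \<zeta> - M" s1 s2] True c b N M
      by (simp add: mem_cbox_real_Pair R_def)
    moreover have "A\<^sup>2 \<le> (cmod (d \<zeta>))\<^sup>2"
      using A ge[OF True] by (intro power_mono)
    ultimately have "?w (N, M) * A\<^sup>2 \<le> R * ?w \<zeta> * (cmod (d \<zeta>))\<^sup>2"
      using R sobolev_weight_pos[of s1 s2 \<zeta>] by (intro mult_mono) auto
    then show ?thesis
      using True by (simp add: mult.assoc)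
  next
    case False
    then show ?thesis
      using R sobolev_weight_pos[of s1 s2 \<zeta>] by simp
  qed
  have "?w (N, M) * A\<^sup>2 * (c * b) = (LINT \<zeta>|lborel. ?w (N, M) * A\<^sup>2 * indicator ?D3 \<zeta>)"
    unfolding integral_mult_right_zero using c b by (subst integral_indicator_cbox_Pair) auto
  also have "\<dots> \<le> (LINT \<zeta>|lborel. R * (?w \<zeta> * (cmod (d \<zeta>))\<^sup>2))"
    by (intro Bochner_Integration.integral_mono le integrable_mult_right integrable_indicator_cbox int)
  finally show ?thesis
    by simp
qed

theorem theorem4p3:
  fixes s1 s2 \<alpha> T :: real
  assumes "-1 \<le> \<alpha>" and "\<alpha> < 0" and "0 < T"
  shows "\<not> (\<exists>X nX C.
     normed_function_space X nX \<and>
     continuously_embedded T s1 s2 X nX \<and>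
     (\<forall>\<phi>\<in>sobolev s1 s2.
        on_interval T (\<lambda>t. W \<alpha> t \<phi>) \<in> X \<and>
        nX (on_interval T (\<lambda>t. W \<alpha> t \<phi>)) \<le> C * sobolev_norm s1 s2 \<phi>) \<and>
     (\<forall>u\<in>X. \<forall>D. is_duhamel \<alpha> T u D \<longrightarrow> D \<in> X \<and> nX D \<le> C * (nX u)\<^sup>2))"
proof (rule notI, elim exE conjE)
  fix X nX C
  assume X: "normed_function_space X nX" "continuously_embedded T s1 s2 X nX"
    and lin: "\<forall>\<phi>\<in>sobolev s1 s2. on_interval T (\<lambda>t. W \<alpha> t \<phi>) \<in> X \<and>
        nX (on_interval T (\<lambda>t. W \<alpha> t \<phi>)) \<le> C * sobolev_norm s1 s2 \<phi>"
    and bil: "\<forall>u\<in>X. \<forall>D. is_duhamel \<alpha> T u D \<longrightarrow> D \<in> X \<and> nX D \<le> C * (nX u)\<^sup>2"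
  let ?w = "sobolev_weight s1 s2"
  obtain K where K: "0 \<le> K" and bound: "\<And>g. integrable lborel g \<Longrightarrow> integrable lborel (\<lambda>\<zeta>. of_real (fst \<zeta>) * g \<zeta>) \<Longrightarrow>
      integrable lborel (\<lambda>\<zeta>. ?w \<zeta> * (cmod (g \<zeta>))\<^sup>2) \<Longrightarrow>
      integrable lborel (\<lambda>\<zeta>. ?w \<zeta> * (cmod (duhamel \<alpha> g T \<zeta>))\<^sup>2) \<and>
      sqrt (LINT \<zeta>|lborel. ?w \<zeta> * (cmod (duhamel \<alpha> g T \<zeta>))\<^sup>2) \<le> K * (LINT \<zeta>|lborel. ?w \<zeta> * (cmod (g \<zeta>))\<^sup>2)"
    by (rule bilinear_bound_if_contraction_space[OF \<open>0 < T\<close> X, of \<alpha> C]) (use lin bil in auto)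
  define R where "R = (4::real) powr (2 * (\<bar>s1\<bar> + \<bar>s2\<bar>))"
  define \<kappa> where "\<kappa> = 300 + 7 * sqrt (3 / - \<alpha>)"
  \<comment> \<open>Keeps T times the resonance function below 1, where the cosine is at least one
    half.\<close>
  define \<epsilon> where "\<epsilon> = min 1 (1 / (T * \<kappa>))"
  define \<tau> where "\<tau> = T / 2 * (1 / (2 * pi)\<^sup>2)"
  \<comment> \<open>The bound that the bilinear estimate will force on N^2 c b.\<close>
  define Z where "Z = R * (6 * K * R)\<^sup>2 / \<tau>\<^sup>2"
  \<comment> \<open>Chosen so that \<epsilon>^2 N^(-\<alpha> / 2) exceeds Z, possible since -
    \<alpha> / 2 is positive; the minimum 4 keeps the boxes apart.\<close>
  define N where "N = max 4 (((Z + 1) / \<epsilon>\<^sup>2) powr (- 2 / \<alpha>))"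
  define c where "c = \<epsilon> * N powr (- 1 / 2)"
  define b where "b = \<epsilon> * N powr (- (3 + \<alpha>) / 2)"
  define M where "M = sqrt (3 / - \<alpha>) * N powr ((3 - \<alpha>) / 2)"
  define B where "B = 1 / sqrt (?w (N, M))"
  define g where "g \<zeta> = complex_of_real (two_bumps B c b N M \<zeta>)" for \<zeta>
  have \<kappa>: "0 < \<kappa>"
    using assms by (simp add: \<kappa>_def add_pos_nonneg)
  have \<epsilon>: "0 < \<epsilon>" "\<epsilon> \<le> 1" "T * (\<kappa> * \<epsilon>) \<le> 1"
  proof -
    show "0 < \<epsilon>" "\<epsilon> \<le> 1"
      using \<kappa> assms by (auto simp: \<epsilon>_def)
    have "T * \<kappa> * \<epsilon> \<le> T * \<kappa> * (1 / (T * \<kappa>))"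
      using \<kappa> assms by (intro mult_left_mono) (auto simp: \<epsilon>_def)
    then show "T * (\<kappa> * \<epsilon>) \<le> 1"
      using \<kappa> assms by (simp add: mult.assoc)
  qed
  have \<tau>: "0 < \<tau>"
    using assms by (simp add: \<tau>_def)
  have R: "0 < R"
    by (simp add: R_def)
  have Z: "0 \<le> Z"
    using R by (simp add: Z_def)
  have N: "4 \<le> N"
    by (simp add: N_def)
  have Npowr_le: "N powr a \<le> 1" if "a \<le> 0" for a
    using powr_mono[OF that, of N] N by simp
  have c: "0 < c" "c \<le> 1" and b: "0 < b" "b \<le> 1" and M: "0 \<le> M"
    using \<epsilon> N assms Npowr_le[of "- 1 / 2"] Npowr_le[of "- (3 + \<alpha>) / 2"]
    by (auto simp: c_def b_def M_def mult_le_one)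
  have w: "0 < ?w (N, M)"
    by (rule sobolev_weight_pos)
  have B: "0 < B" "?w (N, M) * B\<^sup>2 = 1"
    using w by (simp_all add: B_def power_divide)
  have res: "T * \<bar>dispersion \<alpha> (\<zeta>1 + \<zeta>2) - dispersion \<alpha> \<zeta>1 - dispersion \<alpha> \<zeta>2\<bar> \<le> 1"
    if "\<zeta>1 \<in> cbox (c, 0) (2 * c, b)" "\<zeta>2 \<in> cbox (N, M) (N + 2 * c, M + 2 * b)" for \<zeta>1 \<zeta>2
  proof -
    have "\<bar>dispersion \<alpha> (\<zeta>1 + \<zeta>2) - dispersion \<alpha> \<zeta>1 - dispersion \<alpha> \<zeta>2\<bar> \<le> \<kappa> * \<epsilon>"
      using resonance_bound[OF assms(1,2) \<epsilon>(1,2) _ c_def b_def M_def, of "fst \<zeta>1" "snd \<zeta>1" "fst \<zeta>2" "snd \<zeta>2"] that N c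
      by (simp add: mem_cbox_real_Pair dispersion_def \<kappa>_def)
    then have "T * \<bar>dispersion \<alpha> (\<zeta>1 + \<zeta>2) - dispersion \<alpha> \<zeta>1 - dispersion \<alpha> \<zeta>2\<bar> \<le> T * (\<kappa> * \<epsilon>)"
      using assms by (intro mult_left_mono) auto
    with \<epsilon>(3) show ?thesis
      by linarith
  qed
  define I where "I = (LINT \<zeta>|lborel. ?w \<zeta> * (cmod (g \<zeta>))\<^sup>2)"
  define J where "J = (LINT \<zeta>|lborel. ?w \<zeta> * (cmod (duhamel \<alpha> g T \<zeta>))\<^sup>2)"
  have g: "integrable lborel (\<lambda>\<zeta>. ?w \<zeta> * (cmod (g \<zeta>))\<^sup>2)" and I: "I \<le> 6 * R * (c * b)"
    using two_bumps_sobolev_bound[OF c b N M, of s1 s2] by (simp_all add: g_def I_def R_def B_def)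
  have int: "integrable lborel (\<lambda>\<zeta>. ?w \<zeta> * (cmod (duhamel \<alpha> g T \<zeta>))\<^sup>2)" and J_le: "sqrt J \<le> K * I"
    using bound[of g] g integrable_two_bumps[of B c b N M] integrable_x_two_bumps[of B c b N M]
    by (simp_all add: g_def[abs_def] I_def J_def)
  have "?w (N, M) * (\<tau> * (N * B * (c * b)))\<^sup>2 * (c * b) \<le> R * J"
    unfolding R_def J_def
  proof (rule duhamel_sobolev_ge[OF c b N M])
    show "0 \<le> \<tau> * (N * B * (c * b))"
      using \<tau> N B c b by simp
    show "\<tau> * (N * B * (c * b)) \<le> cmod (duhamel \<alpha> g T \<zeta>)"
      if "\<zeta> \<in> cbox (N + 2 * c, M + b) (N + 3 * c, M + 2 * b)" for \<zeta>
      unfolding g_def[abs_def] \<tau>_def using c N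
      by (intro duhamel_two_bumps_ge[OF \<open>0 < T\<close> B(1) c(1) _ b(1) res that]) auto
  qed (rule int)
  also have "J \<le> (6 * K * R * (c * b))\<^sup>2"
  proof -
    have "0 \<le> J"
      unfolding J_def by (intro integral_nonneg_AE AE_I2 mult_nonneg_nonneg) (auto intro: less_imp_le[OF sobolev_weight_pos])
    moreover have "sqrt J \<le> 6 * K * R * (c * b)"
      using order.trans[OF J_le mult_left_mono[OF I K]] by (simp add: mult_ac)
    ultimately show ?thesis
      using power_mono[of "sqrt J" "6 * K * R * (c * b)" 2] by simp
  qed
  finally have "?w (N, M) * (\<tau> * (N * B * (c * b)))\<^sup>2 * (c * b) \<le> R * (6 * K * R * (c * b))\<^sup>2"
    using R by simp
  \<comment> \<open>Three factors c b on the left stand against two on the right: once the weight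
    cancels B^2, one c b remains beside N^2.\<close>
  moreover have "?w (N, M) * (\<tau> * (N * B * (c * b)))\<^sup>2 * (c * b) = (?w (N, M) * B\<^sup>2) * (\<tau>\<^sup>2 * (N\<^sup>2 * (c * b))) * (c * b)\<^sup>2"
    by (simp add: power_mult_distrib power2_eq_square mult_ac)
  moreover have "R * (6 * K * R * (c * b))\<^sup>2 = \<tau>\<^sup>2 * Z * (c * b)\<^sup>2"
    using \<tau> by (simp add: Z_def power_mult_distrib)
  ultimately have "\<tau>\<^sup>2 * (N\<^sup>2 * (c * b)) * (c * b)\<^sup>2 \<le> \<tau>\<^sup>2 * Z * (c * b)\<^sup>2"
    by (simp add: B(2))
  then have "N\<^sup>2 * (c * b) \<le> Z"
    using \<tau> c b by (simp add: mult_le_cancel_right mult_le_cancel_left)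
  moreover have "N\<^sup>2 * (c * b) = \<epsilon>\<^sup>2 * N powr (- \<alpha> / 2)"
  proof -
    have exponent: "2 + (- 1 / 2 + - (3 + \<alpha>) / 2) = - \<alpha> / 2"
      by (simp add: field_simps)
    have "N\<^sup>2 * (c * b) = \<epsilon>\<^sup>2 * (N powr 2 * (N powr (- 1 / 2) * N powr (- (3 + \<alpha>) / 2)))"
      using N by (simp add: c_def b_def power2_eq_square mult_ac)
    then show ?thesis
      unfolding powr_add[symmetric] exponent .
  qed
  moreover have "Z + 1 \<le> \<epsilon>\<^sup>2 * N powr (- \<alpha> / 2)"
  proof -
    let ?q = "(Z + 1) / \<epsilon>\<^sup>2"
    have q: "0 < ?q"
      using Z \<epsilon> by simp
    have "(?q powr (- 2 / \<alpha>)) powr (- \<alpha> / 2) = ?q"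
      using assms q Z by (simp add: powr_powr)
    then have "?q \<le> N powr (- \<alpha> / 2)"
      using powr_mono2[of "- \<alpha> / 2" "?q powr (- 2 / \<alpha>)" N] assms by (simp add: N_def)
    then show ?thesis
      using \<epsilon> by (simp add: pos_divide_le_eq mult.commute)
  qed
  ultimately show False
    by linarith
qed

end
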